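(* Let $\Bbbk$ be a field and let $A$ be a bialgebra over $\Bbbk$. Then the category $\mathsf{Mod}(A)$ of left $A$-modules, equipped with the usual direct sum and tensor product, is a tight bimonoidal category. If $A$ is a braided bialgebra, then $\mathsf{Mod}(A)$ is a tight braided bimonoidal category; if $A$ is a symmetric bialgebra, then $\mathsf{Mod}(A)$ is a tight symmetric bimonoidal category.
   Context: Bialgebras. For a bialgebra $A=(A,\mu,\eta,\Delta,\varepsilon)$ over $\Bbbk$ write $\Delta^{\mathrm{op}}$ for $\Delta$ followed by the swap. A braided (quasitriangular) bialgebra is a bialgebra with an invertible element $R\in A\otimes A$ (an $R$-matrix) such that $\Delta^{\mathrm{op}}(x)R=R\Delta(x)$ for $x\in A$, $(\Delta\otimes1)(R)=R_{13}R_{23}$ and $(1\otimes\Delta)(R)=R_{13}R_{12}$, where $R_{12},R_{13},R_{23}\in A^{\otimes3}$ are obtained from $R$ by inserting $1$ in the missing factor. It is symmetric if $R^{-1}=R^{\mathrm{op}}$, the image of $R$ under the swap. On $\mathsf{Mod}(A)$: $A$ acts on $V\otimes W=V\otimes_{\Bbbk}W$ through $\Delta$ and on $\Bbbk$ through $\varepsilon$; the additive structure is the direct sum with zero module and the usual symmetry; the structure isomorphisms (associativity, units, multiplicative zeros, distributivity) are those of $\Bbbk$-vector spaces; in the braided and symmetric cases the braiding is $\zeta^\otimes_{V,W}(v\otimes w)=\mathrm{swap}(R\cdot(v\otimes w))\in W\otimes V$. Write $AB$ for $A\otimes B$; $\otimes$ binds tighter than $\oplus$. A bimonoidal category is a category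 $C$ with a symmetric monoidal structure $(\oplus,0,\alpha^\oplus,\lambda^\oplus,\rho^\oplus,\zeta^\oplus)$, a monoidal structure $(\otimes,1,\alpha^\otimes,\lambda^\otimes,\rho^\otimes)$ (with $\alpha_{A,B,C}:(AB)C\to A(BC)$, $\lambda_A$, $\rho_A$ the left/right unit isomorphisms), natural isomorphisms $\lambda^\bullet_A:0A\to0$, $\rho^\bullet_A:A0\to 0$, and natural monomorphisms $\delta^l_{A,B,C}:A(B\oplus C)\to AB\oplus AC$, $\delta^r_{A,B,C}:(A\oplus B)C\to AC\oplus BC$, such that for all objects: $\delta^l_{A,C,B}(1\otimes\zeta^\oplus_{B,C})=\zeta^\oplus_{AB,AC}\delta^l_{A,B,C}$; $\delta^r_{B,A,C}(\zeta^\oplus_{A,B}\otimes1)=\zeta^\oplus_{AC,BC}\delta^r_{A,B,C}$; $\alpha^\oplus(\delta^r_{A,B,D}\oplus1)\delta^r_{A\oplus B,C,D}=(1\oplus\delta^r_{B,C,D})\delta^r_{A,B\oplus C,D}(\alpha^\oplus_{A,B,C}\otimes1)$; $\alpha^\oplus(\delta^l_{A,B,C}\oplus1)\delta^l_{A,B\oplus C,D}=(1\oplus\delta^l_{A,C,D})\delta^l_{A,B,C\oplus D}(1\otimes\alpha^\oplus_{B,C,D})$; $\delta^l_{A,BC,BD}(1\otimes\delta^l_{B,C,D})\alpha^\otimes_{A,B,C\oplus D}=(\alpha^\otimes_{A,B,C}\oplus\alpha^\otimes_{A,B,D})\delta^l_{AB,C,D}$; $(\alpha^\otimes_{A,C,D}\oplus\alpha^\otimes_{B,C,D})\delta^r_{AC,BC,D}(\delta^r_{A,B,C}\otimes1)=\delta^r_{A,B,CD}\alpha^\otimes_{A\oplus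 B,C,D}$; $(\alpha^\otimes_{A,B,D}\oplus\alpha^\otimes_{A,C,D})\delta^r_{AB,AC,D}(\delta^l_{A,B,C}\otimes1)=\delta^l_{A,BD,CD}(1\otimes\delta^r_{B,C,D})\alpha^\otimes_{A,B\oplus C,D}$; $\mu(\delta^l_{A,C,D}\oplus\delta^l_{B,C,D})\delta^r_{A,B,C\oplus D}=(\delta^r_{A,B,C}\oplus\delta^r_{A,B,D})\delta^l_{A\oplus B,C,D}$, where $\mu:(AC\oplus AD)\oplus(BC\oplus BD)\to(AC\oplus BC)\oplus(AD\oplus BD)$ is the coherence isomorphism exchanging the two middle summands; $\lambda^\bullet_0=\rho^\bullet_0$; $\lambda^\oplus_0(\lambda^\bullet_A\oplus\lambda^\bullet_B)\delta^l_{0,A,B}=\lambda^\bullet_{A\oplus B}$; $\lambda^\oplus_0(\rho^\bullet_A\oplus\rho^\bullet_B)\delta^r_{A,B,0}=\rho^\bullet_{A\oplus B}$; $\rho^\otimes_0=\lambda^\bullet_1$; $\lambda^\otimes_0=\rho^\bullet_1$; $\lambda^\bullet_{AB}\alpha^\otimes_{0,A,B}=\lambda^\bullet_B(\lambda^\bullet_A\otimes1)$; $\rho^\bullet_A(1\otimes\lambda^\bullet_B)\alpha^\otimes_{A,0,B}=\lambda^\bullet_B(\rho^\bullet_A\otimes1)$; $\rho^\bullet_A(1\otimes\rho^\bullet_B)\alpha^\otimes_{A,B,0}=\rho^\bullet_{AB}$; $\lambda^\oplus_{AB}(\rho^\bullet_A\oplus1)\delta^l_{A,0,B}=1\otimes\lambda^\oplus_B$;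 $\lambda^\oplus_{BA}(\lambda^\bullet_A\oplus1)\delta^r_{0,B,A}=\lambda^\oplus_B\otimes1$; $\rho^\oplus_{AB}(1\oplus\rho^\bullet_A)\delta^l_{A,B,0}=1\otimes\rho^\oplus_B$; $\rho^\oplus_{AB}(1\oplus\lambda^\bullet_B)\delta^r_{A,0,B}=\rho^\oplus_A\otimes1$; $(\lambda^\otimes_A\oplus\lambda^\otimes_B)\delta^l_{1,A,B}=\lambda^\otimes_{A\oplus B}$; $(\rho^\otimes_A\oplus\rho^\otimes_B)\delta^r_{A,B,1}=\rho^\otimes_{A\oplus B}$. It is tight if $\delta^l,\delta^r$ are natural isomorphisms. A braided bimonoidal category is a bimonoidal category with a braiding $\zeta^\otimes$ making $\otimes$ braided monoidal, such that $\delta^l_{C,A,B}\zeta^\otimes_{A\oplus B,C}=(\zeta^\otimes_{A,C}\oplus\zeta^\otimes_{B,C})\delta^r_{A,B,C}$, $\delta^r_{B,C,A}\zeta^\otimes_{A,B\oplus C}=(\zeta^\otimes_{A,B}\oplus\zeta^\otimes_{A,C})\delta^l_{A,B,C}$, $\lambda^\bullet_A\zeta^\otimes_{A,0}=\rho^\bullet_A$, and $\rho^\bullet_A\zeta^\otimes_{0,A}=\lambda^\bullet_A$. A symmetric bimonoidal category is a braided bimonoidal category with $\zeta^\otimes_{B,A}\zeta^\otimes_{A,B}=1$ for all $A,B$. *)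

theory Defs
  imports Complex_Main "HOL-Library.FuncSet"
begin

section \<open>Categories\<close>

record ('o, 'm) category =
  Ob :: "'o set"
  Arr :: "'m set"
  Dom :: "'m \<Rightarrow> 'o"
  Cod :: "'m \<Rightarrow> 'o"
  Idt :: "'o \<Rightarrow> 'm"
  Comp :: "'m \<Rightarrow> 'm \<Rightarrow> 'm"  (infixr \<open>\<cdot>\<index>\<close> 55)

definition hom :: "('o, 'm) category \<Rightarrow> 'o \<Rightarrow> 'o \<Rightarrow> 'm set" where
  "hom C X Y = {f \<in> Arr C. Dom C f = X \<and> Cod C f = Y}"

locale category =
  fixes C :: "('o, 'm) category" (structure)
  assumes Dom_Ob: "f \<in> Arr C \<Longrightarrow> Dom C f \<in> Ob C"
    and Cod_Ob: "f \<in> Arr C \<Longrightarrow> Cod C f \<in> Ob C"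
    and Idt_hom: "X \<in> Ob C \<Longrightarrow> Idt C X \<in> hom C X X"
    and Comp_hom: "\<lbrakk>f \<in> hom C X Y; g \<in> hom C Y Z\<rbrakk> \<Longrightarrow> g \<cdot> f \<in> hom C X Z"
    and Comp_Idt: "f \<in> hom C X Y \<Longrightarrow> f \<cdot> Idt C X = f"
    and Idt_Comp: "f \<in> hom C X Y \<Longrightarrow> Idt C Y \<cdot> f = f"
    and Comp_assoc: "\<lbrakk>f \<in> hom C W X; g \<in> hom C X Y; h \<in> hom C Y Z\<rbrakk>
                     \<Longrightarrow> (h \<cdot> g) \<cdot> f = h \<cdot> (g \<cdot> f)"

definition inverse_arrows :: "('o, 'm) category \<Rightarrow> 'm \<Rightarrow> 'm \<Rightarrow> bool" where
  "inverse_arrows C f g \<longleftrightarrow>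
     f \<in> Arr C \<and> g \<in> hom C (Cod C f) (Dom C f) \<and>
     Comp C g f = Idt C (Dom C f) \<and> Comp C f g = Idt C (Cod C f)"

definition iso_arr :: "('o, 'm) category \<Rightarrow> 'm \<Rightarrow> bool" where
  "iso_arr C f \<longleftrightarrow> (\<exists>g. inverse_arrows C f g)"

definition inv_arr :: "('o, 'm) category \<Rightarrow> 'm \<Rightarrow> 'm" where
  "inv_arr C f = (THE g. inverse_arrows C f g)"

definition mono_arr :: "('o, 'm) category \<Rightarrow> 'm \<Rightarrow> bool" where
  "mono_arr C f \<longleftrightarrow>
     f \<in> Arr C \<and>
     (\<forall>X. \<forall>g\<in>hom C X (Dom C f). \<forall>h\<in>hom C X (Dom C f). Comp C f g = Comp C f h \<longrightarrow> g = h)"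


section \<open>Monoidal categories\<close>

text \<open>
  \<open>\<otimes>\<close> is the tensor on objects and \<open>\<boxtimes>\<close> the tensor on arrows; likewise \<open>\<oplus>\<close> and \<open>\<boxplus>\<close> below.
\<close>

locale monoidal_category = category C
  for C :: "('o, 'm) category" (structure)
    and tob :: "'o \<Rightarrow> 'o \<Rightarrow> 'o"  (infixr \<open>\<otimes>\<close> 70)
    and tar :: "'m \<Rightarrow> 'm \<Rightarrow> 'm"  (infixr \<open>\<boxtimes>\<close> 70)
    and unit :: 'o  (\<open>\<one>\<close>)
    and asc :: "'o \<Rightarrow> 'o \<Rightarrow> 'o \<Rightarrow> 'm"
    and lun :: "'o \<Rightarrow> 'm"
    and run :: "'o \<Rightarrow> 'm" +
  assumes tob_Ob: "\<lbrakk>X \<in> Ob C; Y \<in> Ob C\<rbrakk> \<Longrightarrow> X \<otimes> Y \<in> Ob C"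
    and tar_hom: "\<lbrakk>f \<in> hom C X X'; g \<in> hom C Y Y'\<rbrakk> \<Longrightarrow> f \<boxtimes> g \<in> hom C (X \<otimes> Y) (X' \<otimes> Y')"
    and tar_Idt: "\<lbrakk>X \<in> Ob C; Y \<in> Ob C\<rbrakk> \<Longrightarrow> Idt C X \<boxtimes> Idt C Y = Idt C (X \<otimes> Y)"
    and tar_Comp: "\<lbrakk>f \<in> hom C X X'; f' \<in> hom C X' X''; g \<in> hom C Y Y'; g' \<in> hom C Y' Y''\<rbrakk>
                   \<Longrightarrow> (f' \<cdot> f) \<boxtimes> (g' \<cdot> g) = (f' \<boxtimes> g') \<cdot> (f \<boxtimes> g)"
    and unit_Ob: "\<one> \<in> Ob C"
    and asc_hom: "\<lbrakk>X \<in> Ob C; Y \<in> Ob C; Z \<in> Ob C\<rbrakk>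
                  \<Longrightarrow> asc X Y Z \<in> hom C ((X \<otimes> Y) \<otimes> Z) (X \<otimes> (Y \<otimes> Z))"
    and asc_iso: "\<lbrakk>X \<in> Ob C; Y \<in> Ob C; Z \<in> Ob C\<rbrakk> \<Longrightarrow> iso_arr C (asc X Y Z)"
    and asc_nat: "\<lbrakk>f \<in> hom C X X'; g \<in> hom C Y Y'; h \<in> hom C Z Z'\<rbrakk>
                  \<Longrightarrow> asc X' Y' Z' \<cdot> ((f \<boxtimes> g) \<boxtimes> h) = (f \<boxtimes> (g \<boxtimes> h)) \<cdot> asc X Y Z"
    and lun_hom: "X \<in> Ob C \<Longrightarrow> lun X \<in> hom C (\<one> \<otimes> X) X"
    and lun_iso: "X \<in> Ob C \<Longrightarrow> iso_arr C (lun X)"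
    and lun_nat: "f \<in> hom C X X' \<Longrightarrow> lun X' \<cdot> (Idt C \<one> \<boxtimes> f) = f \<cdot> lun X"
    and run_hom: "X \<in> Ob C \<Longrightarrow> run X \<in> hom C (X \<otimes> \<one>) X"
    and run_iso: "X \<in> Ob C \<Longrightarrow> iso_arr C (run X)"
    and run_nat: "f \<in> hom C X X' \<Longrightarrow> run X' \<cdot> (f \<boxtimes> Idt C \<one>) = f \<cdot> run X"
    and pentagon: "\<lbrakk>W \<in> Ob C; X \<in> Ob C; Y \<in> Ob C; Z \<in> Ob C\<rbrakk>
                   \<Longrightarrow> asc W X (Y \<otimes> Z) \<cdot> asc (W \<otimes> X) Y Z
                       = (Idt C W \<boxtimes> asc X Y Z) \<cdot> asc W (X \<otimes> Y) Z \<cdot> (asc W X Y \<boxtimes> Idt C Z)"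
    and triangle: "\<lbrakk>X \<in> Ob C; Y \<in> Ob C\<rbrakk>
                   \<Longrightarrow> (Idt C X \<boxtimes> lun Y) \<cdot> asc X \<one> Y = run X \<boxtimes> Idt C Y"

locale braided_monoidal_category =
  monoidal_category C tob tar unit asc lun run
  for C :: "('o, 'm) category" (structure)
    and tob (infixr \<open>\<otimes>\<close> 70)
    and tar (infixr \<open>\<boxtimes>\<close> 70)
    and unit (\<open>\<one>\<close>)
    and asc lun run
    and brd :: "'o \<Rightarrow> 'o \<Rightarrow> 'm" +
  assumes brd_hom: "\<lbrakk>X \<in> Ob C; Y \<in> Ob C\<rbrakk> \<Longrightarrow> brd X Y \<in> hom C (X \<otimes> Y) (Y \<otimes> X)"
    and brd_iso: "\<lbrakk>X \<in> Ob C; Y \<in> Ob C\<rbrakk> \<Longrightarrow> iso_arr C (brd X Y)"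
    and brd_nat: "\<lbrakk>f \<in> hom C X X'; g \<in> hom C Y Y'\<rbrakk>
                  \<Longrightarrow> brd X' Y' \<cdot> (f \<boxtimes> g) = (g \<boxtimes> f) \<cdot> brd X Y"
    and hexagon1: "\<lbrakk>X \<in> Ob C; Y \<in> Ob C; Z \<in> Ob C\<rbrakk>
                   \<Longrightarrow> asc Y Z X \<cdot> brd X (Y \<otimes> Z) \<cdot> asc X Y Z
                       = (Idt C Y \<boxtimes> brd X Z) \<cdot> asc Y X Z \<cdot> (brd X Y \<boxtimes> Idt C Z)"
    and hexagon2: "\<lbrakk>X \<in> Ob C; Y \<in> Ob C; Z \<in> Ob C\<rbrakk>
                   \<Longrightarrow> inv_arr C (asc Z X Y) \<cdot> brd (X \<otimes> Y) Z \<cdot> inv_arr C (asc X Y Z)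
                       = (brd X Z \<boxtimes> Idt C Y) \<cdot> inv_arr C (asc X Z Y) \<cdot> (Idt C X \<boxtimes> brd Y Z)"

locale symmetric_monoidal_category = braided_monoidal_category +
  assumes brd_sym: "\<lbrakk>X \<in> Ob C; Y \<in> Ob C\<rbrakk> \<Longrightarrow> brd Y X \<cdot> brd X Y = Idt C (X \<otimes> Y)"


section \<open>Bimonoidal categories\<close>

text \<open>
  The coherence isomorphism \<open>(P \<oplus> Q) \<oplus> (R \<oplus> S) \<rightarrow> (P \<oplus> R) \<oplus> (Q \<oplus> S)\<close> of a symmetric
  monoidal category.
\<close>

definition middle_exchange ::
    "('o, 'm) category \<Rightarrow> ('o \<Rightarrow> 'o \<Rightarrow> 'o) \<Rightarrow> ('m \<Rightarrow> 'm \<Rightarrow> 'm) \<Rightarrow> ('o \<Rightarrow> 'o \<Rightarrow> 'o \<Rightarrow> 'm)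
     \<Rightarrow> ('o \<Rightarrow> 'o \<Rightarrow> 'm) \<Rightarrow> 'o \<Rightarrow> 'o \<Rightarrow> 'o \<Rightarrow> 'o \<Rightarrow> 'm" where
  "middle_exchange C sob sar sasc ssym P Q R S =
     Comp C (inv_arr C (sasc P R (sob Q S)))
      (Comp C (sar (Idt C P)
                   (Comp C (sasc R Q S)
                     (Comp C (sar (ssym Q R) (Idt C S)) (inv_arr C (sasc Q R S)))))
        (sasc P Q (sob R S)))"

locale bimonoidal_category =
  sum: symmetric_monoidal_category C sob sar zero sasc slun srun ssym +
  ten: monoidal_category C tob tar unit tasc tlun trun
  for C :: "('o, 'm) category" (structure)
    and sob (infixr \<open>\<oplus>\<close> 65)
    and sar (infixr \<open>\<boxplus>\<close> 65)
    and zero (\<open>\<zero>\<close>)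
    and sasc slun srun ssym
    and tob (infixr \<open>\<otimes>\<close> 70)
    and tar (infixr \<open>\<boxtimes>\<close> 70)
    and unit (\<open>\<one>\<close>)
    and tasc tlun trun
    and lnul :: "'o \<Rightarrow> 'm"
    and rnul :: "'o \<Rightarrow> 'm"
    and ldis :: "'o \<Rightarrow> 'o \<Rightarrow> 'o \<Rightarrow> 'm"
    and rdis :: "'o \<Rightarrow> 'o \<Rightarrow> 'o \<Rightarrow> 'm" +
  assumes lnul_hom: "A \<in> Ob C \<Longrightarrow> lnul A \<in> hom C (\<zero> \<otimes> A) \<zero>"
    and lnul_iso: "A \<in> Ob C \<Longrightarrow> iso_arr C (lnul A)"
    and lnul_nat: "f \<in> hom C A A' \<Longrightarrow> lnul A' \<cdot> (Idt C \<zero> \<boxtimes> f) = Idt C \<zero> \<cdot> lnul A"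
    and rnul_hom: "A \<in> Ob C \<Longrightarrow> rnul A \<in> hom C (A \<otimes> \<zero>) \<zero>"
    and rnul_iso: "A \<in> Ob C \<Longrightarrow> iso_arr C (rnul A)"
    and rnul_nat: "f \<in> hom C A A' \<Longrightarrow> rnul A' \<cdot> (f \<boxtimes> Idt C \<zero>) = Idt C \<zero> \<cdot> rnul A"
    and ldis_hom: "\<lbrakk>A \<in> Ob C; B \<in> Ob C; D \<in> Ob C\<rbrakk>
                   \<Longrightarrow> ldis A B D \<in> hom C (A \<otimes> (B \<oplus> D)) (A \<otimes> B \<oplus> A \<otimes> D)"
    and ldis_mono: "\<lbrakk>A \<in> Ob C; B \<in> Ob C; D \<in> Ob C\<rbrakk> \<Longrightarrow> mono_arr C (ldis A B D)"
    and ldis_nat: "\<lbrakk>f \<in> hom C A A'; g \<in> hom C B B'; h \<in> hom C D D'\<rbrakk>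
                   \<Longrightarrow> ldis A' B' D' \<cdot> (f \<boxtimes> (g \<boxplus> h)) = (f \<boxtimes> g \<boxplus> f \<boxtimes> h) \<cdot> ldis A B D"
    and rdis_hom: "\<lbrakk>A \<in> Ob C; B \<in> Ob C; D \<in> Ob C\<rbrakk>
                   \<Longrightarrow> rdis A B D \<in> hom C ((A \<oplus> B) \<otimes> D) (A \<otimes> D \<oplus> B \<otimes> D)"
    and rdis_mono: "\<lbrakk>A \<in> Ob C; B \<in> Ob C; D \<in> Ob C\<rbrakk> \<Longrightarrow> mono_arr C (rdis A B D)"
    and rdis_nat: "\<lbrakk>f \<in> hom C A A'; g \<in> hom C B B'; h \<in> hom C D D'\<rbrakk>
                   \<Longrightarrow> rdis A' B' D' \<cdot> ((f \<boxplus> g) \<boxtimes> h) = (f \<boxtimes> h \<boxplus> g \<boxtimes> h) \<cdot> rdis A B D"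
    and ldis_ssym: "\<lbrakk>A \<in> Ob C; B \<in> Ob C; D \<in> Ob C\<rbrakk>
      \<Longrightarrow> ldis A D B \<cdot> (Idt C A \<boxtimes> ssym B D) = ssym (A \<otimes> B) (A \<otimes> D) \<cdot> ldis A B D"
    and rdis_ssym: "\<lbrakk>A \<in> Ob C; B \<in> Ob C; D \<in> Ob C\<rbrakk>
      \<Longrightarrow> rdis B A D \<cdot> (ssym A B \<boxtimes> Idt C D) = ssym (A \<otimes> D) (B \<otimes> D) \<cdot> rdis A B D"
    and rdis_sasc: "\<lbrakk>A \<in> Ob C; B \<in> Ob C; D \<in> Ob C; E \<in> Ob C\<rbrakk>
      \<Longrightarrow> sasc (A \<otimes> E) (B \<otimes> E) (D \<otimes> E) \<cdot> (rdis A B E \<boxplus> Idt C (D \<otimes> E)) \<cdot> rdis (A \<oplus> B) D E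
          = (Idt C (A \<otimes> E) \<boxplus> rdis B D E) \<cdot> rdis A (B \<oplus> D) E \<cdot> (sasc A B D \<boxtimes> Idt C E)"
    and ldis_sasc: "\<lbrakk>A \<in> Ob C; B \<in> Ob C; D \<in> Ob C; E \<in> Ob C\<rbrakk>
      \<Longrightarrow> sasc (A \<otimes> B) (A \<otimes> D) (A \<otimes> E) \<cdot> (ldis A B D \<boxplus> Idt C (A \<otimes> E)) \<cdot> ldis A (B \<oplus> D) E
          = (Idt C (A \<otimes> B) \<boxplus> ldis A D E) \<cdot> ldis A B (D \<oplus> E) \<cdot> (Idt C A \<boxtimes> sasc B D E)"
    and ldis_tasc: "\<lbrakk>A \<in> Ob C; B \<in> Ob C; D \<in> Ob C; E \<in> Ob C\<rbrakk>
      \<Longrightarrow> ldis A (B \<otimes> D) (B \<otimes> E) \<cdot> (Idt C A \<boxtimes> ldis B D E) \<cdot> tasc A B (D \<oplus> E)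
          = (tasc A B D \<boxplus> tasc A B E) \<cdot> ldis (A \<otimes> B) D E"
    and rdis_tasc: "\<lbrakk>A \<in> Ob C; B \<in> Ob C; D \<in> Ob C; E \<in> Ob C\<rbrakk>
      \<Longrightarrow> (tasc A D E \<boxplus> tasc B D E) \<cdot> rdis (A \<otimes> D) (B \<otimes> D) E \<cdot> (rdis A B D \<boxtimes> Idt C E)
          = rdis A B (D \<otimes> E) \<cdot> tasc (A \<oplus> B) D E"
    and ldis_rdis_tasc: "\<lbrakk>A \<in> Ob C; B \<in> Ob C; D \<in> Ob C; E \<in> Ob C\<rbrakk>
      \<Longrightarrow> (tasc A B E \<boxplus> tasc A D E) \<cdot> rdis (A \<otimes> B) (A \<otimes> D) E \<cdot> (ldis A B D \<boxtimes> Idt C E)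
          = ldis A (B \<otimes> E) (D \<otimes> E) \<cdot> (Idt C A \<boxtimes> rdis B D E) \<cdot> tasc A (B \<oplus> D) E"
    and dis_exchange: "\<lbrakk>A \<in> Ob C; B \<in> Ob C; D \<in> Ob C; E \<in> Ob C\<rbrakk>
      \<Longrightarrow> middle_exchange C sob sar sasc ssym (A \<otimes> D) (A \<otimes> E) (B \<otimes> D) (B \<otimes> E)
            \<cdot> (ldis A D E \<boxplus> ldis B D E) \<cdot> rdis A B (D \<oplus> E)
          = (rdis A B D \<boxplus> rdis A B E) \<cdot> ldis (A \<oplus> B) D E"
    and nul_zero: "lnul \<zero> = rnul \<zero>"
    and lnul_sum: "\<lbrakk>A \<in> Ob C; B \<in> Ob C\<rbrakk>
      \<Longrightarrow> slun \<zero> \<cdot> (lnul A \<boxplus> lnul B) \<cdot> ldis \<zero> A B = lnul (A \<oplus> B)"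
    and rnul_sum: "\<lbrakk>A \<in> Ob C; B \<in> Ob C\<rbrakk>
      \<Longrightarrow> slun \<zero> \<cdot> (rnul A \<boxplus> rnul B) \<cdot> rdis A B \<zero> = rnul (A \<oplus> B)"
    and trun_zero: "trun \<zero> = lnul \<one>"
    and tlun_zero: "tlun \<zero> = rnul \<one>"
    and lnul_ten: "\<lbrakk>A \<in> Ob C; B \<in> Ob C\<rbrakk>
      \<Longrightarrow> lnul (A \<otimes> B) \<cdot> tasc \<zero> A B = lnul B \<cdot> (lnul A \<boxtimes> Idt C B)"
    and rnul_lnul_ten: "\<lbrakk>A \<in> Ob C; B \<in> Ob C\<rbrakk>
      \<Longrightarrow> rnul A \<cdot> (Idt C A \<boxtimes> lnul B) \<cdot> tasc A \<zero> B = lnul B \<cdot> (rnul A \<boxtimes> Idt C B)"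
    and rnul_ten: "\<lbrakk>A \<in> Ob C; B \<in> Ob C\<rbrakk>
      \<Longrightarrow> rnul A \<cdot> (Idt C A \<boxtimes> rnul B) \<cdot> tasc A B \<zero> = rnul (A \<otimes> B)"
    and ldis_zero_left: "\<lbrakk>A \<in> Ob C; B \<in> Ob C\<rbrakk>
      \<Longrightarrow> slun (A \<otimes> B) \<cdot> (rnul A \<boxplus> Idt C (A \<otimes> B)) \<cdot> ldis A \<zero> B = Idt C A \<boxtimes> slun B"
    and rdis_zero_left: "\<lbrakk>A \<in> Ob C; B \<in> Ob C\<rbrakk>
      \<Longrightarrow> slun (B \<otimes> A) \<cdot> (lnul A \<boxplus> Idt C (B \<otimes> A)) \<cdot> rdis \<zero> B A = slun B \<boxtimes> Idt C A"
    and ldis_zero_right: "\<lbrakk>A \<in> Ob C; B \<in> Ob C\<rbrakk>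
      \<Longrightarrow> srun (A \<otimes> B) \<cdot> (Idt C (A \<otimes> B) \<boxplus> rnul A) \<cdot> ldis A B \<zero> = Idt C A \<boxtimes> srun B"
    and rdis_zero_right: "\<lbrakk>A \<in> Ob C; B \<in> Ob C\<rbrakk>
      \<Longrightarrow> srun (A \<otimes> B) \<cdot> (Idt C (A \<otimes> B) \<boxplus> lnul B) \<cdot> rdis A \<zero> B = srun A \<boxtimes> Idt C B"
    and ldis_unit: "\<lbrakk>A \<in> Ob C; B \<in> Ob C\<rbrakk>
      \<Longrightarrow> (tlun A \<boxplus> tlun B) \<cdot> ldis \<one> A B = tlun (A \<oplus> B)"
    and rdis_unit: "\<lbrakk>A \<in> Ob C; B \<in> Ob C\<rbrakk>
      \<Longrightarrow> (trun A \<boxplus> trun B) \<cdot> rdis A B \<one> = trun (A \<oplus> B)"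

locale tight_bimonoidal_category = bimonoidal_category +
  assumes ldis_iso: "\<lbrakk>A \<in> Ob C; B \<in> Ob C; D \<in> Ob C\<rbrakk> \<Longrightarrow> iso_arr C (ldis A B D)"
    and rdis_iso: "\<lbrakk>A \<in> Ob C; B \<in> Ob C; D \<in> Ob C\<rbrakk> \<Longrightarrow> iso_arr C (rdis A B D)"

locale braided_bimonoidal_category =
  bimonoidal_category C sob sar zero sasc slun srun ssym tob tar unit tasc tlun trun
    lnul rnul ldis rdis +
  ten: braided_monoidal_category C tob tar unit tasc tlun trun tbrd
  for C :: "('o, 'm) category" (structure)
    and sob (infixr \<open>\<oplus>\<close> 65)
    and sar (infixr \<open>\<boxplus>\<close> 65)
    and zero (\<open>\<zero>\<close>)
    and sasc slun srun ssym
    and tob (infixr \<open>\<otimes>\<close> 70)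
    and tar (infixr \<open>\<boxtimes>\<close> 70)
    and unit (\<open>\<one>\<close>)
    and tasc tlun trun lnul rnul ldis rdis tbrd +
  assumes ldis_tbrd: "\<lbrakk>A \<in> Ob C; B \<in> Ob C; D \<in> Ob C\<rbrakk>
      \<Longrightarrow> ldis D A B \<cdot> tbrd (A \<oplus> B) D = (tbrd A D \<boxplus> tbrd B D) \<cdot> rdis A B D"
    and rdis_tbrd: "\<lbrakk>A \<in> Ob C; B \<in> Ob C; D \<in> Ob C\<rbrakk>
      \<Longrightarrow> rdis B D A \<cdot> tbrd A (B \<oplus> D) = (tbrd A B \<boxplus> tbrd A D) \<cdot> ldis A B D"
    and lnul_tbrd: "A \<in> Ob C \<Longrightarrow> lnul A \<cdot> tbrd A \<zero> = rnul A"
    and rnul_tbrd: "A \<in> Ob C \<Longrightarrow> rnul A \<cdot> tbrd \<zero> A = lnul A"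

locale symmetric_bimonoidal_category = braided_bimonoidal_category +
  assumes tbrd_sym: "\<lbrakk>A \<in> Ob C; B \<in> Ob C\<rbrakk> \<Longrightarrow> tbrd B A \<cdot> tbrd A B = Idt C (A \<otimes> B)"

locale tight_braided_bimonoidal_category =
  braided_bimonoidal_category + tight_bimonoidal_category

locale tight_symmetric_bimonoidal_category =
  symmetric_bimonoidal_category + tight_bimonoidal_category


section \<open>Vector spaces with carrier and their tensor product\<close>

record ('k, 'v) vspace =
  carr :: "'v set"
  vadd :: "'v \<Rightarrow> 'v \<Rightarrow> 'v"
  vzero :: "'v"
  vscl :: "'k \<Rightarrow> 'v \<Rightarrow> 'v"

locale carrier_vector_space =
  fixes V :: "('k::field, 'v, 'e) vspace_scheme"
  assumes vadd_closed: "\<lbrakk>u \<in> carr V; v \<in> carr V\<rbrakk> \<Longrightarrow> vadd V u v \<in> carr V"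
    and vadd_assoc: "\<lbrakk>u \<in> carr V; v \<in> carr V; w \<in> carr V\<rbrakk>
                     \<Longrightarrow> vadd V (vadd V u v) w = vadd V u (vadd V v w)"
    and vadd_commute: "\<lbrakk>u \<in> carr V; v \<in> carr V\<rbrakk> \<Longrightarrow> vadd V u v = vadd V v u"
    and vzero_closed: "vzero V \<in> carr V"
    and vadd_vzero: "v \<in> carr V \<Longrightarrow> vadd V (vzero V) v = v"
    and vadd_inverse: "v \<in> carr V \<Longrightarrow> \<exists>w\<in>carr V. vadd V v w = vzero V"
    and vscl_closed: "v \<in> carr V \<Longrightarrow> vscl V c v \<in> carr V"
    and vscl_vadd: "\<lbrakk>u \<in> carr V; v \<in> carr V\<rbrakk>
                    \<Longrightarrow> vscl V c (vadd V u v) = vadd V (vscl V c u) (vscl V c v)"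
    and vscl_add: "v \<in> carr V \<Longrightarrow> vscl V (c + d) v = vadd V (vscl V c v) (vscl V d v)"
    and vscl_mult: "v \<in> carr V \<Longrightarrow> vscl V (c * d) v = vscl V c (vscl V d v)"
    and vscl_one: "v \<in> carr V \<Longrightarrow> vscl V 1 v = v"

text \<open>
  A list of pairs \<open>[(v\<^sub>1, w\<^sub>1), \<dots>, (v\<^sub>n, w\<^sub>n)]\<close> stands for the formal sum
  \<open>v\<^sub>1 \<otimes> w\<^sub>1 + \<dots> + v\<^sub>n \<otimes> w\<^sub>n\<close>. The relation \<open>tensor_eq V W\<close> is the congruence on formal sums
  generated by the defining relations of \<open>V \<otimes>\<^sub>k W\<close>.
\<close>

inductive tensor_eq ::
    "('k::field, 'v, 'e) vspace_scheme \<Rightarrow> ('k, 'w, 'f) vspace_scheme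
     \<Rightarrow> ('v \<times> 'w) list \<Rightarrow> ('v \<times> 'w) list \<Rightarrow> bool"
  for V W where
  refl: "set xs \<subseteq> carr V \<times> carr W \<Longrightarrow> tensor_eq V W xs xs"
| sym: "tensor_eq V W xs ys \<Longrightarrow> tensor_eq V W ys xs"
| trans: "\<lbrakk>tensor_eq V W xs ys; tensor_eq V W ys zs\<rbrakk> \<Longrightarrow> tensor_eq V W xs zs"
| append: "\<lbrakk>tensor_eq V W xs xs'; tensor_eq V W ys ys'\<rbrakk> \<Longrightarrow> tensor_eq V W (xs @ ys) (xs' @ ys')"
| commute: "\<lbrakk>set xs \<subseteq> carr V \<times> carr W; set ys \<subseteq> carr V \<times> carr W\<rbrakk>
            \<Longrightarrow> tensor_eq V W (xs @ ys) (ys @ xs)"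
| zero_left: "w \<in> carr W \<Longrightarrow> tensor_eq V W [(vzero V, w)] []"
| zero_right: "v \<in> carr V \<Longrightarrow> tensor_eq V W [(v, vzero W)] []"
| add_left: "\<lbrakk>v \<in> carr V; v' \<in> carr V; w \<in> carr W\<rbrakk>
             \<Longrightarrow> tensor_eq V W [(vadd V v v', w)] [(v, w), (v', w)]"
| add_right: "\<lbrakk>v \<in> carr V; w \<in> carr W; w' \<in> carr W\<rbrakk>
              \<Longrightarrow> tensor_eq V W [(v, vadd W w w')] [(v, w), (v, w')]"
| balanced: "\<lbrakk>v \<in> carr V; w \<in> carr W\<rbrakk> \<Longrightarrow> tensor_eq V W [(vscl V c v, w)] [(v, vscl W c w)]"

text \<open>
  The elements of \<open>V \<otimes>\<^sub>k W\<close> are chosen representatives of the classes of \<open>tensor_eq V W\<close> rather than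
  the classes themselves. Formal sums are finite objects, so this permits a type of elements that
  is closed under tensor products (see \<open>elt\<close> below).
\<close>

definition tensor_rep ::
    "('k::field, 'v, 'e) vspace_scheme \<Rightarrow> ('k, 'w, 'f) vspace_scheme
     \<Rightarrow> ('v \<times> 'w) list \<Rightarrow> ('v \<times> 'w) list" where
  "tensor_rep V W xs = (SOME ys. tensor_eq V W xs ys)"

definition tensor ::
    "('k::field, 'v, 'e) vspace_scheme \<Rightarrow> ('k, 'w, 'f) vspace_scheme
     \<Rightarrow> ('k, ('v \<times> 'w) list) vspace" where
  "tensor V W =
     \<lparr>carr = {tensor_rep V W xs | xs. set xs \<subseteq> carr V \<times> carr W},
      vadd = (\<lambda>s t. tensor_rep V W (s @ t)),
      vzero = tensor_rep V W [],
      vscl = (\<lambda>c t. tensor_rep V W (map (\<lambda>(v, w). (vscl V c v, w)) t))\<rparr>"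

definition simple_tensor ::
    "('k::field, 'v, 'e) vspace_scheme \<Rightarrow> ('k, 'w, 'f) vspace_scheme
     \<Rightarrow> 'v \<Rightarrow> 'w \<Rightarrow> ('v \<times> 'w) list" where
  "simple_tensor V W v w = tensor_rep V W [(v, w)]"

text \<open>
  For bilinear \<open>b\<close> with values in \<open>U\<close>, \<open>tensor_lift U b\<close> is the linear map on the tensor product
  with \<open>v \<otimes> w \<mapsto> b v w\<close>.
\<close>

definition tensor_lift ::
    "('k, 'u, 'e) vspace_scheme \<Rightarrow> ('v \<Rightarrow> 'w \<Rightarrow> 'u) \<Rightarrow> ('v \<times> 'w) list \<Rightarrow> 'u" where
  "tensor_lift U b t = foldr (\<lambda>(v, w). vadd U (b v w)) t (vzero U)"


section \<open>Bialgebras\<close>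

text \<open>
  The underlying ring is of class \<open>ring_1\<close>, where \<open>0 \<noteq> 1\<close>. This excludes no bialgebra, because the
  counit maps \<open>1\<close> to \<open>1 \<noteq> 0\<close>.
\<close>

context
  fixes scale :: "'k::field \<Rightarrow> 'a::ring_1 \<Rightarrow> 'a"
begin

definition alg_space :: "('k, 'a) vspace" where
  "alg_space = \<lparr>carr = UNIV, vadd = (+), vzero = 0, vscl = scale\<rparr>"

definition alg2 :: "('k, ('a \<times> 'a) list) vspace" where
  "alg2 = tensor alg_space alg_space"

definition ten2 :: "'a \<Rightarrow> 'a \<Rightarrow> ('a \<times> 'a) list" where
  "ten2 = simple_tensor alg_space alg_space"

definition mult2 :: "('a \<times> 'a) list \<Rightarrow> ('a \<times> 'a) list \<Rightarrow> ('a \<times> 'a) list" where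
  "mult2 s t =
     tensor_lift alg2 (\<lambda>x y. tensor_lift alg2 (\<lambda>x' y'. ten2 (x * x') (y * y')) t) s"

definition swap2 :: "('a \<times> 'a) list \<Rightarrow> ('a \<times> 'a) list" where
  "swap2 = tensor_lift alg2 (\<lambda>x y. ten2 y x)"

text \<open>The triple tensor product is bracketed as \<open>A \<otimes> (A \<otimes> A)\<close>.\<close>

definition alg3 :: "('k, ('a \<times> ('a \<times> 'a) list) list) vspace" where
  "alg3 = tensor alg_space alg2"

definition ten3 :: "'a \<Rightarrow> 'a \<Rightarrow> 'a \<Rightarrow> ('a \<times> ('a \<times> 'a) list) list" where
  "ten3 x y z = simple_tensor alg_space alg2 x (ten2 y z)"

definition mult3 ::
    "('a \<times> ('a \<times> 'a) list) list \<Rightarrow> ('a \<times> ('a \<times> 'a) list) list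
     \<Rightarrow> ('a \<times> ('a \<times> 'a) list) list" where
  "mult3 s t =
     tensor_lift alg3
       (\<lambda>x p. tensor_lift alg3 (\<lambda>x' p'. simple_tensor alg_space alg2 (x * x') (mult2 p p')) t) s"

text \<open>\<open>comul_left \<Delta>\<close> is \<open>\<Delta> \<otimes> 1\<close> and \<open>comul_right \<Delta>\<close> is \<open>1 \<otimes> \<Delta>\<close>.\<close>

definition comul_left ::
    "('a \<Rightarrow> ('a \<times> 'a) list) \<Rightarrow> ('a \<times> 'a) list \<Rightarrow> ('a \<times> ('a \<times> 'a) list) list" where
  "comul_left \<Delta> = tensor_lift alg3 (\<lambda>x y. tensor_lift alg3 (\<lambda>x1 x2. ten3 x1 x2 y) (\<Delta> x))"

definition comul_right ::
    "('a \<Rightarrow> ('a \<times> 'a) list) \<Rightarrow> ('a \<times> 'a) list \<Rightarrow> ('a \<times> ('a \<times> 'a) list) list" where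
  "comul_right \<Delta> = tensor_lift alg3 (\<lambda>x y. tensor_lift alg3 (\<lambda>y1 y2. ten3 x y1 y2) (\<Delta> y))"

definition insert12 :: "('a \<times> 'a) list \<Rightarrow> ('a \<times> ('a \<times> 'a) list) list" where
  "insert12 = tensor_lift alg3 (\<lambda>x y. ten3 x y 1)"

definition insert13 :: "('a \<times> 'a) list \<Rightarrow> ('a \<times> ('a \<times> 'a) list) list" where
  "insert13 = tensor_lift alg3 (\<lambda>x y. ten3 x 1 y)"

definition insert23 :: "('a \<times> 'a) list \<Rightarrow> ('a \<times> ('a \<times> 'a) list) list" where
  "insert23 = tensor_lift alg3 (\<lambda>x y. ten3 1 x y)"

end

locale bialgebra = vector_space scale
  for scale :: "'k::field \<Rightarrow> 'a::ring_1 \<Rightarrow> 'a" +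
  fixes \<Delta> :: "'a \<Rightarrow> ('a \<times> 'a) list"
    and \<epsilon> :: "'a \<Rightarrow> 'k"
  assumes scale_mult_left: "scale c x * y = scale c (x * y)"
    and scale_mult_right: "x * scale c y = scale c (x * y)"
    and \<Delta>_closed: "\<Delta> x \<in> carr (alg2 scale)"
    and \<Delta>_add: "\<Delta> (x + y) = vadd (alg2 scale) (\<Delta> x) (\<Delta> y)"
    and \<Delta>_scale: "\<Delta> (scale c x) = vscl (alg2 scale) c (\<Delta> x)"
    and \<epsilon>_add: "\<epsilon> (x + y) = \<epsilon> x + \<epsilon> y"
    and \<epsilon>_scale: "\<epsilon> (scale c x) = c * \<epsilon> x"
    and coassociative: "comul_left scale \<Delta> (\<Delta> x) = comul_right scale \<Delta> (\<Delta> x)"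
    and counit_left: "tensor_lift (alg_space scale) (\<lambda>y z. scale (\<epsilon> y) z) (\<Delta> x) = x"
    and counit_right: "tensor_lift (alg_space scale) (\<lambda>y z. scale (\<epsilon> z) y) (\<Delta> x) = x"
    and \<Delta>_mult: "\<Delta> (x * y) = mult2 scale (\<Delta> x) (\<Delta> y)"
    and \<Delta>_one: "\<Delta> 1 = ten2 scale 1 1"
    and \<epsilon>_mult: "\<epsilon> (x * y) = \<epsilon> x * \<epsilon> y"
    and \<epsilon>_one: "\<epsilon> 1 = 1"

locale braided_bialgebra = bialgebra scale \<Delta> \<epsilon>
  for scale :: "'k::field \<Rightarrow> 'a::ring_1 \<Rightarrow> 'a" and \<Delta> \<epsilon> +
  fixes R :: "('a \<times> 'a) list"
  assumes R_closed: "R \<in> carr (alg2 scale)"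
    and R_invertible: "\<exists>S\<in>carr (alg2 scale).
          mult2 scale R S = ten2 scale 1 1 \<and> mult2 scale S R = ten2 scale 1 1"
    and R_commute: "mult2 scale (swap2 scale (\<Delta> x)) R = mult2 scale R (\<Delta> x)"
    and comul_left_R: "comul_left scale \<Delta> R = mult3 scale (insert13 scale R) (insert23 scale R)"
    and comul_right_R: "comul_right scale \<Delta> R = mult3 scale (insert13 scale R) (insert12 scale R)"

locale symmetric_bialgebra = braided_bialgebra +
  assumes R_symmetric:
    "mult2 scale R (swap2 scale R) = ten2 scale 1 1"
    "mult2 scale (swap2 scale R) R = ten2 scale 1 1"


section \<open>The category of modules\<close>

text \<open>
  A type of elements closed under the formation of the modules below. Every module is isomorphic
  to one whose elements are \<open>Atom\<close>s of a suitable type \<open>'b\<close>.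
\<close>

datatype ('k, 'b) elt =
  Atom 'b
| Star
| Scalar (unscalar: 'k)
| Couple (lft: "('k, 'b) elt") (rgt: "('k, 'b) elt")
| Tensor (untensor: "(('k, 'b) elt \<times> ('k, 'b) elt) list")

record ('k, 'a, 'u) amod = "('k, 'u) vspace" +
  act :: "'a \<Rightarrow> 'u \<Rightarrow> 'u"

locale left_module = carrier_vector_space V
  for scale :: "'k::field \<Rightarrow> 'a::ring_1 \<Rightarrow> 'a" and V :: "('k, 'a, 'u) amod" +
  assumes act_closed: "v \<in> carr V \<Longrightarrow> act V x v \<in> carr V"
    and act_vadd: "\<lbrakk>v \<in> carr V; w \<in> carr V\<rbrakk>
                   \<Longrightarrow> act V x (vadd V v w) = vadd V (act V x v) (act V x w)"
    and act_add: "v \<in> carr V \<Longrightarrow> act V (x + y) v = vadd V (act V x v) (act V y v)"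
    and act_mult: "v \<in> carr V \<Longrightarrow> act V (x * y) v = act V x (act V y v)"
    and act_one: "v \<in> carr V \<Longrightarrow> act V 1 v = v"
    and act_scale: "v \<in> carr V \<Longrightarrow> act V (scale c x) v = vscl V c (act V x v)"

record ('k, 'a, 'u) arrow =
  adom :: "('k, 'a, 'u) amod"
  acod :: "('k, 'a, 'u) amod"
  afun :: "'u \<Rightarrow> 'u"

definition module_hom ::
    "('k, 'a, 'u) amod \<Rightarrow> ('k, 'a, 'u) amod \<Rightarrow> ('u \<Rightarrow> 'u) \<Rightarrow> bool" where
  "module_hom V W f \<longleftrightarrow>
     f \<in> carr V \<rightarrow> carr W \<and>
     (\<forall>u\<in>carr V. \<forall>v\<in>carr V. f (vadd V u v) = vadd W (f u) (f v)) \<and>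
     (\<forall>c. \<forall>v\<in>carr V. f (vscl V c v) = vscl W c (f v)) \<and>
     (\<forall>x. \<forall>v\<in>carr V. f (act V x v) = act W x (f v))"

definition mk_arrow ::
    "('k, 'a, 'u) amod \<Rightarrow> ('k, 'a, 'u) amod \<Rightarrow> ('u \<Rightarrow> 'u) \<Rightarrow> ('k, 'a, 'u) arrow" where
  "mk_arrow V W f = \<lparr>adom = V, acod = W, afun = restrict f (carr V)\<rparr>"

text \<open>
  The first argument only fixes the type \<open>'b\<close> of atoms, and thereby the size of the modules. An arrow
  records its domain and codomain, and its function is \<open>undefined\<close> off the carrier of the domain, so
  that equality of arrows is equality of module homomorphisms.
\<close>

definition Mod ::
    "'b itself \<Rightarrow> ('k::field \<Rightarrow> 'a::ring_1 \<Rightarrow> 'a)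
     \<Rightarrow> (('k, 'a, ('k, 'b) elt) amod, ('k, 'a, ('k, 'b) elt) arrow) category" where
  "Mod atoms scale =
     \<lparr>Ob = {V. left_module scale V},
      Arr = {f. left_module scale (adom f) \<and> left_module scale (acod f) \<and>
                module_hom (adom f) (acod f) (afun f) \<and> afun f \<in> extensional (carr (adom f))},
      Dom = adom,
      Cod = acod,
      Idt = (\<lambda>V. mk_arrow V V (\<lambda>v. v)),
      Comp = (\<lambda>g f. mk_arrow (adom f) (acod g) (\<lambda>v. afun g (afun f v)))\<rparr>"


subsection \<open>Direct sums\<close>

definition zero_mod :: "('k, 'a, ('k, 'b) elt) amod" where
  "zero_mod =
     \<lparr>carr = {Star}, vadd = (\<lambda>u v. Star), vzero = Star, vscl = (\<lambda>c v. Star), act = (\<lambda>x v. Star)\<rparr>"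

definition dsum ::
    "('k, 'a, ('k, 'b) elt) amod \<Rightarrow> ('k, 'a, ('k, 'b) elt) amod
     \<Rightarrow> ('k, 'a, ('k, 'b) elt) amod" where
  "dsum V W =
     \<lparr>carr = {Couple v w | v w. v \<in> carr V \<and> w \<in> carr W},
      vadd = (\<lambda>p q. Couple (vadd V (lft p) (lft q)) (vadd W (rgt p) (rgt q))),
      vzero = Couple (vzero V) (vzero W),
      vscl = (\<lambda>c p. Couple (vscl V c (lft p)) (vscl W c (rgt p))),
      act = (\<lambda>x p. Couple (act V x (lft p)) (act W x (rgt p)))\<rparr>"

definition dsum_arr ::
    "('k, 'a, ('k, 'b) elt) arrow \<Rightarrow> ('k, 'a, ('k, 'b) elt) arrow
     \<Rightarrow> ('k, 'a, ('k, 'b) elt) arrow" where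
  "dsum_arr f g =
     mk_arrow (dsum (adom f) (adom g)) (dsum (acod f) (acod g))
       (\<lambda>p. Couple (afun f (lft p)) (afun g (rgt p)))"

definition dsum_assoc ::
    "('k, 'a, ('k, 'b) elt) amod \<Rightarrow> ('k, 'a, ('k, 'b) elt) amod \<Rightarrow> ('k, 'a, ('k, 'b) elt) amod
     \<Rightarrow> ('k, 'a, ('k, 'b) elt) arrow" where
  "dsum_assoc U V W =
     mk_arrow (dsum (dsum U V) W) (dsum U (dsum V W))
       (\<lambda>p. Couple (lft (lft p)) (Couple (rgt (lft p)) (rgt p)))"

definition dsum_lunit :: "('k, 'a, ('k, 'b) elt) amod \<Rightarrow> ('k, 'a, ('k, 'b) elt) arrow" where
  "dsum_lunit V = mk_arrow (dsum zero_mod V) V rgt"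

definition dsum_runit :: "('k, 'a, ('k, 'b) elt) amod \<Rightarrow> ('k, 'a, ('k, 'b) elt) arrow" where
  "dsum_runit V = mk_arrow (dsum V zero_mod) V lft"

definition dsum_sym ::
    "('k, 'a, ('k, 'b) elt) amod \<Rightarrow> ('k, 'a, ('k, 'b) elt) amod
     \<Rightarrow> ('k, 'a, ('k, 'b) elt) arrow" where
  "dsum_sym V W = mk_arrow (dsum V W) (dsum W V) (\<lambda>p. Couple (rgt p) (lft p))"


subsection \<open>Tensor products\<close>

definition mtensor_space ::
    "('k::field, 'a, ('k, 'b) elt) amod \<Rightarrow> ('k, 'a, ('k, 'b) elt) amod
     \<Rightarrow> ('k, ('k, 'b) elt) vspace" where
  "mtensor_space V W =
     \<lparr>carr = Tensor ` carr (tensor V W),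
      vadd = (\<lambda>s t. Tensor (vadd (tensor V W) (untensor s) (untensor t))),
      vzero = Tensor (vzero (tensor V W)),
      vscl = (\<lambda>c t. Tensor (vscl (tensor V W) c (untensor t)))\<rparr>"

definition mtens ::
    "('k::field, 'a, ('k, 'b) elt) amod \<Rightarrow> ('k, 'a, ('k, 'b) elt) amod
     \<Rightarrow> ('k, 'b) elt \<Rightarrow> ('k, 'b) elt \<Rightarrow> ('k, 'b) elt" where
  "mtens V W v w = Tensor (simple_tensor V W v w)"

definition mlift ::
    "('k, 'u, 'e) vspace_scheme \<Rightarrow> (('k, 'b) elt \<Rightarrow> ('k, 'b) elt \<Rightarrow> 'u) \<Rightarrow> ('k, 'b) elt \<Rightarrow> 'u" where
  "mlift U b t = tensor_lift U b (untensor t)"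

text \<open>The action of \<open>A \<otimes> A\<close> on \<open>V \<otimes> W\<close>.\<close>

definition act2 ::
    "('k::field, 'a, ('k, 'b) elt) amod \<Rightarrow> ('k, 'a, ('k, 'b) elt) amod
     \<Rightarrow> ('a \<times> 'a) list \<Rightarrow> ('k, 'b) elt \<Rightarrow> ('k, 'b) elt" where
  "act2 V W X t =
     tensor_lift (mtensor_space V W)
       (\<lambda>x y. mlift (mtensor_space V W) (\<lambda>v w. mtens V W (act V x v) (act W y w)) t) X"

definition mtensor ::
    "('a \<Rightarrow> ('a \<times> 'a) list) \<Rightarrow> ('k::field, 'a, ('k, 'b) elt) amod
     \<Rightarrow> ('k, 'a, ('k, 'b) elt) amod \<Rightarrow> ('k, 'a, ('k, 'b) elt) amod" where
  "mtensor \<Delta> V W =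
     \<lparr>carr = carr (mtensor_space V W),
      vadd = vadd (mtensor_space V W),
      vzero = vzero (mtensor_space V W),
      vscl = vscl (mtensor_space V W),
      act = (\<lambda>x. act2 V W (\<Delta> x))\<rparr>"

definition unit_mod :: "('a \<Rightarrow> 'k) \<Rightarrow> ('k::field, 'a, ('k, 'b) elt) amod" where
  "unit_mod \<epsilon> =
     \<lparr>carr = range Scalar,
      vadd = (\<lambda>c d. Scalar (unscalar c + unscalar d)),
      vzero = Scalar 0,
      vscl = (\<lambda>c d. Scalar (c * unscalar d)),
      act = (\<lambda>x d. Scalar (\<epsilon> x * unscalar d))\<rparr>"

definition mtensor_arr ::
    "('a \<Rightarrow> ('a \<times> 'a) list) \<Rightarrow> ('k::field, 'a, ('k, 'b) elt) arrow
     \<Rightarrow> ('k, 'a, ('k, 'b) elt) arrow \<Rightarrow> ('k, 'a, ('k, 'b) elt) arrow" where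
  "mtensor_arr \<Delta> f g =
     mk_arrow (mtensor \<Delta> (adom f) (adom g)) (mtensor \<Delta> (acod f) (acod g))
       (mlift (mtensor_space (acod f) (acod g))
         (\<lambda>v w. mtens (acod f) (acod g) (afun f v) (afun g w)))"

definition mtensor_assoc ::
    "('a \<Rightarrow> ('a \<times> 'a) list) \<Rightarrow> ('k::field, 'a, ('k, 'b) elt) amod
     \<Rightarrow> ('k, 'a, ('k, 'b) elt) amod \<Rightarrow> ('k, 'a, ('k, 'b) elt) amod
     \<Rightarrow> ('k, 'a, ('k, 'b) elt) arrow" where
  "mtensor_assoc \<Delta> U V W =
     (let T = mtensor \<Delta> U (mtensor \<Delta> V W)
      in mk_arrow (mtensor \<Delta> (mtensor \<Delta> U V) W) T
           (mlift T (\<lambda>t w. mlift T (\<lambda>u v. mtens U (mtensor \<Delta> V W) u (mtens V W v w)) t)))"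

definition mtensor_lunit ::
    "('a \<Rightarrow> ('a \<times> 'a) list) \<Rightarrow> ('a \<Rightarrow> 'k) \<Rightarrow> ('k::field, 'a, ('k, 'b) elt) amod
     \<Rightarrow> ('k, 'a, ('k, 'b) elt) arrow" where
  "mtensor_lunit \<Delta> \<epsilon> V =
     mk_arrow (mtensor \<Delta> (unit_mod \<epsilon>) V) V (mlift V (\<lambda>c v. vscl V (unscalar c) v))"

definition mtensor_runit ::
    "('a \<Rightarrow> ('a \<times> 'a) list) \<Rightarrow> ('a \<Rightarrow> 'k) \<Rightarrow> ('k::field, 'a, ('k, 'b) elt) amod
     \<Rightarrow> ('k, 'a, ('k, 'b) elt) arrow" where
  "mtensor_runit \<Delta> \<epsilon> V =
     mk_arrow (mtensor \<Delta> V (unit_mod \<epsilon>)) V (mlift V (\<lambda>v c. vscl V (unscalar c) v))"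

definition mtensor_lnull ::
    "('a \<Rightarrow> ('a \<times> 'a) list) \<Rightarrow> ('k::field, 'a, ('k, 'b) elt) amod
     \<Rightarrow> ('k, 'a, ('k, 'b) elt) arrow" where
  "mtensor_lnull \<Delta> V = mk_arrow (mtensor \<Delta> zero_mod V) zero_mod (\<lambda>t. Star)"

definition mtensor_rnull ::
    "('a \<Rightarrow> ('a \<times> 'a) list) \<Rightarrow> ('k::field, 'a, ('k, 'b) elt) amod
     \<Rightarrow> ('k, 'a, ('k, 'b) elt) arrow" where
  "mtensor_rnull \<Delta> V = mk_arrow (mtensor \<Delta> V zero_mod) zero_mod (\<lambda>t. Star)"

definition mtensor_ldistrib ::
    "('a \<Rightarrow> ('a \<times> 'a) list) \<Rightarrow> ('k::field, 'a, ('k, 'b) elt) amod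
     \<Rightarrow> ('k, 'a, ('k, 'b) elt) amod \<Rightarrow> ('k, 'a, ('k, 'b) elt) amod
     \<Rightarrow> ('k, 'a, ('k, 'b) elt) arrow" where
  "mtensor_ldistrib \<Delta> U V W =
     (let S = dsum (mtensor \<Delta> U V) (mtensor \<Delta> U W)
      in mk_arrow (mtensor \<Delta> U (dsum V W)) S
           (mlift S (\<lambda>u p. Couple (mtens U V u (lft p)) (mtens U W u (rgt p)))))"

definition mtensor_rdistrib ::
    "('a \<Rightarrow> ('a \<times> 'a) list) \<Rightarrow> ('k::field, 'a, ('k, 'b) elt) amod
     \<Rightarrow> ('k, 'a, ('k, 'b) elt) amod \<Rightarrow> ('k, 'a, ('k, 'b) elt) amod
     \<Rightarrow> ('k, 'a, ('k, 'b) elt) arrow" where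
  "mtensor_rdistrib \<Delta> U V W =
     (let S = dsum (mtensor \<Delta> U W) (mtensor \<Delta> V W)
      in mk_arrow (mtensor \<Delta> (dsum U V) W) S
           (mlift S (\<lambda>p w. Couple (mtens U W (lft p) w) (mtens V W (rgt p) w))))"

definition mtensor_swap ::
    "('k::field, 'a, ('k, 'b) elt) amod \<Rightarrow> ('k, 'a, ('k, 'b) elt) amod
     \<Rightarrow> ('k, 'b) elt \<Rightarrow> ('k, 'b) elt" where
  "mtensor_swap V W = mlift (mtensor_space W V) (\<lambda>v w. mtens W V w v)"

definition mtensor_braid ::
    "('a \<Rightarrow> ('a \<times> 'a) list) \<Rightarrow> ('a \<times> 'a) list \<Rightarrow> ('k::field, 'a, ('k, 'b) elt) amod
     \<Rightarrow> ('k, 'a, ('k, 'b) elt) amod \<Rightarrow> ('k, 'a, ('k, 'b) elt) arrow" where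
  "mtensor_braid \<Delta> R V W =
     mk_arrow (mtensor \<Delta> V W) (mtensor \<Delta> W V) (\<lambda>t. mtensor_swap V W (act2 V W R t))"

end

theory Submission
  imports Defs
begin

text \<open>
  A linear map out of a tensor product is determined by its values on pure tensors, and every bilinear
  map prescribes such values. All structure maps of the category of modules are given by simple formulas
  on pure tensors, and each coherence axiom compares two linear maps which visibly agree there: both
  sides rearrange, distribute or drop the same vectors. What has to be argued is that the structure maps
  are invertible, for which the inverse is written down by the universal property, and that they commute
  with the action of \<open>A\<close>. Only the latter involves the bialgebra.

  The action of \<open>A\<close> on \<open>V \<otimes> W\<close> is the pullback along \<open>\<Delta>\<close> of the action of \<open>A \<otimes> A\<close>, and the axioms of a bialgebra
  translate one by one. Multiplicativity of \<open>\<Delta>\<close> makes \<open>V \<otimes> W\<close> a module (\<open>left_module_mtensor\<close>). The counit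
  laws make the unit isomorphisms homomorphisms (\<open>mtensor_lunit_Arr\<close>, \<open>mtensor_runit_Arr\<close>). An element of
  \<open>A \<otimes> A\<close> acts on \<open>(U \<otimes> V) \<otimes> W\<close> and on \<open>U \<otimes> (V \<otimes> W)\<close> through its images in \<open>A \<otimes> (A \<otimes> A)\<close> under \<open>\<Delta> \<otimes> 1\<close> and \<open>1 \<otimes> \<Delta>\<close>
  (\<open>mtensor_assoc_act\<close>, \<open>mtensor_act_comul_right\<close>), so that coassociativity makes the associator a
  homomorphism.

  The same dictionary handles the braiding, which lets \<open>R\<close> act and then exchanges the factors. The
  commutation rule of \<open>R\<close> with \<open>\<Delta>\<close> makes it a homomorphism (\<open>mtensor_braid_Arr\<close>), invertibility of \<open>R\<close> makes it
  an isomorphism, the formulas for \<open>(1 \<otimes> \<Delta>)(R)\<close> and \<open>(\<Delta> \<otimes> 1)(R)\<close> are the hexagons (\<open>mtensor_hexagon1\<close>,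
  \<open>mtensor_hexagon2\<close>), and \<open>R\<^sup>o\<^sup>p R = 1\<close> is symmetry. Compatibility with direct sums is linear in \<open>R\<close> and holds
  for every element of \<open>A \<otimes> A\<close> in its place.

  Elements of tensor products are chosen representatives of formal sums. That they satisfy the universal
  property is \<open>linear_on_tensor_lift\<close> with \<open>tensor_lift_simple_tensor\<close>; that pure tensors generate is
  \<open>generates_simple_tensor\<close>, and \<open>linear_on_eqI\<close> is the resulting test for equality of linear maps.
\<close>

section \<open>Linear and bilinear maps between spaces with carrier\<close>

definition linear_on ::
    "('k, 'v, 'e) vspace_scheme \<Rightarrow> ('k, 'u, 'f) vspace_scheme \<Rightarrow> ('v \<Rightarrow> 'u) \<Rightarrow> bool" where
  "linear_on V U f \<longleftrightarrow>
     f \<in> carr V \<rightarrow> carr U \<and>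
     (\<forall>u\<in>carr V. \<forall>v\<in>carr V. f (vadd V u v) = vadd U (f u) (f v)) \<and>
     (\<forall>c. \<forall>v\<in>carr V. f (vscl V c v) = vscl U c (f v))"

definition bilinear_on ::
    "('k, 'v, 'e) vspace_scheme \<Rightarrow> ('k, 'w, 'f) vspace_scheme \<Rightarrow> ('k, 'u, 'g) vspace_scheme
     \<Rightarrow> ('v \<Rightarrow> 'w \<Rightarrow> 'u) \<Rightarrow> bool" where
  "bilinear_on V W U b \<longleftrightarrow>
     (\<forall>v\<in>carr V. linear_on W U (\<lambda>w. b v w)) \<and> (\<forall>w\<in>carr W. linear_on V U (\<lambda>v. b v w))"

text \<open>
  \<open>S\<close> spans \<open>V\<close> by sums alone. This is what pure tensors do, because they are stable under scaling.
  Quantifying over the sets \<open>E\<close> that are closed under sums makes the definition an induction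
  principle, in a form that composes along iterated tensor products.
\<close>

definition generates :: "'v set \<Rightarrow> ('k, 'v, 'e) vspace_scheme \<Rightarrow> bool" where
  "generates S V \<longleftrightarrow>
     S \<subseteq> carr V \<and>
     (\<forall>E. vzero V \<in> E \<longrightarrow> (\<forall>u\<in>carr V \<inter> E. \<forall>v\<in>carr V \<inter> E. vadd V u v \<in> E) \<longrightarrow> S \<subseteq> E
        \<longrightarrow> carr V \<subseteq> E)"

lemma linear_onI:
  assumes "\<And>v. v \<in> carr V \<Longrightarrow> f v \<in> carr U"
    and "\<And>u v. \<lbrakk>u \<in> carr V; v \<in> carr V\<rbrakk> \<Longrightarrow> f (vadd V u v) = vadd U (f u) (f v)"
    and "\<And>c v. v \<in> carr V \<Longrightarrow> f (vscl V c v) = vscl U c (f v)"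
  shows "linear_on V U f"
  using assms by (simp add: linear_on_def)

lemma linear_on_closed: "\<lbrakk>linear_on V U f; v \<in> carr V\<rbrakk> \<Longrightarrow> f v \<in> carr U"
  and linear_on_vadd:
    "\<lbrakk>linear_on V U f; u \<in> carr V; v \<in> carr V\<rbrakk> \<Longrightarrow> f (vadd V u v) = vadd U (f u) (f v)"
  and linear_on_vscl: "\<lbrakk>linear_on V U f; v \<in> carr V\<rbrakk> \<Longrightarrow> f (vscl V c v) = vscl U c (f v)"
  by (auto simp: linear_on_def)

context carrier_vector_space
begin

lemma vadd_left_commute:
  "\<lbrakk>u \<in> carr V; v \<in> carr V; w \<in> carr V\<rbrakk> \<Longrightarrow> vadd V u (vadd V v w) = vadd V v (vadd V u w)"
  by (metis vadd_assoc vadd_commute)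

lemma vadd_vzero_right: "v \<in> carr V \<Longrightarrow> vadd V v (vzero V) = v"
  by (metis vadd_commute vadd_vzero vzero_closed)

lemma vadd_idem: "v \<in> carr V \<Longrightarrow> vadd V v v = v \<Longrightarrow> v = vzero V"
  by (metis vadd_assoc vadd_inverse vadd_vzero_right)

lemma vscl_zero: "v \<in> carr V \<Longrightarrow> vscl V 0 v = vzero V"
  by (metis add.right_neutral vadd_idem vscl_add vscl_closed)

lemma vscl_vzero: "vscl V c (vzero V) = vzero V"
  by (metis mult_zero_right vscl_mult vscl_zero vzero_closed)

lemma vscl_neg: "v \<in> carr V \<Longrightarrow> vadd V v (vscl V (- 1) v) = vzero V"
  by (metis add.right_inverse vscl_add vscl_one vscl_zero)

lemmas vs_simps = vadd_closed vzero_closed vadd_vzero vadd_vzero_right vscl_closed vscl_vadd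
  vscl_add vscl_mult vscl_one vscl_zero vscl_vzero

lemmas vs_ac = vadd_assoc vadd_commute vadd_left_commute

end

lemma linear_on_vzero:
  assumes "carrier_vector_space V" "carrier_vector_space U" "linear_on V U f"
  shows "f (vzero V) = vzero U"
proof -
  interpret V: carrier_vector_space V by fact
  interpret U: carrier_vector_space U by fact
  show ?thesis
    using linear_on_vscl[OF assms(3) V.vzero_closed, of 0] linear_on_closed[OF assms(3) V.vzero_closed]
    by (simp add: V.vscl_zero V.vzero_closed U.vscl_zero)
qed

lemma linear_on_id: "linear_on V V (\<lambda>v. v)"
  by (simp add: linear_on_def)

lemma linear_on_comp:
  assumes "linear_on W U g" "linear_on V W f"
  shows "linear_on V U (\<lambda>v. g (f v))"
  using assms by (auto simp: linear_on_def Pi_iff)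

lemma linear_on_const_vzero: "carrier_vector_space U \<Longrightarrow> linear_on V U (\<lambda>v. vzero U)"
  by (simp add: linear_on_def carrier_vector_space.vzero_closed carrier_vector_space.vadd_vzero
      carrier_vector_space.vscl_vzero)

lemma linear_on_plus:
  assumes "carrier_vector_space U" "linear_on V U f" "linear_on V U g"
  shows "linear_on V U (\<lambda>v. vadd U (f v) (g v))"
proof -
  interpret U: carrier_vector_space U by fact
  show ?thesis
    using assms(2,3) by (auto simp: linear_on_def Pi_iff U.vs_simps U.vs_ac)
qed

lemma linear_on_scale:
  assumes "carrier_vector_space U" "linear_on V U f"
  shows "linear_on V U (\<lambda>v. vscl U c (f v))"
proof -
  interpret U: carrier_vector_space U by fact
  show ?thesis
    using assms(2)
    by (auto simp: linear_on_def Pi_iff U.vscl_closed U.vscl_vadd)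
      (metis U.vscl_mult mult.commute)
qed

lemma linear_on_vscl_left:
  assumes "carrier_vector_space U" "linear_on V (\<lparr>carr = UNIV, vadd = (+), vzero = 0, vscl = (*)\<rparr>) f" "u \<in> carr U"
  shows "linear_on V U (\<lambda>v. vscl U (f v) u)"
proof -
  interpret U: carrier_vector_space U by fact
  show ?thesis
    using assms(2,3) by (auto simp: linear_on_def Pi_iff U.vs_simps)
qed

lemma generatesD:
  assumes "generates S V" "vzero V \<in> E"
    "\<And>u v. \<lbrakk>u \<in> carr V; v \<in> carr V; u \<in> E; v \<in> E\<rbrakk> \<Longrightarrow> vadd V u v \<in> E" "S \<subseteq> E" "v \<in> carr V"
  shows "v \<in> E"
proof -
  have "\<forall>u\<in>carr V \<inter> E. \<forall>v\<in>carr V \<inter> E. vadd V u v \<in> E" using assms(3) by blast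
  then show ?thesis using assms unfolding generates_def by blast
qed

lemma generates_carr: "generates (carr V) V"
  by (simp add: generates_def)

text \<open>
  The equalizer of two linear maps contains zero and is closed under sums. The identities
  between maps on tensor products below are reduced in this way to identities between pure tensors.
\<close>

lemma linear_on_eqI:
  assumes "carrier_vector_space V" "carrier_vector_space U" "generates S V"
    and "linear_on V U f" "linear_on V U g" "\<And>s. s \<in> S \<Longrightarrow> f s = g s" "v \<in> carr V"
  shows "f v = g v"
proof -
  have "v \<in> {v. f v = g v}"
    by (rule generatesD[OF assms(3) _ _ _ assms(7)])
      (use assms in \<open>auto simp: linear_on_vadd linear_on_vzero\<close>)
  then show ?thesis by simp
qed


section \<open>The tensor product and its universal property\<close>

lemma tensor_eq_sets:
  assumes "carrier_vector_space V" "carrier_vector_space W" "tensor_eq V W xs ys"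
  shows "set xs \<subseteq> carr V \<times> carr W \<and> set ys \<subseteq> carr V \<times> carr W"
  using assms(3)
proof (induction rule: tensor_eq.induct)
qed (use assms(1,2) in \<open>auto simp: carrier_vector_space.vadd_closed
      carrier_vector_space.vzero_closed carrier_vector_space.vscl_closed\<close>)

lemma tensor_lift_Nil: "tensor_lift U b [] = vzero U"
  and tensor_lift_Cons: "tensor_lift U b ((v, w) # xs) = vadd U (b v w) (tensor_lift U b xs)"
  by (simp_all add: tensor_lift_def)

lemma bilinear_on_closed: "\<lbrakk>bilinear_on V W U b; v \<in> carr V; w \<in> carr W\<rbrakk> \<Longrightarrow> b v w \<in> carr U"
  by (auto simp: bilinear_on_def linear_on_def)

lemma tensor_lift_closed:
  assumes "carrier_vector_space U" "bilinear_on V W U b"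
    and "set xs \<subseteq> carr V \<times> carr W"
  shows "tensor_lift U b xs \<in> carr U"
  using assms(3)
  by (induction xs)
    (auto simp: tensor_lift_Nil tensor_lift_Cons assms(1) carrier_vector_space.vadd_closed
      carrier_vector_space.vzero_closed bilinear_on_closed[OF assms(2)])

lemma tensor_lift_append:
  assumes "carrier_vector_space U" "bilinear_on V W U b"
    and "set xs \<subseteq> carr V \<times> carr W" "set ys \<subseteq> carr V \<times> carr W"
  shows "tensor_lift U b (xs @ ys) = vadd U (tensor_lift U b xs) (tensor_lift U b ys)"
proof -
  interpret U: carrier_vector_space U by fact
  have c: "tensor_lift U b zs \<in> carr U" if "set zs \<subseteq> carr V \<times> carr W" for zs
    by (rule tensor_lift_closed[OF assms(1,2) that])
  show ?thesis
    using assms(3)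
    by (induction xs) (auto simp: tensor_lift_Nil tensor_lift_Cons U.vs_simps U.vadd_assoc c assms(4)
        bilinear_on_closed[OF assms(2)])
qed

text \<open>
  Bilinearity of \<open>b\<close> is exactly invariance of \<open>tensor_lift U b\<close> under the generators of the congruence;
  the rules for concatenation correspond to additivity and commutativity in \<open>U\<close>.
\<close>

lemma tensor_lift_eq:
  assumes V: "carrier_vector_space V" and W: "carrier_vector_space W" and U: "carrier_vector_space U"
    and b: "bilinear_on V W U b" and "tensor_eq V W xs ys"
  shows "tensor_lift U b xs = tensor_lift U b ys"
proof -
  interpret V: carrier_vector_space V by fact
  interpret W: carrier_vector_space W by fact
  interpret U: carrier_vector_space U by fact
  have bc: "\<And>v w. \<lbrakk>v \<in> carr V; w \<in> carr W\<rbrakk> \<Longrightarrow> b v w \<in> carr U"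
    using b by (rule bilinear_on_closed)
  note app = tensor_lift_append[OF U b] and clo = tensor_lift_closed[OF U b]
  have l: "\<And>w. w \<in> carr W \<Longrightarrow> linear_on V U (\<lambda>v. b v w)" and r: "\<And>v. v \<in> carr V \<Longrightarrow> linear_on W U (b v)"
    using b by (auto simp: bilinear_on_def)
  show ?thesis
    using assms(5)
  proof (induction rule: tensor_eq.induct)
    case (append xs xs' ys ys')
    note s = tensor_eq_sets[OF V W append.hyps(1)] tensor_eq_sets[OF V W append.hyps(2)]
    show ?case
      using s append.IH by (simp add: app[of xs ys] app[of xs' ys'])
  next
    case (commute xs ys)
    then show ?case
      by (simp add: app[of xs ys] app[of ys xs] U.vadd_commute[OF clo clo])
  qed (simp_all add: tensor_lift_Nil tensor_lift_Cons U.vs_simps V.vs_simps W.vs_simps bc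
      linear_on_vzero[OF V U l] linear_on_vzero[OF W U r] linear_on_vadd[OF l] linear_on_vadd[OF r]
      linear_on_vscl[OF l] linear_on_vscl[OF r])
qed

lemma tensor_rep_eq:
  assumes "set xs \<subseteq> carr V \<times> carr W"
  shows "tensor_eq V W xs (tensor_rep V W xs)"
  unfolding tensor_rep_def by (rule someI, rule tensor_eq.refl[OF assms])

text \<open>
  Equivalent formal sums have the same set of equivalent sums, so the choice operator picks the same
  representative for both. With \<open>tensor_rep_eq\<close> this makes \<open>tensor_rep\<close> a normal form.
\<close>

lemma tensor_rep_cong: "tensor_eq V W xs ys \<Longrightarrow> tensor_rep V W xs = tensor_rep V W ys"
  unfolding tensor_rep_def
  by (rule arg_cong[where f = Eps], rule ext) (blast intro: tensor_eq.sym tensor_eq.trans)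

lemma tensor_eq_map_scl:
  assumes V: "carrier_vector_space V" and W: "carrier_vector_space W"
    and "tensor_eq V W xs ys"
  shows "tensor_eq V W (map (\<lambda>(v, w). (vscl V c v, w)) xs) (map (\<lambda>(v, w). (vscl V c v, w)) ys)"
    (is "tensor_eq V W (?m xs) (?m ys)")
proof -
  interpret V: carrier_vector_space V by fact
  interpret W: carrier_vector_space W by fact
  have m: "set (?m xs) \<subseteq> carr V \<times> carr W" if "set xs \<subseteq> carr V \<times> carr W" for xs
    using that by (auto simp: V.vs_simps)
  show ?thesis
    using assms(3)
  proof (induction rule: tensor_eq.induct)
    case (refl xs)
    then show ?case by (intro tensor_eq.refl m)
  next
    case (append xs xs' ys ys')
    then show ?case by (simp add: tensor_eq.append)
  next
    case (commute xs ys)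
    then show ?case by (simp only: map_append) (intro tensor_eq.commute m)
  next
    case (balanced v w d)
    have "vscl V c (vscl V d v) = vscl V d (vscl V c v)"
      using balanced by (simp add: V.vscl_mult[symmetric] mult.commute)
    then show ?case using balanced by (simp add: tensor_eq.balanced V.vs_simps)
  qed (auto simp: V.vs_simps W.vs_simps intro: tensor_eq.sym tensor_eq.trans tensor_eq.zero_left
      tensor_eq.zero_right tensor_eq.add_left tensor_eq.add_right)
qed

lemma tensor_vzero: "vzero (tensor V W) = tensor_rep V W []"
  and tensor_vadd: "vadd (tensor V W) s t = tensor_rep V W (s @ t)"
  and tensor_vscl: "vscl (tensor V W) c t = tensor_rep V W (map (\<lambda>(v, w). (vscl V c v, w)) t)"
  by (simp_all add: tensor_def)

lemma tensor_rep_carr: "set xs \<subseteq> carr V \<times> carr W \<Longrightarrow> tensor_rep V W xs \<in> carr (tensor V W)"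
  by (auto simp: tensor_def)

context
  fixes V :: "('k::field, 'v, 'e) vspace_scheme" and W :: "('k, 'w, 'f) vspace_scheme"
  assumes V: "carrier_vector_space V" and W: "carrier_vector_space W"
begin

interpretation V: carrier_vector_space V by (rule V)
interpretation W: carrier_vector_space W by (rule W)

lemma tensor_carr_rep:
  assumes "t \<in> carr (tensor V W)"
  shows "set t \<subseteq> carr V \<times> carr W" "tensor_rep V W t = t"
proof -
  obtain xs where xs: "t = tensor_rep V W xs" "set xs \<subseteq> carr V \<times> carr W"
    using assms by (auto simp: tensor_def)
  note e = tensor_rep_eq[OF xs(2)]
  show "set t \<subseteq> carr V \<times> carr W" using tensor_eq_sets[OF V W e] xs by simp
  show "tensor_rep V W t = t" using tensor_rep_cong[OF e] xs by simp
qed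

lemma tensor_rep_add:
  assumes "set xs \<subseteq> carr V \<times> carr W" "set ys \<subseteq> carr V \<times> carr W"
  shows "vadd (tensor V W) (tensor_rep V W xs) (tensor_rep V W ys) = tensor_rep V W (xs @ ys)"
  unfolding tensor_vadd
  by (rule tensor_rep_cong) (intro tensor_eq.append tensor_eq.sym[OF tensor_rep_eq] assms)

lemma tensor_rep_scl:
  assumes "set xs \<subseteq> carr V \<times> carr W"
  shows "vscl (tensor V W) c (tensor_rep V W xs) = tensor_rep V W (map (\<lambda>(v, w). (vscl V c v, w)) xs)"
  unfolding tensor_vscl
  by (rule tensor_rep_cong) (intro tensor_eq_map_scl V W tensor_eq.sym[OF tensor_rep_eq] assms)

lemma tensor_carrE:
  assumes "t \<in> carr (tensor V W)"
  obtains xs where "t = tensor_rep V W xs" "set xs \<subseteq> carr V \<times> carr W"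
  using assms by (auto simp: tensor_def)

text \<open>
  Formal sums carry no negation. Additive inverses in the tensor product arise by scaling all left
  factors by \<open>- 1\<close>.
\<close>

lemma tensor_eq_cancel:
  assumes "set xs \<subseteq> carr V \<times> carr W"
  shows "tensor_eq V W (xs @ map (\<lambda>(v, w). (vscl V (- 1) v, w)) xs) []"
  using assms
proof (induction xs)
  case Nil
  then show ?case by (simp add: tensor_eq.refl)
next
  case (Cons p xs)
  let ?m = "\<lambda>(v, w). (vscl V (- 1) v, w)"
  obtain v w where p: "p = (v, w)" "v \<in> carr V" "w \<in> carr W" using Cons.prems by auto
  have xs: "set xs \<subseteq> carr V \<times> carr W" and mxs: "set (map ?m xs) \<subseteq> carr V \<times> carr W"
    using Cons.prems by (auto simp: V.vs_simps)
  have 1: "tensor_eq V W ([p] @ xs @ [?m p] @ map ?m xs) ([p] @ ([?m p] @ xs) @ map ?m xs)"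
    (is "tensor_eq V W ?l ?r")
  proof -
    have "tensor_eq V W (xs @ [?m p]) ([?m p] @ xs)"
      using p xs by (intro tensor_eq.commute) (auto simp: V.vs_simps)
    from tensor_eq.append[OF tensor_eq.append[OF tensor_eq.refl this] tensor_eq.refl[OF mxs], of "[p]"]
    show ?thesis using p by simp
  qed
  have "tensor_eq V W [p, ?m p] [(vadd V v (vscl V (- 1) v), w)]"
    using p by (auto simp: V.vs_simps intro!: tensor_eq.sym[OF tensor_eq.add_left])
  then have "tensor_eq V W [p, ?m p] []"
    using tensor_eq.zero_left[OF p(3), of V] p by (auto simp: V.vscl_neg intro: tensor_eq.trans)
  from tensor_eq.append[OF this Cons.IH[OF xs]]
  have "tensor_eq V W ([p] @ ([?m p] @ xs) @ map ?m xs) []" by simp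
  with 1 show ?case by (auto intro: tensor_eq.trans)
qed

lemma tensor_carrier_vector_space: "carrier_vector_space (tensor V W)"
proof
  fix c d :: 'k
  fix t u v assume t: "t \<in> carr (tensor V W)"
  from t obtain xs where xs: "t = tensor_rep V W xs" "set xs \<subseteq> carr V \<times> carr W"
    by (rule tensor_carrE)
  have mxs: "set (map (\<lambda>(v, w). (vscl V e v, w)) xs) \<subseteq> carr V \<times> carr W" for e
    using xs by (auto simp: V.vs_simps)
  show "vadd (tensor V W) (vzero (tensor V W)) t = t"
    using xs by (simp add: tensor_vzero tensor_rep_add)
  show "vscl (tensor V W) c t \<in> carr (tensor V W)"
    using xs mxs by (simp add: tensor_rep_scl tensor_rep_carr)
  have m1: "map (\<lambda>(v, w). (vscl V 1 v, w)) xs = xs"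
    using xs(2) by (intro map_idI) (auto simp: V.vs_simps)
  show "vscl (tensor V W) 1 t = t"
    using xs m1 by (simp only: tensor_rep_scl)
  have m2: "map (\<lambda>(v, w). (vscl V (c * d) v, w)) xs =
      map (\<lambda>(v, w). (vscl V c v, w)) (map (\<lambda>(v, w). (vscl V d v, w)) xs)"
    using xs(2) by (auto simp: V.vs_simps)
  show "vscl (tensor V W) (c * d) t = vscl (tensor V W) c (vscl (tensor V W) d t)"
    using xs mxs m2 by (simp only: tensor_rep_scl)
  have "tensor_eq V W (map (\<lambda>(v, w). (vscl V (c + d) v, w)) ys)
      (map (\<lambda>(v, w). (vscl V c v, w)) ys @ map (\<lambda>(v, w). (vscl V d v, w)) ys)"
    if "set ys \<subseteq> carr V \<times> carr W" for ys
    using that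
  proof (induction ys)
    case Nil
    then show ?case by (simp add: tensor_eq.refl)
  next
    case (Cons p ys)
    let ?m = "\<lambda>e. \<lambda>(v, w). (vscl V e v, w)"
    obtain v w where p: "p = (v, w)" "v \<in> carr V" "w \<in> carr W" using Cons.prems by auto
    have m: "set (map (?m e) ys) \<subseteq> carr V \<times> carr W" for e
      using Cons.prems by (auto simp: V.vs_simps)
    have "tensor_eq V W ([?m (c + d) p] @ map (?m (c + d)) ys)
        ([?m c p, ?m d p] @ map (?m c) ys @ map (?m d) ys)"
      using Cons p by (intro tensor_eq.append) (auto simp: V.vs_simps intro: tensor_eq.add_left)
    moreover have "tensor_eq V W ([?m c p] @ ([?m d p] @ map (?m c) ys) @ map (?m d) ys)
        ([?m c p] @ (map (?m c) ys @ [?m d p]) @ map (?m d) ys)"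
      using p m by (intro tensor_eq.append tensor_eq.refl tensor_eq.commute) (auto simp: V.vs_simps)
    ultimately show ?case by (auto intro: tensor_eq.trans)
  qed
  from tensor_rep_cong[OF this[OF xs(2)]]
  show "vscl (tensor V W) (c + d) t = vadd (tensor V W) (vscl (tensor V W) c t) (vscl (tensor V W) d t)"
    using xs mxs by (simp add: tensor_rep_scl tensor_rep_add)
  show "\<exists>w\<in>carr (tensor V W). vadd (tensor V W) t w = vzero (tensor V W)"
  proof
    let ?n = "map (\<lambda>(v, w). (vscl V (- 1) v, w)) xs"
    show "tensor_rep V W ?n \<in> carr (tensor V W)" using mxs by (rule tensor_rep_carr)
    show "vadd (tensor V W) t (tensor_rep V W ?n) = vzero (tensor V W)"
      using tensor_rep_cong[OF tensor_eq_cancel[OF xs(2)]] xs mxs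
      by (simp add: tensor_rep_add tensor_vzero)
  qed
  assume u: "u \<in> carr (tensor V W)"
  from u obtain ys where ys: "u = tensor_rep V W ys" "set ys \<subseteq> carr V \<times> carr W"
    by (rule tensor_carrE)
  show "vadd (tensor V W) t u \<in> carr (tensor V W)"
    using xs ys by (simp add: tensor_rep_add tensor_rep_carr)
  show "vadd (tensor V W) t u = vadd (tensor V W) u t"
    using xs ys by (auto simp: tensor_rep_add intro: tensor_rep_cong tensor_eq.commute)
  have mys: "set (map (\<lambda>(v, w). (vscl V e v, w)) ys) \<subseteq> carr V \<times> carr W" for e
    using ys by (auto simp: V.vs_simps)
  show "vscl (tensor V W) c (vadd (tensor V W) t u) =
      vadd (tensor V W) (vscl (tensor V W) c t) (vscl (tensor V W) c u)"
    using xs ys mxs mys by (simp add: tensor_rep_add tensor_rep_scl)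
  assume v: "v \<in> carr (tensor V W)"
  from v obtain zs where zs: "v = tensor_rep V W zs" "set zs \<subseteq> carr V \<times> carr W"
    by (rule tensor_carrE)
  show "vadd (tensor V W) (vadd (tensor V W) t u) v = vadd (tensor V W) t (vadd (tensor V W) u v)"
    using xs ys zs by (simp add: tensor_rep_add)
next
  show "vzero (tensor V W) \<in> carr (tensor V W)"
    by (simp add: tensor_vzero tensor_rep_carr)
qed

lemma simple_tensor_closed:
  "\<lbrakk>v \<in> carr V; w \<in> carr W\<rbrakk> \<Longrightarrow> simple_tensor V W v w \<in> carr (tensor V W)"
  by (simp add: simple_tensor_def tensor_rep_carr)

lemma bilinear_on_simple_tensor: "bilinear_on V W (tensor V W) (simple_tensor V W)"
  unfolding bilinear_on_def
proof (intro conjI ballI linear_onI; (simp add: simple_tensor_closed; fail)?)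
  fix u v w assume *: "u \<in> carr V" "v \<in> carr W" "w \<in> carr W"
  then show "simple_tensor V W u (vadd W v w) =
      vadd (tensor V W) (simple_tensor V W u v) (simple_tensor V W u w)"
    by (simp add: simple_tensor_def tensor_rep_add) (intro tensor_rep_cong tensor_eq.add_right)
next
  fix u v w assume *: "u \<in> carr W" "v \<in> carr V" "w \<in> carr V"
  then show "simple_tensor V W (vadd V v w) u =
      vadd (tensor V W) (simple_tensor V W v u) (simple_tensor V W w u)"
    by (simp add: simple_tensor_def tensor_rep_add) (intro tensor_rep_cong tensor_eq.add_left)
next
  fix u v c assume *: "u \<in> carr V" "v \<in> carr W"
  then show "simple_tensor V W u (vscl W c v) = vscl (tensor V W) c (simple_tensor V W u v)"
    by (simp add: simple_tensor_def tensor_rep_scl)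
      (intro tensor_rep_cong tensor_eq.sym[OF tensor_eq.balanced])
next
  fix u v c assume *: "u \<in> carr W" "v \<in> carr V"
  then show "simple_tensor V W (vscl V c v) u = vscl (tensor V W) c (simple_tensor V W v u)"
    by (simp add: simple_tensor_def tensor_rep_scl)
qed

text \<open>
  For a fixed generator \<open>s\<close> the vectors \<open>w\<close> whose pure tensor with \<open>s\<close> lies in \<open>E\<close> are closed under sums,
  hence exhaust \<open>W\<close>; the same argument in the left factor yields all pure tensors, and formal sums are
  sums of those.
\<close>

lemma generates_simple_tensor:
  assumes "generates S V" "generates T W"
  shows "generates {simple_tensor V W s t | s t. s \<in> S \<and> t \<in> T} (tensor V W)"
  unfolding generates_def
proof (intro conjI allI impI subsetI)
  interpret T: carrier_vector_space "tensor V W" by (rule tensor_carrier_vector_space)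
  have S: "S \<subseteq> carr V" and T: "T \<subseteq> carr W" using assms by (auto simp: generates_def)
  then show "t \<in> carr (tensor V W)"
    if "t \<in> {simple_tensor V W s t | s t. s \<in> S \<and> t \<in> T}" for t
    using that by (auto intro: simple_tensor_closed)
  fix E t
  assume 0: "vzero (tensor V W) \<in> E"
    and add: "\<forall>u\<in>carr (tensor V W) \<inter> E. \<forall>v\<in>carr (tensor V W) \<inter> E. vadd (tensor V W) u v \<in> E"
    and gen: "{simple_tensor V W s t | s t. s \<in> S \<and> t \<in> T} \<subseteq> E"
    and t: "t \<in> carr (tensor V W)"
  have l: "\<And>w. w \<in> carr W \<Longrightarrow> linear_on V (tensor V W) (\<lambda>v. simple_tensor V W v w)"
    and r: "\<And>v. v \<in> carr V \<Longrightarrow> linear_on W (tensor V W) (simple_tensor V W v)"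
    using bilinear_on_simple_tensor by (auto simp: bilinear_on_def)
  have 1: "simple_tensor V W s w \<in> E" if "s \<in> S" "w \<in> carr W" for s w
  proof -
    have s: "s \<in> carr V" and T': "T \<subseteq> {w. simple_tensor V W s w \<in> E}"
      using S that gen by auto
    have "w \<in> {w. simple_tensor V W s w \<in> E}"
      by (rule generatesD[OF assms(2) _ _ T' that(2)])
        (use 0 add s in \<open>auto simp: linear_on_vadd[OF r] simple_tensor_closed
          linear_on_vzero[OF W tensor_carrier_vector_space r]\<close>)
    then show ?thesis by simp
  qed
  have 2: "simple_tensor V W v w \<in> E" if "v \<in> carr V" "w \<in> carr W" for v w
  proof -
    have "v \<in> {v. simple_tensor V W v w \<in> E}"
      by (rule generatesD[OF assms(1) _ _ _ that(1)])
        (use 0 add 1 that in \<open>auto simp: linear_on_vadd[OF l] simple_tensor_closed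
          linear_on_vzero[OF V tensor_carrier_vector_space l]\<close>)
    then show ?thesis by simp
  qed
  have "tensor_rep V W xs \<in> E" if "set xs \<subseteq> carr V \<times> carr W" for xs
    using that
  proof (induction xs)
    case Nil
    then show ?case using 0 by (simp add: tensor_vzero)
  next
    case (Cons p xs)
    then obtain v w where p: "p = (v, w)" "v \<in> carr V" "w \<in> carr W" by auto
    have "tensor_rep V W (p # xs) = vadd (tensor V W) (simple_tensor V W v w) (tensor_rep V W xs)"
      using Cons.prems p by (simp add: simple_tensor_def tensor_rep_add)
    then show ?case using Cons p add 2 by (auto simp: simple_tensor_closed tensor_rep_carr)
  qed
  then show "t \<in> E" using t by (metis tensor_carrE)
qed

context
  fixes U :: "('k, 'u, 'g) vspace_scheme" and b
  assumes U: "carrier_vector_space U" and b: "bilinear_on V W U b"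
begin

interpretation U: carrier_vector_space U by (rule U)

lemma tensor_lift_rep:
  assumes "set xs \<subseteq> carr V \<times> carr W"
  shows "tensor_lift U b (tensor_rep V W xs) = tensor_lift U b xs"
  using tensor_lift_eq[OF V W U b tensor_rep_eq[OF assms]] by simp

lemma tensor_lift_simple_tensor:
  "\<lbrakk>v \<in> carr V; w \<in> carr W\<rbrakk> \<Longrightarrow> tensor_lift U b (simple_tensor V W v w) = b v w"
  by (simp add: simple_tensor_def tensor_lift_rep tensor_lift_Nil tensor_lift_Cons
      U.vadd_vzero_right bilinear_on_closed[OF b])

lemma linear_on_tensor_lift: "linear_on (tensor V W) U (tensor_lift U b)"
proof (rule linear_onI)
  have bc: "\<And>v w. \<lbrakk>v \<in> carr V; w \<in> carr W\<rbrakk> \<Longrightarrow> b v w \<in> carr U"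
    using b by (rule bilinear_on_closed)
  fix s t c assume "s \<in> carr (tensor V W)"
  note s = tensor_carr_rep[OF this]
  show "tensor_lift U b s \<in> carr U"
    by (rule tensor_lift_closed[OF U b s(1)])
  have m: "set (map (\<lambda>(v, w). (vscl V c v, w)) s) \<subseteq> carr V \<times> carr W"
    using s(1) by (auto simp: V.vs_simps)
  have l: "\<And>w. w \<in> carr W \<Longrightarrow> linear_on V U (\<lambda>v. b v w)"
    using b by (auto simp: bilinear_on_def)
  have "tensor_lift U b (map (\<lambda>(v, w). (vscl V c v, w)) xs) = vscl U c (tensor_lift U b xs)"
    if "set xs \<subseteq> carr V \<times> carr W" for xs
    using that
    by (induction xs)
      (auto simp: tensor_lift_Nil tensor_lift_Cons U.vs_simps bc tensor_lift_closed[OF U b]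
        linear_on_vscl[OF l])
  with s m show "tensor_lift U b (vscl (tensor V W) c s) = vscl U c (tensor_lift U b s)"
    by (simp add: tensor_vscl tensor_lift_rep)
  assume "t \<in> carr (tensor V W)"
  note t = tensor_carr_rep[OF this]
  show "tensor_lift U b (vadd (tensor V W) s t) = vadd U (tensor_lift U b s) (tensor_lift U b t)"
    using s t by (simp add: tensor_vadd tensor_lift_rep tensor_lift_append[OF U b])
qed

end

end

text \<open>
  For a fixed formal sum the lift is a finite sum of values of the map being lifted, and so depends
  linearly on a parameter of that map. Nested lifts are bilinear for this reason.
\<close>

lemma linear_on_tensor_lift_param:
  assumes "carrier_vector_space U"
    and "\<And>v w. \<lbrakk>v \<in> carr V; w \<in> carr W\<rbrakk> \<Longrightarrow> linear_on Z U (\<lambda>z. h z v w)"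
    and "set xs \<subseteq> carr V \<times> carr W"
  shows "linear_on Z U (\<lambda>z. tensor_lift U (h z) xs)"
  using assms(3)
proof (induction xs)
  case Nil
  then show ?case by (simp add: tensor_lift_Nil linear_on_const_vzero assms(1))
next
  case (Cons p xs)
  then show ?case by (cases p) (simp add: tensor_lift_Cons linear_on_plus assms(1,2))
qed

section \<open>Tensor products of modules as vector spaces\<close>

lemma bilinear_onI:
  assumes "\<And>v. v \<in> carr V \<Longrightarrow> linear_on W U (\<lambda>w. b v w)"
    and "\<And>w. w \<in> carr W \<Longrightarrow> linear_on V U (\<lambda>v. b v w)"
  shows "bilinear_on V W U b"
  using assms by (simp add: bilinear_on_def)

lemma bilinear_onD:
  assumes "bilinear_on V W U b"
  shows "v \<in> carr V \<Longrightarrow> linear_on W U (\<lambda>w. b v w)" "w \<in> carr W \<Longrightarrow> linear_on V U (\<lambda>v. b v w)"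
  using assms by (simp_all add: bilinear_on_def)

lemma carr_mtensor_space: "carr (mtensor_space V W) = Tensor ` carr (tensor V W)"
  by (simp add: mtensor_space_def)

lemma linear_on_Tensor: "linear_on (tensor V W) (mtensor_space V W) Tensor"
  and linear_on_untensor: "linear_on (mtensor_space V W) (tensor V W) untensor"
  if "carrier_vector_space V" "carrier_vector_space W"
proof -
  interpret T: carrier_vector_space "tensor V W"
    using that by (rule tensor_carrier_vector_space)
  show "linear_on (tensor V W) (mtensor_space V W) Tensor"
    and "linear_on (mtensor_space V W) (tensor V W) untensor"
    by (auto simp: linear_on_def mtensor_space_def T.vs_simps)
qed

lemma mtensor_carrier_vector_space:
  assumes "carrier_vector_space V" "carrier_vector_space W"
  shows "carrier_vector_space (mtensor_space V W)"
proof -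
  interpret T: carrier_vector_space "tensor V W"
    using assms by (rule tensor_carrier_vector_space)
  show ?thesis
    by unfold_locales
      (auto simp: mtensor_space_def T.vadd_closed T.vadd_assoc T.vzero_closed T.vadd_vzero
        T.vadd_inverse T.vscl_closed T.vscl_vadd T.vscl_add T.vscl_mult T.vscl_one
        intro: T.vadd_commute)
qed

lemma bilinear_on_mtens:
  assumes "carrier_vector_space V" "carrier_vector_space W"
  shows "bilinear_on V W (mtensor_space V W) (mtens V W)"
  unfolding mtens_def
  by (intro bilinear_onI linear_on_comp[OF linear_on_Tensor] bilinear_onD[OF bilinear_on_simple_tensor] assms)

lemma generates_mtens:
  assumes "carrier_vector_space V" "carrier_vector_space W" "generates S V" "generates T W"
  shows "generates {mtens V W s t | s t. s \<in> S \<and> t \<in> T} (mtensor_space V W)"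
  unfolding generates_def
proof (intro conjI allI impI)
  note g = generates_simple_tensor[OF assms]
  let ?G = "{simple_tensor V W s t | s t. s \<in> S \<and> t \<in> T}"
  have G: "{mtens V W s t | s t. s \<in> S \<and> t \<in> T} = Tensor ` ?G"
    by (auto simp: mtens_def)
  show "{mtens V W s t | s t. s \<in> S \<and> t \<in> T} \<subseteq> carr (mtensor_space V W)"
    unfolding G carr_mtensor_space using g by (auto simp: generates_def)
  fix E
  assume *: "vzero (mtensor_space V W) \<in> E"
    "\<forall>u\<in>carr (mtensor_space V W) \<inter> E. \<forall>v\<in>carr (mtensor_space V W) \<inter> E.
       vadd (mtensor_space V W) u v \<in> E"
    "{mtens V W s t | s t. s \<in> S \<and> t \<in> T} \<subseteq> E"
  have "t \<in> Tensor -` E" if "t \<in> carr (tensor V W)" for t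
  proof (rule generatesD[OF g _ _ _ that])
    show "vzero (tensor V W) \<in> Tensor -` E" using *(1) by (simp add: mtensor_space_def)
    show "vadd (tensor V W) u v \<in> Tensor -` E"
      if "u \<in> carr (tensor V W)" "v \<in> carr (tensor V W)" "u \<in> Tensor -` E" "v \<in> Tensor -` E" for u v
      using *(2)[rule_format, of "Tensor u" "Tensor v"] that by (simp add: mtensor_space_def)
    show "?G \<subseteq> Tensor -` E" using *(3) unfolding G by blast
  qed
  then show "carr (mtensor_space V W) \<subseteq> E" by (auto simp: carr_mtensor_space)
qed

context
  fixes V W :: "('k::field, 'a, ('k, 'b) elt) amod" and U :: "('k, 'u, 'e) vspace_scheme" and b
  assumes V: "carrier_vector_space V" and W: "carrier_vector_space W"
    and U: "carrier_vector_space U" and b: "bilinear_on V W U b"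
begin

lemma mlift_mtens: "\<lbrakk>v \<in> carr V; w \<in> carr W\<rbrakk> \<Longrightarrow> mlift U b (mtens V W v w) = b v w"
  by (simp add: mlift_def mtens_def tensor_lift_simple_tensor[OF V W U b])

lemma linear_on_mlift: "linear_on (mtensor_space V W) U (mlift U b)"
  unfolding mlift_def
  by (rule linear_on_comp[OF linear_on_tensor_lift[OF V W U b] linear_on_untensor[OF V W]])

end

lemma linear_on_mlift_param:
  assumes "carrier_vector_space V" "carrier_vector_space W" "carrier_vector_space U"
    and "\<And>v w. \<lbrakk>v \<in> carr V; w \<in> carr W\<rbrakk> \<Longrightarrow> linear_on Z U (\<lambda>z. h z v w)"
    and "t \<in> carr (mtensor_space V W)"
  shows "linear_on Z U (\<lambda>z. mlift U (h z) t)"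
  unfolding mlift_def
  using assms(3,4)
proof (rule linear_on_tensor_lift_param)
  show "set (untensor t) \<subseteq> carr V \<times> carr W"
    using assms(5) tensor_carr_rep(1)[OF assms(1,2)] unfolding carr_mtensor_space by force
qed


section \<open>Actions of tensor products of algebras\<close>

text \<open>
  If \<open>P\<close> acts on \<open>V\<close> by \<open>p\<close> and \<open>Q\<close> acts on \<open>W\<close> by \<open>q\<close>, then \<open>P \<otimes> Q\<close> acts on \<open>V \<otimes> W\<close>. With \<open>P = Q = A\<close> this is \<open>act2\<close>;
  with \<open>P = A\<close> and \<open>Q = A \<otimes> A\<close> it is the action of the triple tensor product of \<open>A\<close> that governs the
  associator and the hexagons.
\<close>

definition tensor_act ::
    "('x \<Rightarrow> ('k, 'b) elt \<Rightarrow> ('k, 'b) elt) \<Rightarrow> ('y \<Rightarrow> ('k, 'b) elt \<Rightarrow> ('k, 'b) elt)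
     \<Rightarrow> ('k::field, 'a, ('k, 'b) elt) amod \<Rightarrow> ('k, 'a, ('k, 'b) elt) amod
     \<Rightarrow> ('x \<times> 'y) list \<Rightarrow> ('k, 'b) elt \<Rightarrow> ('k, 'b) elt" where
  "tensor_act p q V W X t =
     tensor_lift (mtensor_space V W)
       (\<lambda>x y. mlift (mtensor_space V W) (\<lambda>v w. mtens V W (p x v) (q y w)) t) X"

text \<open>
  The factorwise product on \<open>P \<otimes> Q\<close>, of which \<open>mult2\<close> and \<open>mult3\<close> are instances.
\<close>

definition tensor_mult ::
    "('x \<Rightarrow> 'x \<Rightarrow> 'x) \<Rightarrow> ('y \<Rightarrow> 'y \<Rightarrow> 'y)
     \<Rightarrow> ('k::field, 'x, 'e) vspace_scheme \<Rightarrow> ('k, 'y, 'f) vspace_scheme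
     \<Rightarrow> ('x \<times> 'y) list \<Rightarrow> ('x \<times> 'y) list \<Rightarrow> ('x \<times> 'y) list" where
  "tensor_mult m n P Q s t =
     tensor_lift (tensor P Q)
       (\<lambda>x y. tensor_lift (tensor P Q) (\<lambda>x' y'. simple_tensor P Q (m x x') (n y y')) t) s"

context
  fixes P :: "('k::field, 'x, 'e) vspace_scheme" and Q :: "('k, 'y, 'f) vspace_scheme"
    and m n
  assumes P: "carrier_vector_space P" and Q: "carrier_vector_space Q"
    and m: "bilinear_on P P P m" and n: "bilinear_on Q Q Q n"
begin

lemma bilinear_tensor_mult_aux:
  assumes "x \<in> carr P" "y \<in> carr Q"
  shows "bilinear_on P Q (tensor P Q) (\<lambda>x' y'. simple_tensor P Q (m x x') (n y y'))"
  using assms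
  by (intro bilinear_onI linear_on_comp[OF bilinear_onD(1)[OF bilinear_on_simple_tensor[OF P Q]]]
      linear_on_comp[OF bilinear_onD(2)[OF bilinear_on_simple_tensor[OF P Q]]]
      bilinear_onD[OF m] bilinear_onD[OF n] bilinear_on_closed[OF m] bilinear_on_closed[OF n])

lemma bilinear_tensor_mult_aux2:
  assumes "t \<in> carr (tensor P Q)"
  shows "bilinear_on P Q (tensor P Q)
     (\<lambda>x y. tensor_lift (tensor P Q) (\<lambda>x' y'. simple_tensor P Q (m x x') (n y y')) t)"
  using assms
  by (intro bilinear_onI linear_on_tensor_lift_param[where V = P and W = Q]
      linear_on_comp[OF bilinear_onD(1)[OF bilinear_on_simple_tensor[OF P Q]]]
      linear_on_comp[OF bilinear_onD(2)[OF bilinear_on_simple_tensor[OF P Q]]]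
      bilinear_onD[OF m] bilinear_onD[OF n] bilinear_on_closed[OF m] bilinear_on_closed[OF n]
      tensor_carrier_vector_space P Q tensor_carr_rep(1)[OF P Q])

lemma bilinear_on_tensor_mult:
  "bilinear_on (tensor P Q) (tensor P Q) (tensor P Q) (tensor_mult m n P Q)"
  unfolding tensor_mult_def
  by (intro bilinear_onI linear_on_tensor_lift_param[where V = P and W = Q]
      linear_on_tensor_lift[where V = P and W = Q]
      bilinear_tensor_mult_aux bilinear_tensor_mult_aux2
      tensor_carrier_vector_space P Q tensor_carr_rep(1)[OF P Q])

lemma tensor_mult_simple_tensor:
  assumes "x \<in> carr P" "x' \<in> carr P" "y \<in> carr Q" "y' \<in> carr Q"
  shows "tensor_mult m n P Q (simple_tensor P Q x y) (simple_tensor P Q x' y') =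
     simple_tensor P Q (m x x') (n y y')"
  using assms
  by (simp add: tensor_mult_def simple_tensor_closed P Q tensor_carrier_vector_space
      tensor_lift_simple_tensor[OF P Q _ bilinear_tensor_mult_aux2]
      tensor_lift_simple_tensor[OF P Q _ bilinear_tensor_mult_aux])

end

context
  fixes P :: "('k::field, 'x, 'e) vspace_scheme" and Q :: "('k, 'y, 'f) vspace_scheme"
    and V W :: "('k, 'a, ('k, 'b) elt) amod" and p q
  assumes P: "carrier_vector_space P" and Q: "carrier_vector_space Q"
    and V: "carrier_vector_space V" and W: "carrier_vector_space W"
    and p: "bilinear_on P V V p" and q: "bilinear_on Q W W q"
begin

lemma bilinear_tensor_act_aux:
  assumes "x \<in> carr P" "y \<in> carr Q"
  shows "bilinear_on V W (mtensor_space V W) (\<lambda>v w. mtens V W (p x v) (q y w))"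
  using assms
  by (intro bilinear_onI linear_on_comp[OF bilinear_onD(1)[OF bilinear_on_mtens[OF V W]]]
      linear_on_comp[OF bilinear_onD(2)[OF bilinear_on_mtens[OF V W]]]
      bilinear_onD[OF p] bilinear_onD[OF q] bilinear_on_closed[OF p] bilinear_on_closed[OF q])

lemma bilinear_tensor_act_aux2:
  assumes "t \<in> carr (mtensor_space V W)"
  shows "bilinear_on P Q (mtensor_space V W)
     (\<lambda>x y. mlift (mtensor_space V W) (\<lambda>v w. mtens V W (p x v) (q y w)) t)"
  using assms
  by (intro bilinear_onI linear_on_mlift_param[OF V W]
      linear_on_comp[OF bilinear_onD(1)[OF bilinear_on_mtens[OF V W]]]
      linear_on_comp[OF bilinear_onD(2)[OF bilinear_on_mtens[OF V W]]]
      bilinear_onD[OF p] bilinear_onD[OF q] bilinear_on_closed[OF p] bilinear_on_closed[OF q]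
      mtensor_carrier_vector_space V W)

lemma bilinear_on_tensor_act:
  "bilinear_on (tensor P Q) (mtensor_space V W) (mtensor_space V W) (tensor_act p q V W)"
  unfolding tensor_act_def
  by (intro bilinear_onI linear_on_tensor_lift_param[where V = P and W = Q]
      linear_on_tensor_lift[where V = P and W = Q] linear_on_mlift[OF V W]
      bilinear_tensor_act_aux bilinear_tensor_act_aux2
      mtensor_carrier_vector_space P Q V W tensor_carr_rep(1)[OF P Q])

lemma tensor_act_simple_tensor:
  assumes "x \<in> carr P" "y \<in> carr Q" "v \<in> carr V" "w \<in> carr W"
  shows "tensor_act p q V W (simple_tensor P Q x y) (mtens V W v w) = mtens V W (p x v) (q y w)"
  using assms
  by (simp add: tensor_act_def P Q V W mtensor_carrier_vector_space
      bilinear_on_closed[OF bilinear_on_mtens]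
      tensor_lift_simple_tensor[OF P Q _ bilinear_tensor_act_aux2]
      mlift_mtens[OF V W _ bilinear_tensor_act_aux])

text \<open>
  Both sides are linear in \<open>X\<close>, in \<open>Y\<close> and in \<open>t\<close>, so the three arguments are replaced by pure tensors one
  after the other.
\<close>

lemma tensor_act_mult:
  assumes m: "bilinear_on P P P m" and n: "bilinear_on Q Q Q n"
    and pm: "\<And>x x' v. \<lbrakk>x \<in> carr P; x' \<in> carr P; v \<in> carr V\<rbrakk> \<Longrightarrow> p (m x x') v = p x (p x' v)"
    and qn: "\<And>y y' w. \<lbrakk>y \<in> carr Q; y' \<in> carr Q; w \<in> carr W\<rbrakk> \<Longrightarrow> q (n y y') w = q y (q y' w)"
    and X: "X \<in> carr (tensor P Q)" and Y: "Y \<in> carr (tensor P Q)"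
    and t: "t \<in> carr (mtensor_space V W)"
  shows "tensor_act p q V W (tensor_mult m n P Q X Y) t =
     tensor_act p q V W X (tensor_act p q V W Y t)"
proof -
  note mu = bilinear_on_tensor_mult[OF P Q m n] and ac = bilinear_on_tensor_act
  note cl = bilinear_on_closed[OF ac] bilinear_on_closed[OF mu]
  note sp = tensor_carrier_vector_space[OF P Q] mtensor_carrier_vector_space[OF V W]
  note gT = generates_simple_tensor[OF P Q generates_carr generates_carr]
    and gM = generates_mtens[OF V W generates_carr generates_carr]
  note si = simple_tensor_closed[OF P Q] bilinear_on_closed[OF bilinear_on_mtens[OF V W]]
  have 1: "tensor_act p q V W (tensor_mult m n P Q (simple_tensor P Q x y) (simple_tensor P Q x' y')) u =
      tensor_act p q V W (simple_tensor P Q x y) (tensor_act p q V W (simple_tensor P Q x' y') u)"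
    if "x \<in> carr P" "y \<in> carr Q" "x' \<in> carr P" "y' \<in> carr Q" "u \<in> carr (mtensor_space V W)"
    for x y x' y' u
    by (rule linear_on_eqI[OF sp(2) sp(2) gM bilinear_onD(1)[OF ac]
          linear_on_comp[OF bilinear_onD(1)[OF ac] bilinear_onD(1)[OF ac]] _ that(5)])
      (use that in \<open>auto simp: si cl tensor_mult_simple_tensor[OF P Q m n] tensor_act_simple_tensor
        pm qn bilinear_on_closed[OF m] bilinear_on_closed[OF n] bilinear_on_closed[OF p]
        bilinear_on_closed[OF q]\<close>)
  have 2: "tensor_act p q V W (tensor_mult m n P Q (simple_tensor P Q x y) Y) t =
      tensor_act p q V W (simple_tensor P Q x y) (tensor_act p q V W Y t)"
    if "x \<in> carr P" "y \<in> carr Q" for x y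
    by (rule linear_on_eqI[OF sp gT linear_on_comp[OF bilinear_onD(2)[OF ac] bilinear_onD(1)[OF mu]]
          linear_on_comp[OF bilinear_onD(1)[OF ac] bilinear_onD(2)[OF ac]] _ Y])
      (use that t in \<open>auto simp: si 1\<close>)
  show ?thesis
    by (rule linear_on_eqI[OF sp gT linear_on_comp[OF bilinear_onD(2)[OF ac] bilinear_onD(2)[OF mu]]
          bilinear_onD(2)[OF ac] _ X])
      (use t Y in \<open>auto simp: cl 2\<close>)
qed

end

section \<open>Modules over a bialgebra\<close>

lemma afun_mk_arrow [simp]:
  "adom (mk_arrow V W f) = V" "acod (mk_arrow V W f) = W"
  "v \<in> carr V \<Longrightarrow> afun (mk_arrow V W f) v = f v"
  by (simp_all add: mk_arrow_def)

lemma linear_on_mk_arrow: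
  assumes "carrier_vector_space V" "linear_on V U f"
  shows "linear_on V U (afun (mk_arrow V W f))"
  using assms
  by (auto simp: linear_on_def carrier_vector_space.vadd_closed carrier_vector_space.vscl_closed)

text \<open>
  As vector spaces \<open>mtensor \<Delta> V W\<close> and \<open>mtensor_space V W\<close> agree; the simplifier uses the latter as the
  normal form, so that the facts about tensor products of vector spaces apply to modules.
\<close>

lemma mtensor_simps [simp]:
  "carr (mtensor \<Delta> V W) = carr (mtensor_space V W)"
  "vadd (mtensor \<Delta> V W) = vadd (mtensor_space V W)"
  "vzero (mtensor \<Delta> V W) = vzero (mtensor_space V W)"
  "vscl (mtensor \<Delta> V W) = vscl (mtensor_space V W)"
  "act (mtensor \<Delta> V W) = (\<lambda>x. act2 V W (\<Delta> x))"
  by (simp_all add: mtensor_def)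

lemma mtensor_linear_simps [simp]:
  "linear_on (mtensor \<Delta> V W) U f = linear_on (mtensor_space V W) U f"
  "linear_on U' (mtensor \<Delta> V W) g = linear_on U' (mtensor_space V W) g"
  "generates S (mtensor \<Delta> V W) = generates S (mtensor_space V W)"
  by (simp_all add: linear_on_def generates_def)

lemma mtensor_vs_simp [simp]:
  "carrier_vector_space (mtensor \<Delta> V W) = carrier_vector_space (mtensor_space V W)"
  by (simp add: carrier_vector_space_def)

lemma dsum_simps [simp]:
  "vadd (dsum V W) (Couple v w) (Couple v' w') = Couple (vadd V v v') (vadd W w w')"
  "vzero (dsum V W) = Couple (vzero V) (vzero W)"
  "vscl (dsum V W) c (Couple v w) = Couple (vscl V c v) (vscl W c w)"
  "act (dsum V W) x (Couple v w) = Couple (act V x v) (act W x w)"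
  "Couple v w \<in> carr (dsum V W) \<longleftrightarrow> v \<in> carr V \<and> w \<in> carr W"
  by (simp_all add: dsum_def)

lemma dsum_carrE:
  assumes "p \<in> carr (dsum V W)"
  obtains v w where "p = Couple v w" "v \<in> carr V" "w \<in> carr W"
  using assms by (auto simp: dsum_def)

lemma dsum_lft_rgt [simp]:
  assumes "p \<in> carr (dsum V W)"
  shows "lft p \<in> carr V" "rgt p \<in> carr W"
  using assms by (auto elim: dsum_carrE)

lemma zero_mod_simps [simp]:
  "carr zero_mod = {Star}" "vadd zero_mod u v = Star" "vzero zero_mod = Star"
  "vscl zero_mod c v = Star" "act zero_mod x v = Star"
  by (simp_all add: zero_mod_def)

lemma unit_mod_simps [simp]:
  "carr (unit_mod \<epsilon>) = range Scalar" "vadd (unit_mod \<epsilon>) (Scalar c) (Scalar d) = Scalar (c + d)"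
  "vzero (unit_mod \<epsilon>) = Scalar 0" "vscl (unit_mod \<epsilon>) c (Scalar d) = Scalar (c * d)"
  "act (unit_mod \<epsilon>) x (Scalar d) = Scalar (\<epsilon> x * d)"
  by (simp_all add: unit_mod_def)

lemma dsum_vs [simp]:
  assumes "carrier_vector_space V" "carrier_vector_space W"
  shows "carrier_vector_space (dsum V W)"
proof -
  interpret V: carrier_vector_space V by fact
  interpret W: carrier_vector_space W by fact
  show ?thesis
  proof
    fix v assume "v \<in> carr (dsum V W)"
    then obtain a b where v: "v = Couple a b" "a \<in> carr V" "b \<in> carr W" by (rule dsum_carrE)
    obtain a' b' where "a' \<in> carr V" "vadd V a a' = vzero V" "b' \<in> carr W" "vadd W b b' = vzero W"
      using V.vadd_inverse W.vadd_inverse v by blast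
    then show "\<exists>w\<in>carr (dsum V W). vadd (dsum V W) v w = vzero (dsum V W)"
      using v by (intro bexI[of _ "Couple a' b'"]) auto
  qed (auto elim!: dsum_carrE simp: V.vs_simps W.vs_simps V.vadd_assoc W.vadd_assoc
      intro: V.vadd_commute W.vadd_commute)
qed

lemma zero_mod_vs [simp]: "carrier_vector_space zero_mod"
  by unfold_locales simp_all

lemma unit_mod_vs [simp]: "carrier_vector_space (unit_mod \<epsilon>)"
proof
  show "\<exists>w\<in>carr (unit_mod \<epsilon>). vadd (unit_mod \<epsilon>) v w = vzero (unit_mod \<epsilon>)"
    if "v \<in> carr (unit_mod \<epsilon>)" for v
    using that by (auto intro!: exI[of _ "- unscalar v"])
qed (auto simp: algebra_simps)

lemma linear_Couple [simp]:
  "\<lbrakk>linear_on Z V f; linear_on Z W g\<rbrakk> \<Longrightarrow> linear_on Z (dsum V W) (\<lambda>z. Couple (f z) (g z))"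
  by (auto simp: linear_on_def Pi_iff)

lemma linear_lft: "linear_on V X (\<lambda>v. v) \<Longrightarrow> linear_on (dsum V W) X lft"
  and linear_rgt: "linear_on W X (\<lambda>w. w) \<Longrightarrow> linear_on (dsum V W) X rgt"
  by (auto simp: linear_on_def elim!: dsum_carrE)

lemma linear_Star [simp]: "linear_on Z zero_mod (\<lambda>z. Star)"
  by (simp add: linear_on_def)

lemma linear_unscalar:
  "linear_on (unit_mod \<epsilon>) \<lparr>carr = UNIV, vadd = (+), vzero = 0, vscl = (*)\<rparr> unscalar"
  by (auto simp: linear_on_def)

declare linear_on_id [simp] mtensor_carrier_vector_space [simp]

text \<open>
  Linearity facts are stated for composites \<open>\<lambda>z. F (f z)\<close>. Used as conditional rewrite rules they let the
  simplifier prove linearity of nested expressions in whichever variable is abstracted.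
\<close>

context
  fixes V W :: "('k::field, 'a, ('k, 'b) elt) amod"
  assumes V: "carrier_vector_space V" and W: "carrier_vector_space W"
begin

lemma mtens_closed: "\<lbrakk>v \<in> carr V; w \<in> carr W\<rbrakk> \<Longrightarrow> mtens V W v w \<in> carr (mtensor_space V W)"
  using bilinear_on_mtens[OF V W] by (rule bilinear_on_closed)

lemma linear_mtens_left:
  "\<lbrakk>linear_on Z V f; w \<in> carr W\<rbrakk> \<Longrightarrow> linear_on Z (mtensor_space V W) (\<lambda>z. mtens V W (f z) w)"
  using bilinear_onD(2)[OF bilinear_on_mtens[OF V W]] by (rule linear_on_comp)

lemma linear_mtens_right:
  "\<lbrakk>linear_on Z W f; v \<in> carr V\<rbrakk> \<Longrightarrow> linear_on Z (mtensor_space V W) (\<lambda>z. mtens V W v (f z))"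
  using bilinear_onD(1)[OF bilinear_on_mtens[OF V W]] by (rule linear_on_comp)

lemma mtensor_eqI:
  assumes "carrier_vector_space U" "linear_on (mtensor_space V W) U f"
    "linear_on (mtensor_space V W) U g" "t \<in> carr (mtensor_space V W)"
    "\<And>v w. \<lbrakk>v \<in> carr V; w \<in> carr W\<rbrakk> \<Longrightarrow> f (mtens V W v w) = g (mtens V W v w)"
  shows "f t = g t"
  by (rule linear_on_eqI[OF mtensor_carrier_vector_space[OF V W] assms(1)
        generates_mtens[OF V W generates_carr generates_carr] assms(2,3) _ assms(4)])
    (auto simp: assms(5))

end

declare mtens_closed [simp] linear_mtens_left [simp] linear_mtens_right [simp]

context bialgebra
begin

abbreviation "A \<equiv> alg_space scale"
abbreviation "A2 \<equiv> alg2 scale"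
abbreviation "A3 \<equiv> alg3 scale"

lemma A_simps [simp]: "carr A = UNIV" "vadd A = (+)" "vzero A = 0" "vscl A = scale"
  by (simp_all add: alg_space_def)

lemma A_vs [simp]: "carrier_vector_space A"
proof
  show "\<exists>w\<in>carr A. vadd A v w = vzero A" for v by (auto intro: exI[of _ "- v"])
qed (simp_all add: algebra_simps scale_left_distrib scale_right_distrib)

lemma A2_vs [simp]: "carrier_vector_space A2"
  by (simp add: alg2_def tensor_carrier_vector_space)

lemma A3_vs [simp]: "carrier_vector_space A3"
  by (simp add: alg3_def tensor_carrier_vector_space)

lemma bilinear_on_times: "bilinear_on A A A (*)"
  by (auto simp: bilinear_on_def linear_on_def algebra_simps scale_mult_left scale_mult_right)

lemma bilinear_on_ten2: "bilinear_on A A A2 (ten2 scale)"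
  using bilinear_on_simple_tensor[OF A_vs A_vs] by (simp add: alg2_def ten2_def)

lemma mult2_eq: "mult2 scale = tensor_mult (*) (*) A A"
  by (intro ext) (simp add: mult2_def tensor_mult_def alg2_def ten2_def)

lemma mult3_eq: "mult3 scale = tensor_mult (*) (mult2 scale) A A2"
  by (intro ext) (simp add: mult3_def tensor_mult_def alg3_def)

lemma bilinear_on_mult2: "bilinear_on A2 A2 A2 (mult2 scale)"
  unfolding mult2_eq alg2_def
  by (intro bilinear_on_tensor_mult bilinear_on_times A_vs)

lemma ten2_closed [simp]: "ten2 scale x y \<in> carr A2"
  by (rule bilinear_on_closed[OF bilinear_on_ten2]) auto

lemma ten3_closed [simp]: "ten3 scale x y z \<in> carr A3"
  by (simp add: ten3_def alg3_def simple_tensor_closed)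

lemma linear_ten2 [simp]:
  "linear_on Z A f \<Longrightarrow> linear_on Z A2 (\<lambda>z. ten2 scale (f z) y)"
  "linear_on Z A f \<Longrightarrow> linear_on Z A2 (\<lambda>z. ten2 scale x (f z))"
  by (auto intro: linear_on_comp[OF bilinear_onD(2)[OF bilinear_on_ten2]]
      linear_on_comp[OF bilinear_onD(1)[OF bilinear_on_ten2]])

lemma linear_ten3 [simp]:
  "linear_on Z A f \<Longrightarrow> linear_on Z A3 (\<lambda>z. ten3 scale (f z) x y)"
  "linear_on Z A f \<Longrightarrow> linear_on Z A3 (\<lambda>z. ten3 scale x (f z) y)"
  "linear_on Z A f \<Longrightarrow> linear_on Z A3 (\<lambda>z. ten3 scale x y (f z))"
  unfolding ten3_def alg3_def
  by (rule linear_on_comp[OF bilinear_onD(2)[OF bilinear_on_simple_tensor[OF A_vs A2_vs]]]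
      linear_on_comp[OF bilinear_onD(1)[OF bilinear_on_simple_tensor[OF A_vs A2_vs]]]; simp)+

text \<open>
  A law about \<open>\<Delta> x\<close> or \<open>R\<close> is often an instance of a law about every element of \<open>A \<otimes> A\<close>, linear in that
  element. Such a law needs to be verified only for pure tensors \<open>x \<otimes> y\<close>.
\<close>

lemma A2_eqI:
  assumes "carrier_vector_space U" "linear_on A2 U f" "linear_on A2 U g" "X \<in> carr A2"
    "\<And>x y. f (ten2 scale x y) = g (ten2 scale x y)"
  shows "f X = g X"
  by (rule linear_on_eqI[OF A2_vs assms(1) _ assms(2,3) _ assms(4)],
      unfold alg2_def, rule generates_simple_tensor[OF A_vs A_vs generates_carr generates_carr])
    (auto simp: assms(5) ten2_def[symmetric])

context
  fixes U :: "('k, 'u, 'e) vspace_scheme" and b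
  assumes U: "carrier_vector_space U"
    and b: "\<And>x. linear_on A U (\<lambda>y. b x y)" "\<And>y. linear_on A U (\<lambda>x. b x y)"
begin

lemma lift_ten2: "tensor_lift U b (ten2 scale x y) = b x y"
  unfolding ten2_def by (rule tensor_lift_simple_tensor) (auto intro: bilinear_onI b U)

lemma linear_lift2: "linear_on Z A2 f \<Longrightarrow> linear_on Z U (\<lambda>z. tensor_lift U b (f z))"
  unfolding alg2_def
  by (rule linear_on_comp[OF linear_on_tensor_lift]) (auto intro: bilinear_onI b U)

end

lemma linear_lift2_param:
  assumes "carrier_vector_space U" "\<And>x y. linear_on Z U (\<lambda>z. h z x y)" "X \<in> carr A2"
  shows "linear_on Z U (\<lambda>z. tensor_lift U (h z) X)"
  using assms
  by (intro linear_on_tensor_lift_param[where V = A and W = A]) auto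

lemma linear_\<Delta>: "linear_on A A2 \<Delta>"
  by (simp add: linear_on_def \<Delta>_closed \<Delta>_add \<Delta>_scale)

lemma linear_\<Delta>_comp [simp]: "linear_on Z A f \<Longrightarrow> linear_on Z A2 (\<lambda>z. \<Delta> (f z))"
  by (rule linear_on_comp[OF linear_\<Delta>])

declare \<Delta>_closed [simp]

subsection \<open>The action of the tensor square\<close>

lemma left_module_vs [simp]: "left_module scale V \<Longrightarrow> carrier_vector_space V"
  by (simp add: left_module_def)

lemma bilinear_on_act:
  assumes "left_module scale V"
  shows "bilinear_on A V V (act V)"
proof -
  interpret V: left_module scale V by fact
  have "act V x (vscl V c v) = vscl V c (act V x v)" if "v \<in> carr V" for x c v
  proof -
    have "vscl V c v = act V (scale c 1) v" using that by (simp add: V.act_scale V.act_one)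
    then have "act V x (vscl V c v) = act V (x * scale c 1) v"
      using that by (simp add: V.act_mult)
    then show ?thesis using that by (simp add: scale_mult_right V.act_scale)
  qed
  then show ?thesis
    by (simp add: bilinear_on_def linear_on_def V.act_closed V.act_vadd V.act_add V.act_scale)
qed

lemma act_closed [simp]: "\<lbrakk>left_module scale V; v \<in> carr V\<rbrakk> \<Longrightarrow> act V x v \<in> carr V"
  by (rule left_module.act_closed)

lemma linear_act_left [simp]:
  "\<lbrakk>left_module scale V; linear_on Z A f; v \<in> carr V\<rbrakk> \<Longrightarrow> linear_on Z V (\<lambda>z. act V (f z) v)"
  by (rule linear_on_comp[OF bilinear_onD(2)[OF bilinear_on_act]])

lemma linear_act_right [simp]:
  "\<lbrakk>left_module scale V; linear_on Z V f\<rbrakk> \<Longrightarrow> linear_on Z V (\<lambda>z. act V x (f z))"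
  by (rule linear_on_comp[OF bilinear_onD(1)[OF bilinear_on_act]]) simp_all

lemma act2_eq: "act2 V W = tensor_act (act V) (act W) V W"
  by (intro ext) (simp add: act2_def tensor_act_def)

context
  fixes V W :: "('k, 'a, ('k, 'b) elt) amod"
  assumes V: "left_module scale V" and W: "left_module scale W"
begin

lemma bilinear_on_act2: "bilinear_on A2 (mtensor_space V W) (mtensor_space V W) (act2 V W)"
  unfolding act2_eq alg2_def
  by (intro bilinear_on_tensor_act bilinear_on_act A_vs left_module_vs V W)

lemma act2_closed:
  "\<lbrakk>X \<in> carr A2; t \<in> carr (mtensor_space V W)\<rbrakk> \<Longrightarrow> act2 V W X t \<in> carr (mtensor_space V W)"
  by (rule bilinear_on_closed[OF bilinear_on_act2])

lemma linear_act2_left: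
  "\<lbrakk>linear_on Z A2 f; t \<in> carr (mtensor_space V W)\<rbrakk>
    \<Longrightarrow> linear_on Z (mtensor_space V W) (\<lambda>z. act2 V W (f z) t)"
  by (rule linear_on_comp[OF bilinear_onD(2)[OF bilinear_on_act2]])

lemma linear_act2_right:
  "\<lbrakk>X \<in> carr A2; linear_on Z (mtensor_space V W) f\<rbrakk>
    \<Longrightarrow> linear_on Z (mtensor_space V W) (\<lambda>z. act2 V W X (f z))"
  by (rule linear_on_comp[OF bilinear_onD(1)[OF bilinear_on_act2]])

lemma act2_ten2:
  "\<lbrakk>v \<in> carr V; w \<in> carr W\<rbrakk>
    \<Longrightarrow> act2 V W (ten2 scale x y) (mtens V W v w) = mtens V W (act V x v) (act W y w)"
  unfolding act2_eq ten2_def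
  by (rule tensor_act_simple_tensor) (auto intro: bilinear_on_act V W simp: V W)

lemma act2_mult2:
  "\<lbrakk>X \<in> carr A2; Y \<in> carr A2; t \<in> carr (mtensor_space V W)\<rbrakk>
    \<Longrightarrow> act2 V W (mult2 scale X Y) t = act2 V W X (act2 V W Y t)"
  unfolding act2_eq mult2_eq alg2_def
  by (rule tensor_act_mult)
    (auto intro: bilinear_on_act bilinear_on_times V W simp: V W left_module.act_mult[OF V]
      left_module.act_mult[OF W])

lemma act2_one:
  assumes "t \<in> carr (mtensor_space V W)"
  shows "act2 V W (ten2 scale 1 1) t = t"
  by (rule mtensor_eqI[OF _ _ _ _ _ assms, where U = "mtensor_space V W"])
    (simp_all add: V W linear_act2_right act2_ten2 left_module.act_one[OF V]
      left_module.act_one[OF W])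

end

declare act2_closed [simp] linear_act2_left [simp] linear_act2_right [simp] act2_ten2 [simp]

text \<open>
  The action of \<open>A \<otimes> A\<close> on \<open>V \<otimes> W\<close> is an action of an algebra. Pulling it back along \<open>\<Delta>\<close> gives a module
  because \<open>\<Delta>\<close> is a homomorphism of algebras; the counit does the same for the unit module.
\<close>

lemma left_module_mtensor [simp]:
  assumes V: "left_module scale V" and W: "left_module scale W"
  shows "left_module scale (mtensor \<Delta> V W)"
proof (intro left_module.intro left_module_axioms.intro)
  note b = bilinear_on_act2[OF V W]
  fix s t x y c assume t: "t \<in> carr (mtensor \<Delta> V W)"
  show "act (mtensor \<Delta> V W) (x + y) t = vadd (mtensor \<Delta> V W) (act (mtensor \<Delta> V W) x t) (act (mtensor \<Delta> V W) y t)"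
    using t linear_on_vadd[OF bilinear_onD(2)[OF b]] by (simp add: \<Delta>_add)
  show "act (mtensor \<Delta> V W) (scale c x) t = vscl (mtensor \<Delta> V W) c (act (mtensor \<Delta> V W) x t)"
    using t linear_on_vscl[OF bilinear_onD(2)[OF b]] by (simp add: \<Delta>_scale)
  show "act (mtensor \<Delta> V W) (x * y) t = act (mtensor \<Delta> V W) x (act (mtensor \<Delta> V W) y t)"
    using t V W by (simp add: \<Delta>_mult act2_mult2)
  show "act (mtensor \<Delta> V W) 1 t = t"
    using t V W by (simp add: \<Delta>_one act2_one)
  show "act (mtensor \<Delta> V W) x t \<in> carr (mtensor \<Delta> V W)" using t V W by simp
  assume s: "s \<in> carr (mtensor \<Delta> V W)"
  show "act (mtensor \<Delta> V W) x (vadd (mtensor \<Delta> V W) t s) =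
      vadd (mtensor \<Delta> V W) (act (mtensor \<Delta> V W) x t) (act (mtensor \<Delta> V W) x s)"
    using s t linear_on_vadd[OF bilinear_onD(1)[OF b]] by simp
qed (simp add: V W)

lemma left_module_dsum [simp]:
  assumes V: "left_module scale V" and W: "left_module scale W"
  shows "left_module scale (dsum V W)"
  by (intro left_module.intro left_module_axioms.intro)
    (auto elim!: dsum_carrE simp: V W left_module.act_vadd[OF V] left_module.act_vadd[OF W]
      left_module.act_add[OF V] left_module.act_add[OF W] left_module.act_mult[OF V]
      left_module.act_mult[OF W] left_module.act_one[OF V] left_module.act_one[OF W]
      left_module.act_scale[OF V] left_module.act_scale[OF W])

lemma left_module_zero_mod [simp]: "left_module scale zero_mod"
  by (intro left_module.intro left_module_axioms.intro) simp_all

lemma left_module_unit_mod [simp]: "left_module scale (unit_mod \<epsilon>)"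
  by (intro left_module.intro left_module_axioms.intro)
    (auto simp: distrib_left distrib_right mult.assoc \<epsilon>_add \<epsilon>_mult \<epsilon>_one \<epsilon>_scale)

end

section \<open>Arrows of the category of modules\<close>

declare linear_on_plus [simp] linear_on_scale [simp] linear_lft [simp] linear_rgt [simp]

context bialgebra
begin

abbreviation M :: "(('k, 'a, ('k, 'b) elt) amod, ('k, 'a, ('k, 'b) elt) arrow) category" where
  "M \<equiv> Mod TYPE('b) scale"

lemma M_simps [simp]:
  "V \<in> Ob M \<longleftrightarrow> left_module scale V" "Dom M = adom" "Cod M = acod"
  "f \<in> hom M V W \<longleftrightarrow> f \<in> Arr M \<and> adom f = V \<and> acod f = W"
  by (simp_all add: Mod_def hom_def)

lemma module_hom_iff:
  "module_hom V W f \<longleftrightarrow> linear_on V W f \<and> (\<forall>x. \<forall>v\<in>carr V. f (act V x v) = act W x (f v))"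
  by (auto simp: module_hom_def linear_on_def)

lemma Arr_iff:
  "f \<in> Arr M \<longleftrightarrow> left_module scale (adom f) \<and> left_module scale (acod f) \<and>
     linear_on (adom f) (acod f) (afun f) \<and>
     (\<forall>x. \<forall>v\<in>carr (adom f). afun f (act (adom f) x v) = act (acod f) x (afun f v)) \<and>
     afun f \<in> extensional (carr (adom f))"
  by (simp add: Mod_def module_hom_iff conj_assoc)

lemma Comp_M: "Comp M g f = mk_arrow (adom f) (acod g) (\<lambda>v. afun g (afun f v))"
  and Idt_M: "Idt M V = mk_arrow V V (\<lambda>v. v)"
  by (simp_all add: Mod_def)

lemma ArrD [simp]:
  assumes "f \<in> Arr M"
  shows "left_module scale (adom f)" "left_module scale (acod f)"
    and "linear_on (adom f) (acod f) (afun f)"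
    and "v \<in> carr (adom f) \<Longrightarrow> afun f (act (adom f) x v) = act (acod f) x (afun f v)"
  using assms by (simp_all add: Arr_iff)

lemma linear_afun [simp]:
  assumes "f \<in> Arr M" "linear_on Z (adom f) h" "linear_on (acod f) U (\<lambda>v. v)"
  shows "linear_on Z U (\<lambda>z. afun f (h z))"
  using assms(1) linear_on_comp[OF linear_on_comp[OF assms(3)] assms(2), of "afun f"]
  by simp

lemma afun_closed [simp]:
  "\<lbrakk>f \<in> Arr M; v \<in> carr (adom f); carr (acod f) = carr W\<rbrakk> \<Longrightarrow> afun f v \<in> carr W"
  using linear_on_closed[OF ArrD(3)] by blast

text \<open>
  Both sides of the equivariance condition are linear in the vector, so generators suffice.
\<close>

lemma Arr_mk_arrowI:
  assumes V: "left_module scale V" and W: "left_module scale W" and f: "linear_on V W f"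
    and S: "generates S V" and e: "\<And>x s. s \<in> S \<Longrightarrow> f (act V x s) = act W x (f s)"
  shows "mk_arrow V W f \<in> Arr M"
proof -
  have "f (act V x v) = act W x (f v)" if "v \<in> carr V" for x v
    by (rule linear_on_eqI[OF left_module_vs[OF V] left_module_vs[OF W] S _ _ e that])
      (auto intro!: linear_act_right V W f linear_on_id intro: linear_on_comp[OF f])
  then show ?thesis
    unfolding Arr_iff using V W f by (simp add: linear_on_mk_arrow) (simp add: mk_arrow_def)
qed

lemma arrow_eqI:
  assumes "f \<in> Arr M" "g \<in> Arr M" "adom g = adom f" "acod g = acod f"
    and "generates S (adom f)" "\<And>s. s \<in> S \<Longrightarrow> afun f s = afun g s"
  shows "f = g"
proof -
  note g = ArrD[OF assms(2), unfolded assms(3,4)]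
  have "afun f v = afun g v" if "v \<in> carr (adom f)" for v
    using left_module_vs[OF ArrD(1)[OF assms(1)]] left_module_vs[OF ArrD(2)[OF assms(1)]] assms(5)
      ArrD(3)[OF assms(1)] g(3) assms(6) that
    by (rule linear_on_eqI)
  then have "afun f = afun g"
    using assms(1-3) unfolding Arr_iff by (metis extensionalityI)
  then show ?thesis using assms by simp
qed

lemma arrow_eqI_carr:
  assumes "f \<in> Arr M" "g \<in> Arr M" "adom g = adom f" "acod g = acod f"
    and "\<And>v. v \<in> carr (adom f) \<Longrightarrow> afun f v = afun g v"
  shows "f = g"
  using arrow_eqI[OF assms(1-4) generates_carr assms(5)] .

lemma arrow_eqI_zero:
  assumes "f \<in> Arr M" "g \<in> Arr M" "adom g = adom f" "acod g = acod f" "acod f = zero_mod"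
  shows "f = g"
proof (rule arrow_eqI_carr[OF assms(1-4)])
  fix v assume v: "v \<in> carr (adom f)"
  show "afun f v = afun g v"
    using linear_on_closed[OF ArrD(3)[OF assms(1)] v]
      linear_on_closed[OF ArrD(3)[OF assms(2)], unfolded assms(3,4), OF v]
    by (simp add: assms(5))
qed

lemma Comp_simps [simp]:
  "adom (Comp M g f) = adom f" "acod (Comp M g f) = acod g"
  "v \<in> carr (adom f) \<Longrightarrow> afun (Comp M g f) v = afun g (afun f v)"
  by (simp_all add: Comp_M)

lemma Comp_Arr [simp]:
  assumes "f \<in> Arr M" "g \<in> Arr M" "acod f = adom g"
  shows "Comp M g f \<in> Arr M"
proof -
  have "mk_arrow (adom f) (acod g) (\<lambda>v. afun g (afun f v)) \<in> Arr M"
    by (rule Arr_mk_arrowI[OF _ _ _ generates_carr]) (use assms in auto)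
  then show ?thesis by (simp add: Comp_M)
qed

lemma Idt_simps [simp]:
  "adom (Idt M V) = V" "acod (Idt M V) = V" "v \<in> carr V \<Longrightarrow> afun (Idt M V) v = v"
  by (simp_all add: Idt_M)

lemma Idt_Arr [simp]:
  assumes "left_module scale V"
  shows "Idt M V \<in> Arr M"
proof -
  have "mk_arrow V V (\<lambda>v. v) \<in> Arr M"
    by (rule Arr_mk_arrowI[OF _ _ _ generates_carr]) (use assms in auto)
  then show ?thesis by (simp add: Idt_M)
qed

lemma category_M: "category M"
  by unfold_locales (auto intro: arrow_eqI_carr)

text \<open>
  The inverse of a bijective module homomorphism is again one, so a linear inverse is enough, and
  that it is inverse can be tested on generators.
\<close>

lemma iso_arrI:
  assumes f: "f \<in> Arr M" and g: "linear_on (acod f) (adom f) g"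
    and S: "generates S (adom f)" "\<And>s. s \<in> S \<Longrightarrow> g (afun f s) = s"
    and T: "generates T (acod f)" "\<And>t. t \<in> T \<Longrightarrow> afun f (g t) = t"
  shows "iso_arr M f"
proof -
  have gf: "g (afun f v) = v" if "v \<in> carr (adom f)" for v
    by (rule linear_on_eqI[OF _ _ S(1) linear_on_comp[OF g] linear_on_id S(2) that])
      (use f in simp_all)
  have fg: "afun f (g v) = v" if "v \<in> carr (acod f)" for v
    by (rule linear_on_eqI[OF _ _ T(1) linear_on_comp[OF _ g] linear_on_id T(2) that])
      (use f in simp_all)
  let ?g = "mk_arrow (acod f) (adom f) g"
  have "g (act (acod f) x v) = act (adom f) x (g v)" if v: "v \<in> carr (acod f)" for x v
  proof -
    have gv: "g v \<in> carr (adom f)" using g v by (rule linear_on_closed)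
    have "g (act (acod f) x v) = g (act (acod f) x (afun f (g v)))" using v by (simp add: fg)
    also have "\<dots> = g (afun f (act (adom f) x (g v)))" using f gv by simp
    also have "\<dots> = act (adom f) x (g v)" using f gv by (intro gf) simp
    finally show ?thesis .
  qed
  then have gA: "?g \<in> Arr M"
    by (intro Arr_mk_arrowI[OF _ _ g generates_carr]) (use f in auto)
  have "Comp M ?g f = Idt M (adom f)" "Comp M f ?g = Idt M (acod f)"
    using f gA by (auto intro!: arrow_eqI_carr simp: gf fg)
  then show ?thesis
    using f gA unfolding iso_arr_def inverse_arrows_def by auto
qed

lemma inv_arr_simps:
  assumes "iso_arr M f"
  shows "inv_arr M f \<in> Arr M" "adom (inv_arr M f) = acod f" "acod (inv_arr M f) = adom f"
    and "v \<in> carr (adom f) \<Longrightarrow> afun (inv_arr M f) (afun f v) = v"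
proof -
  interpret category M by (rule category_M)
  obtain g where g: "inverse_arrows M f g" using assms by (auto simp: iso_arr_def)
  have "g' = g" if "inverse_arrows M f g'" for g'
  proof -
    have "g' = Comp M (Comp M g' f) g"
      using that g Comp_assoc[of g "acod f" "adom f" f "acod f" g' "adom f"] Comp_Idt[of g']
      by (simp add: inverse_arrows_def)
    then show ?thesis using that g Idt_Comp[of g] by (simp add: inverse_arrows_def)
  qed
  then have "inverse_arrows M f (inv_arr M f)"
    unfolding inv_arr_def using g by (rule theI[where a = g, rotated])
  then have i: "inv_arr M f \<in> Arr M" "adom (inv_arr M f) = acod f" "acod (inv_arr M f) = adom f"
    "Comp M (inv_arr M f) f = Idt M (adom f)"
    by (auto simp: inverse_arrows_def)
  then show "inv_arr M f \<in> Arr M" "adom (inv_arr M f) = acod f" "acod (inv_arr M f) = adom f"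
    by auto
  show "afun (inv_arr M f) (afun f v) = v" if "v \<in> carr (adom f)"
    using that arg_cong[OF i(4), of "\<lambda>h. afun h v"] by simp
qed

lemma iso_arr_mono:
  assumes "iso_arr M f"
  shows "mono_arr M f"
  unfolding mono_arr_def
proof (intro conjI allI ballI impI)
  show f: "f \<in> Arr M" using assms by (auto simp: iso_arr_def inverse_arrows_def)
  fix X g h assume g: "g \<in> hom M X (Dom M f)" and h: "h \<in> hom M X (Dom M f)"
    and eq: "Comp M f g = Comp M f h"
  show "g = h"
  proof (rule arrow_eqI_carr)
    fix v assume v: "v \<in> carr (adom g)"
    have "afun (inv_arr M f) (afun (Comp M f g) v) = afun g v"
      "afun (inv_arr M f) (afun (Comp M f h) v) = afun h v"
      using v g h f inv_arr_simps(4)[OF assms] by auto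
    then show "afun g v = afun h v" using eq by simp
  qed (use g h in auto)
qed


subsection \<open>Direct sums\<close>

lemma dsum_arr_simps [simp]:
  "adom (dsum_arr f g) = dsum (adom f) (adom g)" "acod (dsum_arr f g) = dsum (acod f) (acod g)"
  "\<lbrakk>v \<in> carr (adom f); w \<in> carr (adom g)\<rbrakk>
    \<Longrightarrow> afun (dsum_arr f g) (Couple v w) = Couple (afun f v) (afun g w)"
  by (simp_all add: dsum_arr_def)

lemma dsum_arr_Arr [simp]:
  "\<lbrakk>f \<in> Arr M; g \<in> Arr M\<rbrakk> \<Longrightarrow> dsum_arr f g \<in> Arr M"
  unfolding dsum_arr_def
  by (rule Arr_mk_arrowI[OF _ _ _ generates_carr])
    (auto intro!: linear_Couple linear_lft linear_rgt elim!: dsum_carrE)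

lemma dsum_struct_simps [simp]:
  "adom (dsum_assoc U V W) = dsum (dsum U V) W" "acod (dsum_assoc U V W) = dsum U (dsum V W)"
  "\<lbrakk>u \<in> carr U; v \<in> carr V; w \<in> carr W\<rbrakk>
    \<Longrightarrow> afun (dsum_assoc U V W) (Couple (Couple u v) w) = Couple u (Couple v w)"
  "adom (dsum_lunit V) = dsum zero_mod V" "acod (dsum_lunit V) = V"
  "v \<in> carr V \<Longrightarrow> afun (dsum_lunit V) (Couple Star v) = v"
  "adom (dsum_runit V) = dsum V zero_mod" "acod (dsum_runit V) = V"
  "v \<in> carr V \<Longrightarrow> afun (dsum_runit V) (Couple v Star) = v"
  "adom (dsum_sym V W) = dsum V W" "acod (dsum_sym V W) = dsum W V"
  "\<lbrakk>v \<in> carr V; w \<in> carr W\<rbrakk> \<Longrightarrow> afun (dsum_sym V W) (Couple v w) = Couple w v"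
  by (simp_all add: dsum_assoc_def dsum_lunit_def dsum_runit_def dsum_sym_def)

lemma dsum_struct_Arr [simp]:
  "\<lbrakk>left_module scale U; left_module scale V; left_module scale W\<rbrakk> \<Longrightarrow> dsum_assoc U V W \<in> Arr M"
  "left_module scale V \<Longrightarrow> dsum_lunit V \<in> Arr M"
  "left_module scale V \<Longrightarrow> dsum_runit V \<in> Arr M"
  "\<lbrakk>left_module scale V; left_module scale W\<rbrakk> \<Longrightarrow> dsum_sym V W \<in> Arr M"
  unfolding dsum_assoc_def dsum_lunit_def dsum_runit_def dsum_sym_def
  by (rule Arr_mk_arrowI[OF _ _ _ generates_carr];
      auto simp: linear_on_def elim!: dsum_carrE)+

lemma dsum_struct_iso [simp]:
  "\<lbrakk>left_module scale U; left_module scale V; left_module scale W\<rbrakk> \<Longrightarrow> iso_arr M (dsum_assoc U V W)"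
  "left_module scale V \<Longrightarrow> iso_arr M (dsum_lunit V)"
  "left_module scale V \<Longrightarrow> iso_arr M (dsum_runit V)"
  "\<lbrakk>left_module scale V; left_module scale W\<rbrakk> \<Longrightarrow> iso_arr M (dsum_sym V W)"
proof -
  assume V: "left_module scale V"
  show "iso_arr M (dsum_lunit V)"
    by (rule iso_arrI[OF _ _ generates_carr _ generates_carr, where g = "\<lambda>v. Couple Star v"])
      (use V in \<open>auto elim!: dsum_carrE\<close>)
  show "iso_arr M (dsum_runit V)"
    by (rule iso_arrI[OF _ _ generates_carr _ generates_carr, where g = "\<lambda>v. Couple v Star"])
      (use V in \<open>auto elim!: dsum_carrE\<close>)
  assume W: "left_module scale W"
  show "iso_arr M (dsum_sym V W)"
    by (rule iso_arrI[OF _ _ generates_carr _ generates_carr, where g = "\<lambda>p. Couple (rgt p) (lft p)"])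
      (use V W in \<open>auto intro!: linear_Couple linear_lft linear_rgt elim!: dsum_carrE\<close>)
  assume U: "left_module scale U"
  show "iso_arr M (dsum_assoc U V W)"
    by (rule iso_arrI[OF _ _ generates_carr _ generates_carr,
          where g = "\<lambda>p. Couple (Couple (lft p) (lft (rgt p))) (rgt (rgt p))"])
      (use U V W in \<open>auto simp: linear_on_def elim!: dsum_carrE\<close>)
qed

lemma inv_dsum_assoc [simp]:
  assumes "left_module scale U" "left_module scale V" "left_module scale W"
  shows "inv_arr M (dsum_assoc U V W) \<in> Arr M"
    "adom (inv_arr M (dsum_assoc U V W)) = dsum U (dsum V W)"
    "acod (inv_arr M (dsum_assoc U V W)) = dsum (dsum U V) W"
    "\<lbrakk>u \<in> carr U; v \<in> carr V; w \<in> carr W\<rbrakk>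
      \<Longrightarrow> afun (inv_arr M (dsum_assoc U V W)) (Couple u (Couple v w)) = Couple (Couple u v) w"
  using inv_arr_simps(1-3)[OF dsum_struct_iso(1)[OF assms]]
    inv_arr_simps(4)[OF dsum_struct_iso(1)[OF assms], of "Couple (Couple u v) w"]
  by simp_all

lemma symmetric_monoidal_dsum:
  "symmetric_monoidal_category M dsum dsum_arr zero_mod dsum_assoc dsum_lunit dsum_runit dsum_sym"
proof (intro symmetric_monoidal_category.intro braided_monoidal_category.intro
    monoidal_category.intro category_M monoidal_category_axioms.intro
    braided_monoidal_category_axioms.intro symmetric_monoidal_category_axioms.intro)
qed (auto intro!: arrow_eqI_carr elim!: dsum_carrE)

end

section \<open>Tensor products of modules\<close>

lemma generates_mtens2 [simp]:
  assumes "carrier_vector_space V" "carrier_vector_space W"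
  shows "generates {mtens V W v w | v w. v \<in> carr V \<and> w \<in> carr W} (mtensor_space V W)"
  using generates_mtens[OF assms generates_carr generates_carr] .

lemma generates_dsum:
  assumes V: "carrier_vector_space V" and W: "carrier_vector_space W"
    and S: "generates S V" and T: "generates T W"
  shows "generates ((\<lambda>s. Couple s (vzero W)) ` S \<union> Couple (vzero V) ` T) (dsum V W)"
proof -
  interpret V: carrier_vector_space V by fact
  interpret W: carrier_vector_space W by fact
  show ?thesis
    unfolding generates_def
  proof (intro conjI allI impI subsetI)
    show "p \<in> carr (dsum V W)" if "p \<in> (\<lambda>s. Couple s (vzero W)) ` S \<union> Couple (vzero V) ` T" for p
      using that S T by (auto simp: generates_def V.vs_simps W.vs_simps)
    fix E p
    assume 0: "vzero (dsum V W) \<in> E"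
      and add: "\<forall>u\<in>carr (dsum V W) \<inter> E. \<forall>v\<in>carr (dsum V W) \<inter> E. vadd (dsum V W) u v \<in> E"
      and gen: "(\<lambda>s. Couple s (vzero W)) ` S \<union> Couple (vzero V) ` T \<subseteq> E"
      and p: "p \<in> carr (dsum V W)"
    obtain v w where vw: "p = Couple v w" "v \<in> carr V" "w \<in> carr W" using p by (rule dsum_carrE)
    have add': "Couple (vadd V a a') (vadd W b b') \<in> E"
      if "Couple a b \<in> E" "Couple a' b' \<in> E" "a \<in> carr V" "a' \<in> carr V" "b \<in> carr W" "b' \<in> carr W"
      for a b a' b'
      using add[rule_format, of "Couple a b" "Couple a' b'"] that by simp
    have "v \<in> {v. Couple v (vzero W) \<in> E}"
      by (rule generatesD[OF S _ _ _ vw(2)])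
        (use 0 gen add'[of _ "vzero W" _ "vzero W"] in \<open>auto simp: W.vs_simps\<close>)
    moreover have "w \<in> {w. Couple (vzero V) w \<in> E}"
      by (rule generatesD[OF T _ _ _ vw(3)])
        (use 0 gen add'[of "vzero V" _ "vzero V"] in \<open>auto simp: V.vs_simps\<close>)
    ultimately show "p \<in> E"
      using add'[of v "vzero W" "vzero V" w] vw by (simp add: V.vs_simps W.vs_simps)
  qed
qed

text \<open>
  The universal property in the form in which the structure arrows are defined: lifting a bilinear
  map gives a linear map with prescribed values on pure tensors.
\<close>

lemma mk_lift_simps:
  assumes "carrier_vector_space V" "carrier_vector_space W" "carrier_vector_space U"
    and "\<And>v. v \<in> carr V \<Longrightarrow> linear_on W U (\<lambda>w. b v w)"
    and "\<And>w. w \<in> carr W \<Longrightarrow> linear_on V U (\<lambda>v. b v w)"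
  shows "linear_on (mtensor_space V W) U (afun (mk_arrow (mtensor \<Delta> V W) X (mlift U b)))"
    and "\<lbrakk>v \<in> carr V; w \<in> carr W\<rbrakk>
      \<Longrightarrow> afun (mk_arrow (mtensor \<Delta> V W) X (mlift U b)) (mtens V W v w) = b v w"
proof -
  have b: "bilinear_on V W U b" using assms(4,5) by (rule bilinear_onI)
  show "linear_on (mtensor_space V W) U (afun (mk_arrow (mtensor \<Delta> V W) X (mlift U b)))"
    using linear_on_mk_arrow[of "mtensor \<Delta> V W" U "mlift U b" X] linear_on_mlift[OF assms(1-3) b]
      assms(1,2)
    by simp
  show "afun (mk_arrow (mtensor \<Delta> V W) X (mlift U b)) (mtens V W v w) = b v w"
    if "v \<in> carr V" "w \<in> carr W"
    using that assms(1-3) by (simp add: mlift_mtens b)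
qed

lemma mtens_vzero:
  assumes "carrier_vector_space V" "carrier_vector_space W"
  shows "v \<in> carr V \<Longrightarrow> mtens V W v (vzero W) = vzero (mtensor_space V W)"
    and "w \<in> carr W \<Longrightarrow> mtens V W (vzero V) w = vzero (mtensor_space V W)"
  using linear_on_vzero[OF assms(2) mtensor_carrier_vector_space[OF assms]
      bilinear_onD(1)[OF bilinear_on_mtens[OF assms]]]
    linear_on_vzero[OF assms(1) mtensor_carrier_vector_space[OF assms]
      bilinear_onD(2)[OF bilinear_on_mtens[OF assms]]]
  by auto

context bialgebra
begin

lemma mk_mtensor_ArrI:
  assumes V: "left_module scale V" and W: "left_module scale W" and U: "left_module scale U"
    and f: "linear_on (mtensor_space V W) U (afun (mk_arrow (mtensor \<Delta> V W) U f))"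
    and e: "\<And>x v w. \<lbrakk>v \<in> carr V; w \<in> carr W\<rbrakk> \<Longrightarrow>
      afun (mk_arrow (mtensor \<Delta> V W) U f) (act2 V W (\<Delta> x) (mtens V W v w)) =
      act U x (afun (mk_arrow (mtensor \<Delta> V W) U f) (mtens V W v w))"
  shows "mk_arrow (mtensor \<Delta> V W) U f \<in> Arr M"
proof (rule Arr_mk_arrowI)
  show "linear_on (mtensor \<Delta> V W) U f"
    using f V W linear_on_closed[OF f] linear_on_vadd[OF f] linear_on_vscl[OF f]
    by (intro linear_onI)
      (auto simp: carrier_vector_space.vadd_closed carrier_vector_space.vscl_closed)
  show "generates {mtens V W v w | v w. v \<in> carr V \<and> w \<in> carr W} (mtensor \<Delta> V W)"
    using V W by simp
  show "f (act (mtensor \<Delta> V W) x s) = act U x (f s)"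
    if "s \<in> {mtens V W v w | v w. v \<in> carr V \<and> w \<in> carr W}" for x s
    using that V W U e by auto
qed (use V W U in simp_all)


lemma arrow_eqI2:
  assumes "adom f = mtensor \<Delta> V W" "f \<in> Arr M" "g \<in> Arr M" "adom g = adom f" "acod g = acod f"
    and "left_module scale V" "left_module scale W"
    and "\<And>v w. \<lbrakk>v \<in> carr V; w \<in> carr W\<rbrakk> \<Longrightarrow> afun f (mtens V W v w) = afun g (mtens V W v w)"
  shows "f = g"
  by (rule arrow_eqI[OF assms(2-5), where S = "{mtens V W v w | v w. v \<in> carr V \<and> w \<in> carr W}"])
    (use assms in auto)

lemma iso_arrI2:
  assumes "adom f = mtensor \<Delta> V W" "f \<in> Arr M" "linear_on (acod f) (mtensor_space V W) g"
    and "left_module scale V" "left_module scale W"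
    and "\<And>v w. \<lbrakk>v \<in> carr V; w \<in> carr W\<rbrakk> \<Longrightarrow> g (afun f (mtens V W v w)) = mtens V W v w"
    and "generates T (acod f)" "\<And>t. t \<in> T \<Longrightarrow> afun f (g t) = t"
  shows "iso_arr M f"
  by (rule iso_arrI[OF assms(2) _ _ _ assms(7,8),
        where S = "{mtens V W v w | v w. v \<in> carr V \<and> w \<in> carr W}"])
    (use assms in auto)

lemma arrow_eqI3:
  assumes "adom f = mtensor \<Delta> (mtensor \<Delta> U V) W" "f \<in> Arr M" "g \<in> Arr M"
    "adom g = adom f" "acod g = acod f"
    and "left_module scale U" "left_module scale V" "left_module scale W"
    and "\<And>u v w. \<lbrakk>u \<in> carr U; v \<in> carr V; w \<in> carr W\<rbrakk>
      \<Longrightarrow> afun f (mtens (mtensor \<Delta> U V) W (mtens U V u v) w) =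
          afun g (mtens (mtensor \<Delta> U V) W (mtens U V u v) w)"
  shows "f = g"
proof (rule arrow_eqI[OF assms(2-5)])
  show "generates {mtens (mtensor \<Delta> U V) W t w | t w. t \<in> {mtens U V u v | u v. u \<in> carr U \<and> v \<in> carr V} \<and> w \<in> carr W} (adom f)"
    unfolding assms(1)
    by (intro mtensor_linear_simps(3)[THEN iffD2] generates_mtens generates_carr;
        simp add: assms(6-8))
qed (use assms(9) in auto)

lemma arrow_eqI3':
  assumes "adom f = mtensor \<Delta> U (mtensor \<Delta> V W)" "f \<in> Arr M" "g \<in> Arr M"
    "adom g = adom f" "acod g = acod f"
    and "left_module scale U" "left_module scale V" "left_module scale W"
    and "\<And>u v w. \<lbrakk>u \<in> carr U; v \<in> carr V; w \<in> carr W\<rbrakk>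
      \<Longrightarrow> afun f (mtens U (mtensor \<Delta> V W) u (mtens V W v w)) =
          afun g (mtens U (mtensor \<Delta> V W) u (mtens V W v w))"
  shows "f = g"
proof (rule arrow_eqI[OF assms(2-5)])
  show "generates {mtens U (mtensor \<Delta> V W) u t | u t. u \<in> carr U \<and> t \<in> {mtens V W v w | v w. v \<in> carr V \<and> w \<in> carr W}} (adom f)"
    unfolding assms(1)
    by (intro mtensor_linear_simps(3)[THEN iffD2] generates_mtens generates_carr;
        simp add: assms(6-8))
qed (use assms(9) in auto)

lemma arrow_eqI4:
  assumes "adom f = mtensor \<Delta> (mtensor \<Delta> (mtensor \<Delta> U V) W) X" "f \<in> Arr M" "g \<in> Arr M"
    "adom g = adom f" "acod g = acod f"
    and "left_module scale U" "left_module scale V" "left_module scale W" "left_module scale X"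
    and "\<And>u v w x. \<lbrakk>u \<in> carr U; v \<in> carr V; w \<in> carr W; x \<in> carr X\<rbrakk>
      \<Longrightarrow> afun f (mtens (mtensor \<Delta> (mtensor \<Delta> U V) W) X (mtens (mtensor \<Delta> U V) W (mtens U V u v) w) x) =
          afun g (mtens (mtensor \<Delta> (mtensor \<Delta> U V) W) X (mtens (mtensor \<Delta> U V) W (mtens U V u v) w) x)"
  shows "f = g"
proof (rule arrow_eqI[OF assms(2-5)])
  show "generates {mtens (mtensor \<Delta> (mtensor \<Delta> U V) W) X s x | s x. s \<in>
      {mtens (mtensor \<Delta> U V) W t w | t w. t \<in> {mtens U V u v | u v. u \<in> carr U \<and> v \<in> carr V} \<and> w \<in> carr W} \<and> x \<in> carr X} (adom f)"
    unfolding assms(1)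
    by (intro mtensor_linear_simps(3)[THEN iffD2] generates_mtens generates_carr;
        simp add: assms(6-9))
qed (use assms(10) in auto)


subsection \<open>The tensor product of arrows\<close>

lemma mtensor_arr_simps [simp]:
  "adom (mtensor_arr \<Delta> f g) = mtensor \<Delta> (adom f) (adom g)"
  "acod (mtensor_arr \<Delta> f g) = mtensor \<Delta> (acod f) (acod g)"
  by (simp_all add: mtensor_arr_def)

lemma mtensor_arr_mtens [simp]:
  "\<lbrakk>f \<in> Arr M; g \<in> Arr M; adom f = V; adom g = W; v \<in> carr V; w \<in> carr W\<rbrakk>
    \<Longrightarrow> afun (mtensor_arr \<Delta> f g) (mtens V W v w) = mtens (acod f) (acod g) (afun f v) (afun g w)"
  unfolding mtensor_arr_def by (auto intro!: mk_lift_simps(2))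

lemma linear_mtensor_arr:
  assumes "f \<in> Arr M" "g \<in> Arr M"
  shows "linear_on (mtensor_space (adom f) (adom g)) (mtensor_space (acod f) (acod g))
     (afun (mtensor_arr \<Delta> f g))"
  unfolding mtensor_arr_def using assms by (auto intro!: mk_lift_simps(1))

text \<open>
  A tensor product of homomorphisms commutes with all of \<open>A \<otimes> A\<close> and not only with the image of \<open>\<Delta>\<close>.
  For \<open>\<Delta> x\<close> this says that it is a homomorphism, for \<open>R\<close> it is half of the naturality of the braiding.
\<close>

lemma mtensor_arr_act2:
  assumes f: "f \<in> Arr M" and g: "g \<in> Arr M" and X: "X \<in> carr A2"
    and t: "t \<in> carr (mtensor_space (adom f) (adom g))"
  shows "afun (mtensor_arr \<Delta> f g) (act2 (adom f) (adom g) X t) =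
     act2 (acod f) (acod g) X (afun (mtensor_arr \<Delta> f g) t)"
proof -
  note l = linear_mtensor_arr[OF f g]
  have 1: "afun (mtensor_arr \<Delta> f g) (act2 (adom f) (adom g) (ten2 scale x y) t) =
     act2 (acod f) (acod g) (ten2 scale x y) (afun (mtensor_arr \<Delta> f g) t)" for x y
    by (rule mtensor_eqI[OF _ _ _ linear_on_comp[OF l] _ t])
      (use f g l in simp_all)
  show ?thesis
    by (rule A2_eqI[OF _ linear_on_comp[OF l] _ X])
      (use f g t linear_on_closed[OF l t] 1 in simp_all)
qed

lemma mtensor_arr_Arr [simp]:
  assumes f: "f \<in> Arr M" and g: "g \<in> Arr M"
  shows "mtensor_arr \<Delta> f g \<in> Arr M"
  unfolding mtensor_arr_def
  by (rule mk_mtensor_ArrI; (unfold mtensor_arr_def[symmetric])?)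
    (use f g linear_mtensor_arr[OF f g] mtensor_arr_act2[OF f g] in auto)


subsection \<open>The unit\<close>

lemma linear_counit: "linear_on A A (scale c)" "linear_on A A (\<lambda>y. scale (\<epsilon> y) z)"
  by (simp_all add: linear_on_def scale_right_distrib scale_left_distrib \<epsilon>_add \<epsilon>_scale mult.commute)

context
  fixes V :: "('k, 'a, ('k, 'b) elt) amod"
  assumes V: "left_module scale V"
begin

interpretation V: left_module scale V by (rule V)

lemma act_vscl: "v \<in> carr V \<Longrightarrow> act V x (vscl V c v) = vscl V c (act V x v)"
  using linear_on_vscl[OF bilinear_onD(1)[OF bilinear_on_act[OF V]]] by simp

lemma linear_scalar: "v \<in> carr V \<Longrightarrow> linear_on (unit_mod \<epsilon>) V (\<lambda>c. vscl V (unscalar c) v)"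
  by (rule linear_on_vscl_left[OF _ linear_unscalar]) (simp_all add: V)

lemma
  mtensor_lunit_simps [simp]:
    "adom (mtensor_lunit \<Delta> \<epsilon> V) = mtensor \<Delta> (unit_mod \<epsilon>) V" "acod (mtensor_lunit \<Delta> \<epsilon> V) = V"
    "v \<in> carr V \<Longrightarrow> afun (mtensor_lunit \<Delta> \<epsilon> V) (mtens (unit_mod \<epsilon>) V (Scalar c) v) = vscl V c v" and
  linear_mtensor_lunit: "linear_on (mtensor_space (unit_mod \<epsilon>) V) V (afun (mtensor_lunit \<Delta> \<epsilon> V))" and
  mtensor_runit_simps [simp]:
    "adom (mtensor_runit \<Delta> \<epsilon> V) = mtensor \<Delta> V (unit_mod \<epsilon>)" "acod (mtensor_runit \<Delta> \<epsilon> V) = V"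
    "v \<in> carr V \<Longrightarrow> afun (mtensor_runit \<Delta> \<epsilon> V) (mtens V (unit_mod \<epsilon>) v (Scalar c)) = vscl V c v" and
  linear_mtensor_runit: "linear_on (mtensor_space V (unit_mod \<epsilon>)) V (afun (mtensor_runit \<Delta> \<epsilon> V))"
  unfolding mtensor_lunit_def mtensor_runit_def
  by (simp_all add: V linear_scalar mk_lift_simps del: afun_mk_arrow(3))

lemma mtensor_lunit_Arr [simp]: "mtensor_lunit \<Delta> \<epsilon> V \<in> Arr M"
  unfolding mtensor_lunit_def
proof (rule mk_mtensor_ArrI; (unfold mtensor_lunit_def[symmetric])?)
  fix x v and c :: "('k, 'b) elt" assume c: "c \<in> carr (unit_mod \<epsilon>)" and v: "v \<in> carr V"
  \<comment> \<open>For \<open>X = \<Delta> x\<close> the lift on the right is \<open>x\<close>, by the left counit law.\<close>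
  have "afun (mtensor_lunit \<Delta> \<epsilon> V) (act2 (unit_mod \<epsilon>) V X (mtens (unit_mod \<epsilon>) V c v)) =
      vscl V (unscalar c) (act V (tensor_lift A (\<lambda>y z. scale (\<epsilon> y) z) X) v)" if "X \<in> carr A2" for X
  proof (rule A2_eqI[OF _ linear_on_comp[OF linear_mtensor_lunit] _ that])
    fix y z
    show "afun (mtensor_lunit \<Delta> \<epsilon> V) (act2 (unit_mod \<epsilon>) V (ten2 scale y z) (mtens (unit_mod \<epsilon>) V c v)) =
      vscl V (unscalar c) (act V (tensor_lift A (\<lambda>y z. scale (\<epsilon> y) z) (ten2 scale y z)) v)"
      using c v by (auto simp: V lift_ten2 linear_counit V.act_scale V.vscl_mult[symmetric] mult.commute)
  qed (use c v in \<open>auto simp: V linear_lift2 linear_counit\<close>)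
  from this[OF \<Delta>_closed]
  show "afun (mtensor_lunit \<Delta> \<epsilon> V) (act2 (unit_mod \<epsilon>) V (\<Delta> x) (mtens (unit_mod \<epsilon>) V c v)) =
      act V x (afun (mtensor_lunit \<Delta> \<epsilon> V) (mtens (unit_mod \<epsilon>) V c v))"
    using c v by (auto simp: V counit_left act_vscl)
qed (simp_all add: V linear_mtensor_lunit)

lemma mtensor_runit_Arr [simp]: "mtensor_runit \<Delta> \<epsilon> V \<in> Arr M"
  unfolding mtensor_runit_def
proof (rule mk_mtensor_ArrI; (unfold mtensor_runit_def[symmetric])?)
  fix x v and c :: "('k, 'b) elt" assume v: "v \<in> carr V" and c: "c \<in> carr (unit_mod \<epsilon>)"
  \<comment> \<open>For \<open>X = \<Delta> x\<close> the lift on the right is \<open>x\<close>, by the right counit law.\<close>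
  have "afun (mtensor_runit \<Delta> \<epsilon> V) (act2 V (unit_mod \<epsilon>) X (mtens V (unit_mod \<epsilon>) v c)) =
      vscl V (unscalar c) (act V (tensor_lift A (\<lambda>y z. scale (\<epsilon> z) y) X) v)" if "X \<in> carr A2" for X
  proof (rule A2_eqI[OF _ linear_on_comp[OF linear_mtensor_runit] _ that])
    fix y z
    show "afun (mtensor_runit \<Delta> \<epsilon> V) (act2 V (unit_mod \<epsilon>) (ten2 scale y z) (mtens V (unit_mod \<epsilon>) v c)) =
      vscl V (unscalar c) (act V (tensor_lift A (\<lambda>y z. scale (\<epsilon> z) y) (ten2 scale y z)) v)"
      using c v by (auto simp: V lift_ten2 linear_counit V.act_scale V.vscl_mult[symmetric] mult.commute)
  qed (use c v in \<open>auto simp: V linear_lift2 linear_counit\<close>)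
  from this[OF \<Delta>_closed]
  show "afun (mtensor_runit \<Delta> \<epsilon> V) (act2 V (unit_mod \<epsilon>) (\<Delta> x) (mtens V (unit_mod \<epsilon>) v c)) =
      act V x (afun (mtensor_runit \<Delta> \<epsilon> V) (mtens V (unit_mod \<epsilon>) v c))"
    using c v by (auto simp: V counit_right act_vscl)
qed (simp_all add: V linear_mtensor_runit)

lemma unit_balanced:
  assumes "v \<in> carr V"
  shows "mtens (unit_mod \<epsilon>) V (Scalar 1) (vscl V c v) = mtens (unit_mod \<epsilon>) V (Scalar c) v"
    and "mtens V (unit_mod \<epsilon>) (vscl V c v) (Scalar 1) = mtens V (unit_mod \<epsilon>) v (Scalar c)"
proof -
  have U: "(Scalar d :: ('k, 'b) elt) \<in> carr (unit_mod \<epsilon>)" for d by simp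
  note b = bilinear_on_mtens[OF unit_mod_vs left_module_vs[OF V]]
    bilinear_on_mtens[OF left_module_vs[OF V] unit_mod_vs]
  show "mtens (unit_mod \<epsilon>) V (Scalar 1) (vscl V c v) = mtens (unit_mod \<epsilon>) V (Scalar c) v"
    using linear_on_vscl[OF bilinear_onD(1)[OF b(1) U] assms, of 1 c]
      linear_on_vscl[OF bilinear_onD(2)[OF b(1) assms] U, of c 1] by simp
  show "mtens V (unit_mod \<epsilon>) (vscl V c v) (Scalar 1) = mtens V (unit_mod \<epsilon>) v (Scalar c)"
    using linear_on_vscl[OF bilinear_onD(2)[OF b(2) U] assms, of c 1]
      linear_on_vscl[OF bilinear_onD(1)[OF b(2) assms] U, of c 1] by simp
qed

lemma mtensor_unit_iso [simp]: "iso_arr M (mtensor_lunit \<Delta> \<epsilon> V)" "iso_arr M (mtensor_runit \<Delta> \<epsilon> V)"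
proof -
  show "iso_arr M (mtensor_lunit \<Delta> \<epsilon> V)"
    by (rule iso_arrI2[OF mtensor_lunit_simps(1) _ _ _ _ _ generates_carr,
          where g = "mtens (unit_mod \<epsilon>) V (Scalar 1)"])
      (auto simp: V V.vs_simps linear_mtens_right unit_balanced)
  show "iso_arr M (mtensor_runit \<Delta> \<epsilon> V)"
    by (rule iso_arrI2[OF mtensor_runit_simps(1) _ _ _ _ _ generates_carr,
          where g = "\<lambda>v. mtens V (unit_mod \<epsilon>) v (Scalar 1)"])
      (auto simp: V V.vs_simps linear_mtens_left unit_balanced)
qed

end


subsection \<open>Associativity\<close>

definition act3 ::
    "('k, 'a, ('k, 'b) elt) amod \<Rightarrow> ('k, 'a, ('k, 'b) elt) amod \<Rightarrow> ('k, 'a, ('k, 'b) elt) amod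
     \<Rightarrow> ('a \<times> ('a \<times> 'a) list) list \<Rightarrow> ('k, 'b) elt \<Rightarrow> ('k, 'b) elt" where
  "act3 U V W = tensor_act (act U) (act2 V W) U (mtensor \<Delta> V W)"

context
  fixes U V W :: "('k, 'a, ('k, 'b) elt) amod"
  assumes U: "left_module scale U" and V: "left_module scale V" and W: "left_module scale W"
begin

lemma bilinear_on_act2': "bilinear_on A2 (mtensor \<Delta> V W) (mtensor \<Delta> V W) (act2 V W)"
  using bilinear_on_act2[OF V W] by (simp add: bilinear_on_def)

lemma bilinear_on_act3:
  "bilinear_on A3 (mtensor_space U (mtensor \<Delta> V W)) (mtensor_space U (mtensor \<Delta> V W)) (act3 U V W)"
  unfolding act3_def alg3_def
  by (intro bilinear_on_tensor_act bilinear_on_act bilinear_on_act2') (simp_all add: U V W)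

lemma act3_ten3 [simp]:
  "\<lbrakk>u \<in> carr U; v \<in> carr V; w \<in> carr W\<rbrakk> \<Longrightarrow>
    act3 U V W (ten3 scale x y z) (mtens U (mtensor \<Delta> V W) u (mtens V W v w)) =
    mtens U (mtensor \<Delta> V W) (act U x u) (mtens V W (act V y v) (act W z w))"
  unfolding act3_def ten3_def
  by (subst tensor_act_simple_tensor[where P = A and Q = A2])
    (auto intro: bilinear_on_act bilinear_on_act2' simp: U V W)

lemma linear_act3 [simp]:
  "\<lbrakk>linear_on Z A3 f; t \<in> carr (mtensor_space U (mtensor \<Delta> V W))\<rbrakk>
    \<Longrightarrow> linear_on Z (mtensor_space U (mtensor \<Delta> V W)) (\<lambda>z. act3 U V W (f z) t)"
  by (rule linear_on_comp[OF bilinear_onD(2)[OF bilinear_on_act3]])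

lemma act3_mult3:
  "\<lbrakk>X \<in> carr A3; Y \<in> carr A3; t \<in> carr (mtensor_space U (mtensor \<Delta> V W))\<rbrakk>
    \<Longrightarrow> act3 U V W (mult3 scale X Y) t = act3 U V W X (act3 U V W Y t)"
  unfolding act3_def mult3_eq alg3_def
  by (rule tensor_act_mult)
    (auto intro: bilinear_on_act bilinear_on_times bilinear_on_mult2 bilinear_on_act2'
      simp: U V W left_module.act_mult[OF U] act2_mult2)

lemma mtensor_assoc_dom [simp]:
  "adom (mtensor_assoc \<Delta> U V W) = mtensor \<Delta> (mtensor \<Delta> U V) W"
  "acod (mtensor_assoc \<Delta> U V W) = mtensor \<Delta> U (mtensor \<Delta> V W)"
  by (simp_all add: mtensor_assoc_def Let_def)

lemma mtensor_assoc_bilinear: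
  shows "w \<in> carr W \<Longrightarrow> bilinear_on U V (mtensor \<Delta> U (mtensor \<Delta> V W))
      (\<lambda>u v. mtens U (mtensor \<Delta> V W) u (mtens V W v w))"
    and "t \<in> carr (mtensor \<Delta> U V) \<Longrightarrow> linear_on W (mtensor \<Delta> U (mtensor \<Delta> V W))
      (\<lambda>w. mlift (mtensor \<Delta> U (mtensor \<Delta> V W)) (\<lambda>u v. mtens U (mtensor \<Delta> V W) u (mtens V W v w)) t)"
    and "w \<in> carr W \<Longrightarrow> linear_on (mtensor \<Delta> U V) (mtensor \<Delta> U (mtensor \<Delta> V W))
      (\<lambda>t. mlift (mtensor \<Delta> U (mtensor \<Delta> V W)) (\<lambda>u v. mtens U (mtensor \<Delta> V W) u (mtens V W v w)) t)"
proof -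
  show b: "bilinear_on U V (mtensor \<Delta> U (mtensor \<Delta> V W))
      (\<lambda>u v. mtens U (mtensor \<Delta> V W) u (mtens V W v w))" if "w \<in> carr W" for w
    using that U V W by (auto intro: bilinear_onI)
  show "linear_on (mtensor \<Delta> U V) (mtensor \<Delta> U (mtensor \<Delta> V W))
      (\<lambda>t. mlift (mtensor \<Delta> U (mtensor \<Delta> V W)) (\<lambda>u v. mtens U (mtensor \<Delta> V W) u (mtens V W v w)) t)"
    if "w \<in> carr W"
    using linear_on_mlift[OF _ _ _ b[OF that]] U V W by simp
  show "linear_on W (mtensor \<Delta> U (mtensor \<Delta> V W))
      (\<lambda>w. mlift (mtensor \<Delta> U (mtensor \<Delta> V W)) (\<lambda>u v. mtens U (mtensor \<Delta> V W) u (mtens V W v w)) t)"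
    if "t \<in> carr (mtensor \<Delta> U V)"
    by (rule linear_on_mlift_param[where V = U and W = V]) (use that U V W in auto)
qed

lemma linear_mtensor_assoc:
    "linear_on (mtensor_space (mtensor \<Delta> U V) W) (mtensor_space U (mtensor \<Delta> V W))
       (afun (mtensor_assoc \<Delta> U V W))"
  and mtensor_assoc_mtens [simp]:
    "\<lbrakk>u \<in> carr U; v \<in> carr V; w \<in> carr W\<rbrakk> \<Longrightarrow>
      afun (mtensor_assoc \<Delta> U V W) (mtens (mtensor \<Delta> U V) W (mtens U V u v) w) =
      mtens U (mtensor \<Delta> V W) u (mtens V W v w)"
proof -
  note ml = mk_lift_simps[OF _ _ _ mtensor_assoc_bilinear(2) mtensor_assoc_bilinear(3)]
  show "linear_on (mtensor_space (mtensor \<Delta> U V) W) (mtensor_space U (mtensor \<Delta> V W))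
       (afun (mtensor_assoc \<Delta> U V W))"
    unfolding mtensor_assoc_def Let_def using ml(1) U V W by simp
  show "afun (mtensor_assoc \<Delta> U V W) (mtens (mtensor \<Delta> U V) W (mtens U V u v) w) =
      mtens U (mtensor \<Delta> V W) u (mtens V W v w)"
    if "u \<in> carr U" "v \<in> carr V" "w \<in> carr W"
    unfolding mtensor_assoc_def Let_def using that U V W
    by (subst ml(2)) (simp_all add: mlift_mtens[OF _ _ _ mtensor_assoc_bilinear(1)])
qed

lemma linear_comul_left [simp]: "linear_on Z A2 f \<Longrightarrow> linear_on Z A3 (\<lambda>z. comul_left scale \<Delta> (f z))"
  and comul_left_ten2 [simp]: "comul_left scale \<Delta> (ten2 scale x y) =
    tensor_lift A3 (\<lambda>x1 x2. ten3 scale x1 x2 y) (\<Delta> x)"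
  and linear_comul_right [simp]: "linear_on Z A2 f \<Longrightarrow> linear_on Z A3 (\<lambda>z. comul_right scale \<Delta> (f z))"
  and comul_right_ten2 [simp]: "comul_right scale \<Delta> (ten2 scale x y) =
    tensor_lift A3 (\<lambda>y1 y2. ten3 scale x y1 y2) (\<Delta> y)"
  unfolding comul_left_def comul_right_def
  by (simp_all add: lift_ten2 linear_lift2 linear_lift2_param)

text \<open>
  On \<open>(U \<otimes> V) \<otimes> W\<close> an element of \<open>A \<otimes> A\<close> acts through \<open>\<Delta> \<otimes> 1\<close>, and on \<open>U \<otimes> (V \<otimes> W)\<close> through \<open>1 \<otimes> \<Delta>\<close>. For
  elements \<open>\<Delta> x\<close> the two agree by coassociativity, so the associator is a homomorphism; for \<open>R\<close> the two
  formulas turn the axioms on \<open>R\<close> into the hexagons.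
\<close>

lemma mtensor_assoc_act:
  assumes X: "X \<in> carr A2" and u: "u \<in> carr U" and v: "v \<in> carr V" and w: "w \<in> carr W"
  shows "afun (mtensor_assoc \<Delta> U V W)
      (act2 (mtensor \<Delta> U V) W X (mtens (mtensor \<Delta> U V) W (mtens U V u v) w)) =
    act3 U V W (comul_left scale \<Delta> X) (mtens U (mtensor \<Delta> V W) u (mtens V W v w))"
proof (rule A2_eqI[OF _ linear_on_comp[OF linear_mtensor_assoc] _ X])
  fix x y
  \<comment> \<open>Here \<open>P\<close> stands for \<open>\<Delta> x\<close>; the statement is linear in \<open>P\<close>.\<close>
  have "afun (mtensor_assoc \<Delta> U V W)
      (mtens (mtensor \<Delta> U V) W (act2 U V P (mtens U V u v)) (act W y w)) =
    act3 U V W (tensor_lift A3 (\<lambda>x1 x2. ten3 scale x1 x2 y) P)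
      (mtens U (mtensor \<Delta> V W) u (mtens V W v w))" if "P \<in> carr A2" for P
    by (rule A2_eqI[OF _ linear_on_comp[OF linear_mtensor_assoc] _ that])
      (use u v w U V W in \<open>simp_all add: lift_ten2 linear_lift2\<close>)
  from this[OF \<Delta>_closed]
  show "afun (mtensor_assoc \<Delta> U V W)
      (act2 (mtensor \<Delta> U V) W (ten2 scale x y) (mtens (mtensor \<Delta> U V) W (mtens U V u v) w)) =
    act3 U V W (comul_left scale \<Delta> (ten2 scale x y)) (mtens U (mtensor \<Delta> V W) u (mtens V W v w))"
    using u v w U V W by simp
qed (use u v w U V W in simp_all)

lemma mtensor_act_comul_right:
  assumes X: "X \<in> carr A2" and u: "u \<in> carr U" and v: "v \<in> carr V" and w: "w \<in> carr W"
  shows "act2 U (mtensor \<Delta> V W) X (mtens U (mtensor \<Delta> V W) u (mtens V W v w)) =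
    act3 U V W (comul_right scale \<Delta> X) (mtens U (mtensor \<Delta> V W) u (mtens V W v w))"
proof (rule A2_eqI[OF _ _ _ X, where U = "mtensor_space U (mtensor \<Delta> V W)"])
  fix x y
  \<comment> \<open>Here \<open>P\<close> stands for \<open>\<Delta> y\<close>; the statement is linear in \<open>P\<close>.\<close>
  have "mtens U (mtensor \<Delta> V W) (act U x u) (act2 V W P (mtens V W v w)) =
    act3 U V W (tensor_lift A3 (\<lambda>y1 y2. ten3 scale x y1 y2) P)
      (mtens U (mtensor \<Delta> V W) u (mtens V W v w))" if "P \<in> carr A2" for P
    by (rule A2_eqI[OF _ _ _ that, where U = "mtensor_space U (mtensor \<Delta> V W)"])
      (use u v w U V W in \<open>simp_all add: lift_ten2 linear_lift2\<close>)
  from this[OF \<Delta>_closed]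
  show "act2 U (mtensor \<Delta> V W) (ten2 scale x y) (mtens U (mtensor \<Delta> V W) u (mtens V W v w)) =
    act3 U V W (comul_right scale \<Delta> (ten2 scale x y)) (mtens U (mtensor \<Delta> V W) u (mtens V W v w))"
    using u v w U V W by simp
qed (use u v w U V W in simp_all)

lemma mtensor_assoc_Arr [simp]: "mtensor_assoc \<Delta> U V W \<in> Arr M"
proof -
  have "mk_arrow (mtensor \<Delta> (mtensor \<Delta> U V) W) (mtensor \<Delta> U (mtensor \<Delta> V W))
      (afun (mtensor_assoc \<Delta> U V W)) \<in> Arr M"
  proof (rule Arr_mk_arrowI)
    show "generates {mtens (mtensor \<Delta> U V) W t w | t w.
        t \<in> {mtens U V u v | u v. u \<in> carr U \<and> v \<in> carr V} \<and> w \<in> carr W} (mtensor \<Delta> (mtensor \<Delta> U V) W)"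
      by (intro mtensor_linear_simps(3)[THEN iffD2] generates_mtens generates_carr; simp add: U V W)
  qed (use U V W linear_mtensor_assoc in
      \<open>auto simp: mtensor_assoc_act mtensor_act_comul_right coassociative\<close>)
  then show ?thesis by (simp add: mtensor_assoc_def Let_def mk_arrow_def)
qed

end

context
  fixes U V W :: "('k, 'a, ('k, 'b) elt) amod"
  assumes U: "left_module scale U" and V: "left_module scale V" and W: "left_module scale W"
begin

lemma mtensor_assoc_iso [simp]: "iso_arr M (mtensor_assoc \<Delta> U V W)"
proof -
  let ?T = "mtensor \<Delta> (mtensor \<Delta> U V) W"
  let ?b = "\<lambda>u v w. mtens (mtensor \<Delta> U V) W (mtens U V u v) w"
  let ?h = "\<lambda>u s. mlift ?T (?b u) s"
  have b: "bilinear_on V W ?T (?b u)" if "u \<in> carr U" for u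
    using that U V W by (auto intro: bilinear_onI)
  have h1: "linear_on (mtensor \<Delta> V W) ?T (?h u)" if "u \<in> carr U" for u
    using linear_on_mlift[OF _ _ _ b[OF that]] U V W by simp
  have h2: "linear_on U ?T (\<lambda>u. ?h u s)" if "s \<in> carr (mtensor \<Delta> V W)" for s
    by (rule linear_on_mlift_param[where V = V and W = W]) (use that U V W in auto)
  have h: "bilinear_on U (mtensor \<Delta> V W) ?T ?h"
    using h1 h2 by (auto intro: bilinear_onI)
  show ?thesis
  proof (rule iso_arrI)
    show "linear_on (acod (mtensor_assoc \<Delta> U V W)) (adom (mtensor_assoc \<Delta> U V W)) (mlift ?T ?h)"
      using linear_on_mlift[OF _ _ _ h] U V W by simp
    show "generates {mtens (mtensor \<Delta> U V) W t w | t w.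
        t \<in> {mtens U V u v | u v. u \<in> carr U \<and> v \<in> carr V} \<and> w \<in> carr W} (adom (mtensor_assoc \<Delta> U V W))"
      unfolding mtensor_assoc_dom[OF U V W]
      by (intro mtensor_linear_simps(3)[THEN iffD2] generates_mtens generates_carr; simp add: U V W)
    show "generates {mtens U (mtensor \<Delta> V W) u t | u t. u \<in> carr U \<and>
        t \<in> {mtens V W v w | v w. v \<in> carr V \<and> w \<in> carr W}} (acod (mtensor_assoc \<Delta> U V W))"
      unfolding mtensor_assoc_dom[OF U V W]
      by (intro mtensor_linear_simps(3)[THEN iffD2] generates_mtens generates_carr; simp add: U V W)
  qed (use U V W in \<open>auto simp: mlift_mtens[OF _ _ _ h] mlift_mtens[OF _ _ _ b]\<close>)
qed

lemma inv_mtensor_assoc [simp]: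
  shows "inv_arr M (mtensor_assoc \<Delta> U V W) \<in> Arr M"
    "adom (inv_arr M (mtensor_assoc \<Delta> U V W)) = mtensor \<Delta> U (mtensor \<Delta> V W)"
    "acod (inv_arr M (mtensor_assoc \<Delta> U V W)) = mtensor \<Delta> (mtensor \<Delta> U V) W"
    "\<lbrakk>u \<in> carr U; v \<in> carr V; w \<in> carr W\<rbrakk>
      \<Longrightarrow> afun (inv_arr M (mtensor_assoc \<Delta> U V W)) (mtens U (mtensor \<Delta> V W) u (mtens V W v w)) =
          mtens (mtensor \<Delta> U V) W (mtens U V u v) w"
  using inv_arr_simps(1-3)[OF mtensor_assoc_iso]
    inv_arr_simps(4)[OF mtensor_assoc_iso, of "mtens (mtensor \<Delta> U V) W (mtens U V u v) w"] U V W
  by simp_all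


subsection \<open>Distributivity\<close>

lemma
  mtensor_ldistrib_simps [simp]:
    "adom (mtensor_ldistrib \<Delta> U V W) = mtensor \<Delta> U (dsum V W)"
    "acod (mtensor_ldistrib \<Delta> U V W) = dsum (mtensor \<Delta> U V) (mtensor \<Delta> U W)"
    "\<lbrakk>u \<in> carr U; v \<in> carr V; w \<in> carr W\<rbrakk> \<Longrightarrow>
      afun (mtensor_ldistrib \<Delta> U V W) (mtens U (dsum V W) u (Couple v w)) =
      Couple (mtens U V u v) (mtens U W u w)" and
  linear_mtensor_ldistrib:
    "linear_on (mtensor_space U (dsum V W)) (dsum (mtensor \<Delta> U V) (mtensor \<Delta> U W))
       (afun (mtensor_ldistrib \<Delta> U V W))" and
  mtensor_rdistrib_simps [simp]:
    "adom (mtensor_rdistrib \<Delta> U V W) = mtensor \<Delta> (dsum U V) W"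
    "acod (mtensor_rdistrib \<Delta> U V W) = dsum (mtensor \<Delta> U W) (mtensor \<Delta> V W)"
    "\<lbrakk>u \<in> carr U; v \<in> carr V; w \<in> carr W\<rbrakk> \<Longrightarrow>
      afun (mtensor_rdistrib \<Delta> U V W) (mtens (dsum U V) W (Couple u v) w) =
      Couple (mtens U W u w) (mtens V W v w)" and
  linear_mtensor_rdistrib:
    "linear_on (mtensor_space (dsum U V) W) (dsum (mtensor \<Delta> U W) (mtensor \<Delta> V W))
       (afun (mtensor_rdistrib \<Delta> U V W))"
  unfolding mtensor_ldistrib_def mtensor_rdistrib_def Let_def
  by (simp_all add: U V W mk_lift_simps del: afun_mk_arrow(3))

text \<open>
  The distributivity maps intertwine the actions of all of \<open>A \<otimes> A\<close>, since that action never mixes the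
  summands.
\<close>

lemma mtensor_ldistrib_act2:
  assumes X: "X \<in> carr A2" and u: "u \<in> carr U" and v: "v \<in> carr V" and w: "w \<in> carr W"
  shows "afun (mtensor_ldistrib \<Delta> U V W) (act2 U (dsum V W) X (mtens U (dsum V W) u (Couple v w))) =
    Couple (act2 U V X (mtens U V u v)) (act2 U W X (mtens U W u w))"
  by (rule A2_eqI[OF _ linear_on_comp[OF linear_mtensor_ldistrib] _ X])
    (use u v w U V W in simp_all)

lemma mtensor_rdistrib_act2:
  assumes X: "X \<in> carr A2" and u: "u \<in> carr U" and v: "v \<in> carr V" and w: "w \<in> carr W"
  shows "afun (mtensor_rdistrib \<Delta> U V W) (act2 (dsum U V) W X (mtens (dsum U V) W (Couple u v) w)) =
    Couple (act2 U W X (mtens U W u w)) (act2 V W X (mtens V W v w))"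
  by (rule A2_eqI[OF _ linear_on_comp[OF linear_mtensor_rdistrib] _ X])
    (use u v w U V W in simp_all)

lemma mtensor_distrib_Arr [simp]:
  "mtensor_ldistrib \<Delta> U V W \<in> Arr M" "mtensor_rdistrib \<Delta> U V W \<in> Arr M"
proof -
  show "mtensor_ldistrib \<Delta> U V W \<in> Arr M"
    unfolding mtensor_ldistrib_def Let_def
    by (rule mk_mtensor_ArrI; (unfold mtensor_ldistrib_def[unfolded Let_def, symmetric])?)
      (use linear_mtensor_ldistrib in \<open>auto simp: U V W mtensor_ldistrib_act2 elim!: dsum_carrE\<close>)
  show "mtensor_rdistrib \<Delta> U V W \<in> Arr M"
    unfolding mtensor_rdistrib_def Let_def
    by (rule mk_mtensor_ArrI; (unfold mtensor_rdistrib_def[unfolded Let_def, symmetric])?)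
      (use linear_mtensor_rdistrib in \<open>auto simp: U V W mtensor_rdistrib_act2 elim!: dsum_carrE\<close>)
qed

text \<open>
  The inverses send \<open>(u \<otimes> v, u' \<otimes> w)\<close> to \<open>u \<otimes> (v, 0) + u' \<otimes> (0, w)\<close>, and symmetrically on the right.
\<close>

lemma mtensor_distrib_iso [simp]:
  "iso_arr M (mtensor_ldistrib \<Delta> U V W)" "iso_arr M (mtensor_rdistrib \<Delta> U V W)"
proof -
  interpret U: carrier_vector_space U using U by simp
  interpret V: carrier_vector_space V using V by simp
  interpret W: carrier_vector_space W using W by simp
  note gen = generates_dsum[OF _ _ mtensor_linear_simps(3)[THEN iffD2, OF generates_mtens2]
      mtensor_linear_simps(3)[THEN iffD2, OF generates_mtens2]]
  {
    let ?T = "mtensor_space U (dsum V W)"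
    let ?b = "\<lambda>u v. mtens U (dsum V W) u (Couple v (vzero W))"
    let ?c = "\<lambda>u w. mtens U (dsum V W) u (Couple (vzero V) w)"
    let ?g = "\<lambda>p. vadd ?T (mlift ?T ?b (lft p)) (mlift ?T ?c (rgt p))"
    interpret T: carrier_vector_space ?T using U V W by simp
    have b: "bilinear_on U V ?T ?b" and c: "bilinear_on U W ?T ?c"
      using U V W by (auto intro!: bilinear_onI simp: linear_on_const_vzero V.vs_simps W.vs_simps)
    note lb = linear_on_mlift[OF _ _ _ b] and lc = linear_on_mlift[OF _ _ _ c]
    have 0: "mlift ?T ?b (vzero (mtensor_space U V)) = vzero ?T"
      "mlift ?T ?c (vzero (mtensor_space U W)) = vzero ?T"
      using linear_on_vzero[OF _ _ lb] linear_on_vzero[OF _ _ lc] U V W by auto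
    have add: "vadd ?T (?b u v) (?c u w) = mtens U (dsum V W) u (Couple v w)"
      if "u \<in> carr U" "v \<in> carr V" "w \<in> carr W" for u v w
      using linear_on_vadd[OF bilinear_onD(1)[OF bilinear_on_mtens[of U "dsum V W"]],
          of u "Couple v (vzero W)" "Couple (vzero V) w"] that U V W
      by (simp add: V.vs_simps W.vs_simps)
    show "iso_arr M (mtensor_ldistrib \<Delta> U V W)"
    proof (rule iso_arrI2[where g = ?g, OF mtensor_ldistrib_simps(1)])
      show "linear_on (acod (mtensor_ldistrib \<Delta> U V W)) ?T ?g"
        using U V W by (auto intro!: linear_on_plus linear_on_comp[OF lb] linear_on_comp[OF lc])
      show "generates ((\<lambda>s. Couple s (vzero (mtensor \<Delta> U W))) ` {mtens U V u v | u v. u \<in> carr U \<and> v \<in> carr V} \<union>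
          Couple (vzero (mtensor \<Delta> U V)) ` {mtens U W u w | u w. u \<in> carr U \<and> w \<in> carr W})
          (acod (mtensor_ldistrib \<Delta> U V W))"
        unfolding mtensor_ldistrib_simps by (rule gen) (simp_all add: U V W)
    qed (use U V W in \<open>auto simp: mlift_mtens[OF _ _ _ b] mlift_mtens[OF _ _ _ c] add 0 V.vs_simps
        W.vs_simps T.vs_simps mtens_vzero elim!: dsum_carrE\<close>)
  }
  {
    let ?T = "mtensor_space (dsum U V) W"
    let ?b = "\<lambda>u w. mtens (dsum U V) W (Couple u (vzero V)) w"
    let ?c = "\<lambda>v w. mtens (dsum U V) W (Couple (vzero U) v) w"
    let ?g = "\<lambda>p. vadd ?T (mlift ?T ?b (lft p)) (mlift ?T ?c (rgt p))"
    interpret T: carrier_vector_space ?T using U V W by simp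
    have b: "bilinear_on U W ?T ?b" and c: "bilinear_on V W ?T ?c"
      using U V W by (auto intro!: bilinear_onI simp: linear_on_const_vzero V.vs_simps U.vs_simps)
    note lb = linear_on_mlift[OF _ _ _ b] and lc = linear_on_mlift[OF _ _ _ c]
    have 0: "mlift ?T ?b (vzero (mtensor_space U W)) = vzero ?T"
      "mlift ?T ?c (vzero (mtensor_space V W)) = vzero ?T"
      using linear_on_vzero[OF _ _ lb] linear_on_vzero[OF _ _ lc] U V W by auto
    have add: "vadd ?T (?b u w) (?c v w) = mtens (dsum U V) W (Couple u v) w"
      if "u \<in> carr U" "v \<in> carr V" "w \<in> carr W" for u v w
      using linear_on_vadd[OF bilinear_onD(2)[OF bilinear_on_mtens[of "dsum U V" W]],
          of w "Couple u (vzero V)" "Couple (vzero U) v"] that U V W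
      by (simp add: V.vs_simps U.vs_simps)
    show "iso_arr M (mtensor_rdistrib \<Delta> U V W)"
    proof (rule iso_arrI2[where g = ?g, OF mtensor_rdistrib_simps(1)])
      show "linear_on (acod (mtensor_rdistrib \<Delta> U V W)) ?T ?g"
        using U V W by (auto intro!: linear_on_plus linear_on_comp[OF lb] linear_on_comp[OF lc])
      show "generates ((\<lambda>s. Couple s (vzero (mtensor \<Delta> V W))) ` {mtens U W u w | u w. u \<in> carr U \<and> w \<in> carr W} \<union>
          Couple (vzero (mtensor \<Delta> U W)) ` {mtens V W v w | v w. v \<in> carr V \<and> w \<in> carr W})
          (acod (mtensor_rdistrib \<Delta> U V W))"
        unfolding mtensor_rdistrib_simps by (rule gen) (simp_all add: U V W)
    qed (use U V W in \<open>auto simp: mlift_mtens[OF _ _ _ b] mlift_mtens[OF _ _ _ c] add 0 V.vs_simps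
        U.vs_simps T.vs_simps mtens_vzero elim!: dsum_carrE\<close>)
  }
qed

end

subsection \<open>Multiplicative zeros\<close>

context
  fixes V :: "('k, 'a, ('k, 'b) elt) amod"
  assumes V: "left_module scale V"
begin

lemma mtensor_null_simps [simp]:
  "adom (mtensor_lnull \<Delta> V) = mtensor \<Delta> zero_mod V" "acod (mtensor_lnull \<Delta> V) = zero_mod"
  "t \<in> carr (mtensor_space zero_mod V) \<Longrightarrow> afun (mtensor_lnull \<Delta> V) t = Star"
  "adom (mtensor_rnull \<Delta> V) = mtensor \<Delta> V zero_mod" "acod (mtensor_rnull \<Delta> V) = zero_mod"
  "t \<in> carr (mtensor_space V zero_mod) \<Longrightarrow> afun (mtensor_rnull \<Delta> V) t = Star"
  by (simp_all add: mtensor_lnull_def mtensor_rnull_def)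

lemma mtensor_null_Arr [simp]: "mtensor_lnull \<Delta> V \<in> Arr M" "mtensor_rnull \<Delta> V \<in> Arr M"
  unfolding mtensor_lnull_def mtensor_rnull_def
  by (rule Arr_mk_arrowI[OF _ _ _ generates_carr]; simp add: V)+

text \<open>
  Every pure tensor with a factor in the zero module is zero, so the constant zero map is inverse to
  the constant map to the zero module.
\<close>

lemma mtensor_null_iso [simp]: "iso_arr M (mtensor_lnull \<Delta> V)" "iso_arr M (mtensor_rnull \<Delta> V)"
proof -
  interpret V: carrier_vector_space V using V by simp
  show "iso_arr M (mtensor_lnull \<Delta> V)"
    by (rule iso_arrI2[where g = "\<lambda>x. vzero (mtensor_space zero_mod V)", OF mtensor_null_simps(1) _ _ _ _ _ generates_carr])
      (use mtens_vzero(2)[of "zero_mod :: ('k, 'a, ('k, 'b) elt) amod" V] in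
        \<open>auto simp: V linear_on_const_vzero carrier_vector_space.vzero_closed\<close>)
  show "iso_arr M (mtensor_rnull \<Delta> V)"
    by (rule iso_arrI2[where g = "\<lambda>x. vzero (mtensor_space V zero_mod)", OF mtensor_null_simps(4) _ _ _ _ _ generates_carr])
      (use mtens_vzero(1)[of V "zero_mod :: ('k, 'a, ('k, 'b) elt) amod"] in
        \<open>auto simp: V linear_on_const_vzero carrier_vector_space.vzero_closed\<close>)
qed

end

end

section \<open>The bimonoidal category of modules\<close>

context bialgebra
begin

text \<open>
  Typing and invertibility are rewrite rules by now. The equational axioms compare two arrows with the
  same ends and are tested on iterated pure tensors of the domain, where both sides evaluate to the
  same rearrangement of the factors; scalars from the unit object move across the tensor sign.
\<close>

lemma monoidal_mtensor:
  "monoidal_category M (mtensor \<Delta>) (mtensor_arr \<Delta>) (unit_mod \<epsilon>)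
     (mtensor_assoc \<Delta>) (mtensor_lunit \<Delta> \<epsilon>) (mtensor_runit \<Delta> \<epsilon>)"
  apply (intro monoidal_category.intro category_M monoidal_category_axioms.intro)
                  apply (simp; fail)
                 apply (simp; fail)
  subgoal for X Y by (rule arrow_eqI2[of _ X Y]) auto
  subgoal for f X X' f' X'' g Y Y' g' Y'' by (rule arrow_eqI2[of _ X Y]) auto
              apply (simp; fail)+
  subgoal for f X X' g Y Y' h Z Z' by (rule arrow_eqI3[of _ X Y Z]) auto
           apply (simp; fail)+
  subgoal for f X X'
    by (rule arrow_eqI2[of _ "unit_mod \<epsilon>" X]) (auto simp: linear_on_vscl[OF ArrD(3)])
       apply (simp; fail)+
  subgoal for f X X'
    by (rule arrow_eqI2[of _ X "unit_mod \<epsilon>"]) (auto simp: linear_on_vscl[OF ArrD(3)])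
  subgoal for W X Y Z by (rule arrow_eqI4[of _ W X Y Z]) auto
  subgoal for X Y
    using linear_on_vscl[OF bilinear_onD(1)[OF bilinear_on_mtens], of X Y]
      linear_on_vscl[OF bilinear_onD(2)[OF bilinear_on_mtens], of X Y]
    by (intro arrow_eqI3[of _ X "unit_mod \<epsilon>" Y]) (auto simp: carrier_vector_space.vscl_closed)
  done

text \<open>
  The summands of a domain such as \<open>(A \<oplus> B) \<otimes> D\<close> are treated as pairs \<open>(a, b)\<close>, so that generators are pure
  tensors of tuples and the distributivity maps act on them by distributing. Axioms with values in the
  zero module hold because that module has one element.
\<close>

lemma bimonoidal_Mod:
  "bimonoidal_category M
      dsum dsum_arr zero_mod dsum_assoc dsum_lunit dsum_runit dsum_sym
      (mtensor \<Delta>) (mtensor_arr \<Delta>) (unit_mod \<epsilon>)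
      (mtensor_assoc \<Delta>) (mtensor_lunit \<Delta> \<epsilon>) (mtensor_runit \<Delta> \<epsilon>)
      (mtensor_lnull \<Delta>) (mtensor_rnull \<Delta>)
      (mtensor_ldistrib \<Delta>) (mtensor_rdistrib \<Delta>)"
  apply (intro bimonoidal_category.intro symmetric_monoidal_dsum monoidal_mtensor
      bimonoidal_category_axioms.intro)
  apply (simp; fail)
  apply (simp; fail)
  subgoal by (rule arrow_eqI_zero) auto
  apply (simp; fail)
  apply (simp; fail)
  subgoal by (rule arrow_eqI_zero) auto
  apply (simp; fail)
  apply (simp add: iso_arr_mono; fail)
  subgoal for f A A' g B B' h D D' by (rule arrow_eqI2[of _ A "dsum B D"]) (auto elim!: dsum_carrE)
  apply (simp; fail)
  apply (simp add: iso_arr_mono; fail)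
  subgoal for f A A' g B B' h D D' by (rule arrow_eqI2[of _ "dsum A B" D]) (auto elim!: dsum_carrE)
  subgoal for A B D by (rule arrow_eqI2[of _ A "dsum B D"]) (auto elim!: dsum_carrE)
  subgoal for A B D by (rule arrow_eqI2[of _ "dsum A B" D]) (auto elim!: dsum_carrE)
  subgoal for A B D E by (rule arrow_eqI2[of _ "dsum (dsum A B) D" E]) (auto elim!: dsum_carrE)
  subgoal for A B D E by (rule arrow_eqI2[of _ A "dsum (dsum B D) E"]) (auto elim!: dsum_carrE)
  subgoal for A B D E by (rule arrow_eqI3[of _ A B "dsum D E"]) (auto elim!: dsum_carrE)
  subgoal for A B D E by (rule arrow_eqI3[of _ "dsum A B" D E]) (auto elim!: dsum_carrE)
  subgoal for A B D E by (rule arrow_eqI3[of _ A "dsum B D" E]) (auto elim!: dsum_carrE)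
  subgoal for A B D E
    by (rule arrow_eqI2[of _ "dsum A B" "dsum D E"]) (auto simp: middle_exchange_def elim!: dsum_carrE)
  subgoal by (rule arrow_eqI_zero) auto
  subgoal by (rule arrow_eqI_zero) auto
  subgoal by (rule arrow_eqI_zero) auto
  subgoal by (rule arrow_eqI_zero) auto
  subgoal by (rule arrow_eqI_zero) auto
  subgoal by (rule arrow_eqI_zero) auto
  subgoal by (rule arrow_eqI_zero) auto
  subgoal by (rule arrow_eqI_zero) auto
  subgoal for A B by (rule arrow_eqI2[of _ A "dsum zero_mod B"]) (auto elim!: dsum_carrE)
  subgoal for A B by (rule arrow_eqI2[of _ "dsum zero_mod B" A]) (auto elim!: dsum_carrE)
  subgoal for A B by (rule arrow_eqI2[of _ A "dsum B zero_mod"]) (auto elim!: dsum_carrE)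
  subgoal for A B by (rule arrow_eqI2[of _ "dsum A zero_mod" B]) (auto elim!: dsum_carrE)
  subgoal for A B by (rule arrow_eqI2[of _ "unit_mod \<epsilon>" "dsum A B"]) (auto elim!: dsum_carrE)
  subgoal for A B by (rule arrow_eqI2[of _ "dsum A B" "unit_mod \<epsilon>"]) (auto elim!: dsum_carrE)
  done

lemma tight_bimonoidal_Mod:
  "tight_bimonoidal_category M
      dsum dsum_arr zero_mod dsum_assoc dsum_lunit dsum_runit dsum_sym
      (mtensor \<Delta>) (mtensor_arr \<Delta>) (unit_mod \<epsilon>)
      (mtensor_assoc \<Delta>) (mtensor_lunit \<Delta> \<epsilon>) (mtensor_runit \<Delta> \<epsilon>)
      (mtensor_lnull \<Delta>) (mtensor_rnull \<Delta>)
      (mtensor_ldistrib \<Delta>) (mtensor_rdistrib \<Delta>)"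
  by (intro tight_bimonoidal_category.intro tight_bimonoidal_category_axioms.intro bimonoidal_Mod)
    simp_all

end

section \<open>Braidings\<close>

context bialgebra
begin

lemma linear_swap2 [simp]: "linear_on Z A2 f \<Longrightarrow> linear_on Z A2 (\<lambda>z. swap2 scale (f z))"
  and swap2_ten2 [simp]: "swap2 scale (ten2 scale x y) = ten2 scale y x"
  unfolding swap2_def by (simp_all add: lift_ten2 linear_lift2)

lemma swap2_closed [simp]: "X \<in> carr A2 \<Longrightarrow> swap2 scale X \<in> carr A2"
  by (rule linear_on_closed[OF linear_swap2[OF linear_on_id]])

lemma swap2_swap2: "X \<in> carr A2 \<Longrightarrow> swap2 scale (swap2 scale X) = X"
  by (rule A2_eqI[where U = A2 and f = "\<lambda>X. swap2 scale (swap2 scale X)" and g = "\<lambda>X. X"]) simp_all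

lemma
  shows linear_insert12 [simp]: "linear_on Z A2 f \<Longrightarrow> linear_on Z A3 (\<lambda>z. insert12 scale (f z))"
    and linear_insert13 [simp]: "linear_on Z A2 f \<Longrightarrow> linear_on Z A3 (\<lambda>z. insert13 scale (f z))"
    and linear_insert23 [simp]: "linear_on Z A2 f \<Longrightarrow> linear_on Z A3 (\<lambda>z. insert23 scale (f z))"
    and insert12_ten2 [simp]: "insert12 scale (ten2 scale x y) = ten3 scale x y 1"
    and insert13_ten2 [simp]: "insert13 scale (ten2 scale x y) = ten3 scale x 1 y"
    and insert23_ten2 [simp]: "insert23 scale (ten2 scale x y) = ten3 scale 1 x y"
  unfolding insert12_def insert13_def insert23_def by (simp_all add: lift_ten2 linear_lift2)

lemma insert_closed [simp]:
  assumes "X \<in> carr A2"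
  shows "insert12 scale X \<in> carr A3" "insert13 scale X \<in> carr A3" "insert23 scale X \<in> carr A3"
  using assms linear_on_closed[OF linear_insert12[OF linear_on_id]]
    linear_on_closed[OF linear_insert13[OF linear_on_id]]
    linear_on_closed[OF linear_insert23[OF linear_on_id]]
  by auto

context
  fixes V W :: "('k, 'a, ('k, 'b) elt) amod"
  assumes V: "left_module scale V" and W: "left_module scale W"
begin

lemma linear_mtensor_swap: "linear_on (mtensor_space V W) (mtensor_space W V) (mtensor_swap V W)"
  and mtensor_swap_mtens [simp]:
    "\<lbrakk>v \<in> carr V; w \<in> carr W\<rbrakk> \<Longrightarrow> mtensor_swap V W (mtens V W v w) = mtens W V w v"
proof -
  have b: "bilinear_on V W (mtensor_space W V) (\<lambda>v w. mtens W V w v)"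
    using V W by (auto intro: bilinear_onI)
  show "linear_on (mtensor_space V W) (mtensor_space W V) (mtensor_swap V W)"
    unfolding mtensor_swap_def using V W by (intro linear_on_mlift b) simp_all
  show "mtensor_swap V W (mtens V W v w) = mtens W V w v" if "v \<in> carr V" "w \<in> carr W"
    unfolding mtensor_swap_def using V W that by (intro mlift_mtens b) simp_all
qed

lemma linear_mtensor_swap_comp [simp]:
  "linear_on Z (mtensor_space V W) f \<Longrightarrow> linear_on Z (mtensor_space W V) (\<lambda>z. mtensor_swap V W (f z))"
  by (rule linear_on_comp[OF linear_mtensor_swap])

lemma mtensor_swap_closed [simp]:
  "t \<in> carr (mtensor_space V W) \<Longrightarrow> mtensor_swap V W t \<in> carr (mtensor_space W V)"
  by (rule linear_on_closed[OF linear_mtensor_swap])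

end

context
  fixes V W :: "('k, 'a, ('k, 'b) elt) amod"
  assumes V: "left_module scale V" and W: "left_module scale W"
begin

lemma mtensor_swap_swap [simp]:
  assumes "t \<in> carr (mtensor_space V W)"
  shows "mtensor_swap W V (mtensor_swap V W t) = t"
  by (rule mtensor_eqI[of V W "mtensor_space V W" "\<lambda>t. mtensor_swap W V (mtensor_swap V W t)" "\<lambda>t. t"])
    (use assms V W in simp_all)

lemma mtensor_swap_act2:
  assumes X: "X \<in> carr A2" and t: "t \<in> carr (mtensor_space V W)"
  shows "mtensor_swap V W (act2 V W X t) = act2 W V (swap2 scale X) (mtensor_swap V W t)"
proof (rule A2_eqI[OF _ _ _ X, where U = "mtensor_space W V"])
  fix x y
  show "mtensor_swap V W (act2 V W (ten2 scale x y) t) =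
      act2 W V (swap2 scale (ten2 scale x y)) (mtensor_swap V W t)"
    by (rule mtensor_eqI[OF _ _ _ _ _ t, where U = "mtensor_space W V"]) (use V W in simp_all)
qed (use V W t in simp_all)

end

lemma mtensor_swap_nat:
  assumes f: "f \<in> Arr M" and g: "g \<in> Arr M" and t: "t \<in> carr (mtensor_space (adom f) (adom g))"
  shows "mtensor_swap (acod f) (acod g) (afun (mtensor_arr \<Delta> f g) t) =
     afun (mtensor_arr \<Delta> g f) (mtensor_swap (adom f) (adom g) t)"
  by (rule mtensor_eqI[OF _ _ _ _ _ t, where U = "mtensor_space (acod g) (acod f)"])
    (use f g in simp_all)

lemma linear_mtensor_assoc_comp [simp]:
  "\<lbrakk>left_module scale U; left_module scale V; left_module scale W;
    linear_on Z (mtensor_space (mtensor \<Delta> U V) W) f\<rbrakk>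
    \<Longrightarrow> linear_on Z (mtensor_space U (mtensor \<Delta> V W)) (\<lambda>z. afun (mtensor_assoc \<Delta> U V W) (f z))"
  by (rule linear_on_comp[OF linear_mtensor_assoc])

lemma act3_closed [simp]:
  "\<lbrakk>left_module scale U; left_module scale V; left_module scale W; X \<in> carr A3;
    t \<in> carr (mtensor_space U (mtensor \<Delta> V W))\<rbrakk>
    \<Longrightarrow> act3 U V W X t \<in> carr (mtensor_space U (mtensor \<Delta> V W))"
  by (rule bilinear_on_closed[OF bilinear_on_act3])

lemma linear_act3_right [simp]:
  "\<lbrakk>left_module scale U; left_module scale V; left_module scale W; X \<in> carr A3;
    linear_on Z (mtensor_space U (mtensor \<Delta> V W)) f\<rbrakk>
    \<Longrightarrow> linear_on Z (mtensor_space U (mtensor \<Delta> V W)) (\<lambda>z. act3 U V W X (f z))"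
  by (rule linear_on_comp[OF bilinear_onD(1)[OF bilinear_on_act3]])

end

context braided_bialgebra
begin

declare R_closed [simp]

lemma mtensor_braid_simps [simp]:
  "adom (mtensor_braid \<Delta> R V W) = mtensor \<Delta> V W" "acod (mtensor_braid \<Delta> R V W) = mtensor \<Delta> W V"
  "t \<in> carr (mtensor_space V W)
    \<Longrightarrow> afun (mtensor_braid \<Delta> R V W) t = mtensor_swap V W (act2 V W R t)"
  by (simp_all add: mtensor_braid_def)

context
  fixes V W :: "('k, 'a, ('k, 'b) elt) amod"
  assumes V: "left_module scale V" and W: "left_module scale W"
begin

text \<open>
  This is the axiom \<open>\<Delta>\<^sup>o\<^sup>p(x) R = R \<Delta>(x)\<close>, applied to vectors: the flip of \<open>V \<otimes> W\<close> exchanges the actions of an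
  element of \<open>A \<otimes> A\<close> and of its flip.
\<close>

lemma mtensor_braid_Arr [simp]: "mtensor_braid \<Delta> R V W \<in> Arr M"
  unfolding mtensor_braid_def
proof (rule Arr_mk_arrowI[OF _ _ _ generates_carr])
  fix x t assume t: "t \<in> carr (mtensor \<Delta> V W)"
  have "act2 V W R (act2 V W (\<Delta> x) t) = act2 V W (mult2 scale R (\<Delta> x)) t"
    using t by (simp add: V W act2_mult2)
  also have "\<dots> = act2 V W (swap2 scale (\<Delta> x)) (act2 V W R t)"
    using t by (simp add: V W act2_mult2 R_commute[symmetric])
  finally show "mtensor_swap V W (act2 V W R (act (mtensor \<Delta> V W) x t)) =
      act (mtensor \<Delta> W V) x (mtensor_swap V W (act2 V W R t))"
    using t by (simp add: V W mtensor_swap_act2 swap2_swap2)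
qed (simp_all add: V W)

lemma mtensor_braid_iso [simp]: "iso_arr M (mtensor_braid \<Delta> R V W)"
proof -
  obtain S where S: "S \<in> carr A2" "mult2 scale R S = ten2 scale 1 1" "mult2 scale S R = ten2 scale 1 1"
    using R_invertible by blast
  have SR: "act2 V W S (act2 V W R t) = t" "act2 V W R (act2 V W S t) = t"
    if "t \<in> carr (mtensor_space V W)" for t
    using S that V W by (simp_all add: act2_mult2[symmetric] act2_one)
  show ?thesis
    by (rule iso_arrI[OF _ _ generates_carr _ generates_carr,
          where g = "\<lambda>t. act2 V W S (mtensor_swap W V t)"])
      (simp_all add: V W S SR)
qed

end

context
  fixes X Y Z :: "('k, 'a, ('k, 'b) elt) amod"
  assumes X: "left_module scale X" and Y: "left_module scale Y" and Z: "left_module scale Z"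
begin

text \<open>
  Moving \<open>x\<close> past \<open>y \<otimes> z\<close> in one step lets \<open>(1 \<otimes> \<Delta>)(R)\<close> act on \<open>x \<otimes> (y \<otimes> z)\<close> before a cyclic permutation of the
  factors. Moving it past \<open>y\<close> and then past \<open>z\<close> lets \<open>R\<^sub>1\<^sub>2\<close> and then \<open>R\<^sub>1\<^sub>3\<close> act before the same
  permutation. So the hexagon is the image of \<open>(1 \<otimes> \<Delta>)(R) = R\<^sub>1\<^sub>3 R\<^sub>1\<^sub>2\<close>.
\<close>

lemma mtensor_hexagon1:
  "Comp M (mtensor_assoc \<Delta> Y Z X)
     (Comp M (mtensor_braid \<Delta> R X (mtensor \<Delta> Y Z)) (mtensor_assoc \<Delta> X Y Z)) =
   Comp M (mtensor_arr \<Delta> (Idt M Y) (mtensor_braid \<Delta> R X Z))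
     (Comp M (mtensor_assoc \<Delta> Y X Z) (mtensor_arr \<Delta> (mtensor_braid \<Delta> R X Y) (Idt M Z)))"
proof (rule arrow_eqI3[of _ X Y Z])
  fix x y z assume x: "x \<in> carr X" and y: "y \<in> carr Y" and z: "z \<in> carr Z"
  note XYZ = X Y Z x y z left_module.act_one[OF X] left_module.act_one[OF Y] left_module.act_one[OF Z]
  let ?t = "mtens X (mtensor \<Delta> Y Z) x (mtens Y Z y z)"
  let ?L = "\<lambda>Q. afun (mtensor_assoc \<Delta> Y Z X) (mtensor_swap X (mtensor \<Delta> Y Z) Q)"
  let ?T = "mtensor_space Y (mtensor \<Delta> Z X)"
  \<comment> \<open>The two occurrences of \<open>R\<close> are resolved separately. Here the one that acts first is already the pure tensor \<open>a \<otimes> b\<close>.\<close>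
  have 1: "mtens Y (mtensor \<Delta> Z X) (act Y b y) (mtensor_swap X Z (act2 X Z R (mtens X Z (act X a x) z))) =
      ?L (act3 X Y Z (insert13 scale R) (act3 X Y Z (ten3 scale a b 1) ?t))" for a b
    by (rule A2_eqI[OF _ _ _ R_closed, where U = ?T]) (simp_all add: XYZ)
  have 2: "afun (mtensor_arr \<Delta> (Idt M Y) (mtensor_braid \<Delta> R X Z))
        (afun (mtensor_assoc \<Delta> Y X Z)
          (mtens (mtensor \<Delta> Y X) Z (mtensor_swap X Y (act2 X Y R (mtens X Y x y))) z)) =
      ?L (act3 X Y Z (insert13 scale R) (act3 X Y Z (insert12 scale R) ?t))"
    by (rule A2_eqI[OF _ _ _ R_closed, where U = ?T])
      (use 1 in \<open>simp_all add: XYZ\<close>)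
  show "afun (Comp M (mtensor_assoc \<Delta> Y Z X)
        (Comp M (mtensor_braid \<Delta> R X (mtensor \<Delta> Y Z)) (mtensor_assoc \<Delta> X Y Z)))
        (mtens (mtensor \<Delta> X Y) Z (mtens X Y x y) z) =
      afun (Comp M (mtensor_arr \<Delta> (Idt M Y) (mtensor_braid \<Delta> R X Z))
        (Comp M (mtensor_assoc \<Delta> Y X Z) (mtensor_arr \<Delta> (mtensor_braid \<Delta> R X Y) (Idt M Z))))
        (mtens (mtensor \<Delta> X Y) Z (mtens X Y x y) z)"
    using 2 by (simp add: XYZ mtensor_act_comul_right comul_right_R act3_mult3)
qed (simp_all add: X Y Z)

text \<open>
  In the same way this hexagon is the image of \<open>(\<Delta> \<otimes> 1)(R) = R\<^sub>1\<^sub>3 R\<^sub>2\<^sub>3\<close>.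
\<close>

lemma mtensor_hexagon2:
  "Comp M (inv_arr M (mtensor_assoc \<Delta> Z X Y))
     (Comp M (mtensor_braid \<Delta> R (mtensor \<Delta> X Y) Z) (inv_arr M (mtensor_assoc \<Delta> X Y Z))) =
   Comp M (mtensor_arr \<Delta> (mtensor_braid \<Delta> R X Z) (Idt M Y))
     (Comp M (inv_arr M (mtensor_assoc \<Delta> X Z Y)) (mtensor_arr \<Delta> (Idt M X) (mtensor_braid \<Delta> R Y Z)))"
proof (rule arrow_eqI3'[of _ X Y Z])
  fix x y z assume x: "x \<in> carr X" and y: "y \<in> carr Y" and z: "z \<in> carr Z"
  note XYZ = X Y Z x y z left_module.act_one[OF X] left_module.act_one[OF Y] left_module.act_one[OF Z]
  let ?t = "mtens X (mtensor \<Delta> Y Z) x (mtens Y Z y z)"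
  let ?inv = "\<lambda>U V W. afun (inv_arr M (mtensor_assoc \<Delta> U V W))"
  let ?L = "\<lambda>Q. ?inv Z X Y (mtensor_swap (mtensor \<Delta> X Y) Z (?inv X Y Z Q))"
  let ?T = "mtensor_space (mtensor \<Delta> Z X) Y"
  \<comment> \<open>The domain is bracketed to the right here, so the action through \<open>\<Delta> \<otimes> 1\<close> is transported along the associator.\<close>
  have 0: "act2 (mtensor \<Delta> X Y) Z R (mtens (mtensor \<Delta> X Y) Z (mtens X Y x y) z) =
      ?inv X Y Z (act3 X Y Z (comul_left scale \<Delta> R) ?t)"
    using inv_arr_simps(4)[OF mtensor_assoc_iso[OF X Y Z],
        of "act2 (mtensor \<Delta> X Y) Z R (mtens (mtensor \<Delta> X Y) Z (mtens X Y x y) z)"]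
    by (simp add: XYZ mtensor_assoc_act)
  \<comment> \<open>As before, the occurrence of \<open>R\<close> that acts first is already the pure tensor \<open>a \<otimes> b\<close>.\<close>
  have 1: "mtens (mtensor \<Delta> Z X) Y (mtensor_swap X Z (act2 X Z R (mtens X Z x (act Z b z)))) (act Y a y) =
      ?L (act3 X Y Z (insert13 scale R) (act3 X Y Z (ten3 scale 1 a b) ?t))" for a b
    by (rule A2_eqI[OF _ _ _ R_closed, where U = ?T]) (simp_all add: XYZ)
  have 2: "afun (mtensor_arr \<Delta> (mtensor_braid \<Delta> R X Z) (Idt M Y))
        (?inv X Z Y (mtens X (mtensor \<Delta> Z Y) x (mtensor_swap Y Z (act2 Y Z R (mtens Y Z y z))))) =
      ?L (act3 X Y Z (insert13 scale R) (act3 X Y Z (insert23 scale R) ?t))"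
    by (rule A2_eqI[OF _ _ _ R_closed, where U = ?T])
      (use 1 in \<open>simp_all add: XYZ\<close>)
  show "afun (Comp M (inv_arr M (mtensor_assoc \<Delta> Z X Y))
      (Comp M (mtensor_braid \<Delta> R (mtensor \<Delta> X Y) Z) (inv_arr M (mtensor_assoc \<Delta> X Y Z)))) ?t =
    afun (Comp M (mtensor_arr \<Delta> (mtensor_braid \<Delta> R X Z) (Idt M Y))
      (Comp M (inv_arr M (mtensor_assoc \<Delta> X Z Y)) (mtensor_arr \<Delta> (Idt M X) (mtensor_braid \<Delta> R Y Z)))) ?t"
    using 2 by (simp add: XYZ 0 comul_left_R act3_mult3)
qed (simp_all add: X Y Z)

lemma mtensor_distrib_braid:
  "Comp M (mtensor_ldistrib \<Delta> Z X Y) (mtensor_braid \<Delta> R (dsum X Y) Z) =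
   Comp M (dsum_arr (mtensor_braid \<Delta> R X Z) (mtensor_braid \<Delta> R Y Z)) (mtensor_rdistrib \<Delta> X Y Z)"
  "Comp M (mtensor_rdistrib \<Delta> Y Z X) (mtensor_braid \<Delta> R X (dsum Y Z)) =
   Comp M (dsum_arr (mtensor_braid \<Delta> R X Y) (mtensor_braid \<Delta> R X Z)) (mtensor_ldistrib \<Delta> X Y Z)"
proof -
  have 1: "afun (mtensor_ldistrib \<Delta> Z X Y) (mtensor_swap (dsum X Y) Z
        (act2 (dsum X Y) Z R (mtens (dsum X Y) Z (Couple x y) z))) =
      Couple (mtensor_swap X Z (act2 X Z R (mtens X Z x z))) (mtensor_swap Y Z (act2 Y Z R (mtens Y Z y z)))"
    if "x \<in> carr X" "y \<in> carr Y" "z \<in> carr Z" for x y z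
    by (rule A2_eqI[OF _ linear_on_comp[OF linear_mtensor_ldistrib] _ R_closed])
      (use that in \<open>simp_all add: X Y Z\<close>)
  have 2: "afun (mtensor_rdistrib \<Delta> Y Z X) (mtensor_swap X (dsum Y Z)
        (act2 X (dsum Y Z) R (mtens X (dsum Y Z) x (Couple y z)))) =
      Couple (mtensor_swap X Y (act2 X Y R (mtens X Y x y))) (mtensor_swap X Z (act2 X Z R (mtens X Z x z)))"
    if "x \<in> carr X" "y \<in> carr Y" "z \<in> carr Z" for x y z
    by (rule A2_eqI[OF _ linear_on_comp[OF linear_mtensor_rdistrib] _ R_closed])
      (use that in \<open>simp_all add: X Y Z\<close>)
  show "Comp M (mtensor_ldistrib \<Delta> Z X Y) (mtensor_braid \<Delta> R (dsum X Y) Z) =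
   Comp M (dsum_arr (mtensor_braid \<Delta> R X Z) (mtensor_braid \<Delta> R Y Z)) (mtensor_rdistrib \<Delta> X Y Z)"
    by (rule arrow_eqI2[of _ "dsum X Y" Z]) (auto simp: X Y Z 1 elim!: dsum_carrE)
  show "Comp M (mtensor_rdistrib \<Delta> Y Z X) (mtensor_braid \<Delta> R X (dsum Y Z)) =
   Comp M (dsum_arr (mtensor_braid \<Delta> R X Y) (mtensor_braid \<Delta> R X Z)) (mtensor_ldistrib \<Delta> X Y Z)"
    by (rule arrow_eqI2[of _ X "dsum Y Z"]) (auto simp: X Y Z 2 elim!: dsum_carrE)
qed

end

lemma braided_monoidal_mtensor:
  "braided_monoidal_category M (mtensor \<Delta>) (mtensor_arr \<Delta>) (unit_mod \<epsilon>)
     (mtensor_assoc \<Delta>) (mtensor_lunit \<Delta> \<epsilon>) (mtensor_runit \<Delta> \<epsilon>) (mtensor_braid \<Delta> R)"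
proof (intro braided_monoidal_category.intro monoidal_mtensor braided_monoidal_category_axioms.intro)
  fix f g :: "('k, 'a, ('k, 'b) elt) arrow" and X X' Y Y'
  assume "f \<in> hom M X X'" "g \<in> hom M Y Y'"
  then show "Comp M (mtensor_braid \<Delta> R X' Y') (mtensor_arr \<Delta> f g) =
      Comp M (mtensor_arr \<Delta> g f) (mtensor_braid \<Delta> R X Y)"
    by (intro arrow_eqI_carr) (auto simp: mtensor_arr_act2[symmetric] mtensor_swap_nat[symmetric])
qed (simp_all add: mtensor_hexagon1 mtensor_hexagon2)

lemma tight_braided_bimonoidal_Mod:
  "tight_braided_bimonoidal_category M
      dsum dsum_arr zero_mod dsum_assoc dsum_lunit dsum_runit dsum_sym
      (mtensor \<Delta>) (mtensor_arr \<Delta>) (unit_mod \<epsilon>)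
      (mtensor_assoc \<Delta>) (mtensor_lunit \<Delta> \<epsilon>) (mtensor_runit \<Delta> \<epsilon>)
      (mtensor_lnull \<Delta>) (mtensor_rnull \<Delta>)
      (mtensor_ldistrib \<Delta>) (mtensor_rdistrib \<Delta>) (mtensor_braid \<Delta> R)"
  by (intro tight_braided_bimonoidal_category.intro braided_bimonoidal_category.intro
      braided_bimonoidal_category_axioms.intro tight_bimonoidal_Mod bimonoidal_Mod
      braided_monoidal_mtensor)
    (auto simp: mtensor_distrib_braid intro!: arrow_eqI_zero)

end

lemma (in symmetric_bialgebra) tight_symmetric_bimonoidal_Mod:
  "tight_symmetric_bimonoidal_category M
      dsum dsum_arr zero_mod dsum_assoc dsum_lunit dsum_runit dsum_sym
      (mtensor \<Delta>) (mtensor_arr \<Delta>) (unit_mod \<epsilon>)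
      (mtensor_assoc \<Delta>) (mtensor_lunit \<Delta> \<epsilon>) (mtensor_runit \<Delta> \<epsilon>)
      (mtensor_lnull \<Delta>) (mtensor_rnull \<Delta>)
      (mtensor_ldistrib \<Delta>) (mtensor_rdistrib \<Delta>) (mtensor_braid \<Delta> R)"
proof (intro tight_symmetric_bimonoidal_category.intro symmetric_bimonoidal_category.intro
    symmetric_bimonoidal_category_axioms.intro tight_bimonoidal_Mod
    tight_braided_bimonoidal_category.axioms(1)[OF tight_braided_bimonoidal_Mod])
  fix V W :: "('a, 'b, ('a, 'c) elt) amod"
  assume "V \<in> Ob M" "W \<in> Ob M"
  then show "Comp M (mtensor_braid \<Delta> R W V) (mtensor_braid \<Delta> R V W) = Idt M (mtensor \<Delta> V W)"
    by (intro arrow_eqI_carr)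
      (simp_all add: mtensor_swap_act2[of V W] act2_mult2[symmetric] R_symmetric act2_one)
qed

theorem mainTheorem6:
  fixes scale :: "'k::field \<Rightarrow> 'a::ring_1 \<Rightarrow> 'a"
    and \<Delta> :: "'a \<Rightarrow> ('a \<times> 'a) list"
    and \<epsilon> :: "'a \<Rightarrow> 'k"
    and R :: "('a \<times> 'a) list"
  assumes "bialgebra scale \<Delta> \<epsilon>"
  shows "tight_bimonoidal_category (Mod TYPE('b) scale)
              dsum dsum_arr zero_mod dsum_assoc dsum_lunit dsum_runit dsum_sym
              (mtensor \<Delta>) (mtensor_arr \<Delta>) (unit_mod \<epsilon>)
              (mtensor_assoc \<Delta>) (mtensor_lunit \<Delta> \<epsilon>) (mtensor_runit \<Delta> \<epsilon>)
              (mtensor_lnull \<Delta>) (mtensor_rnull \<Delta>)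
              (mtensor_ldistrib \<Delta>) (mtensor_rdistrib \<Delta>)
         \<and> (braided_bialgebra scale \<Delta> \<epsilon> R \<longrightarrow>
            tight_braided_bimonoidal_category (Mod TYPE('b) scale)
              dsum dsum_arr zero_mod dsum_assoc dsum_lunit dsum_runit dsum_sym
              (mtensor \<Delta>) (mtensor_arr \<Delta>) (unit_mod \<epsilon>)
              (mtensor_assoc \<Delta>) (mtensor_lunit \<Delta> \<epsilon>) (mtensor_runit \<Delta> \<epsilon>)
              (mtensor_lnull \<Delta>) (mtensor_rnull \<Delta>)
              (mtensor_ldistrib \<Delta>) (mtensor_rdistrib \<Delta>)
              (mtensor_braid \<Delta> R))
         \<and> (symmetric_bialgebra scale \<Delta> \<epsilon> R \<longrightarrow>
            tight_symmetric_bimonoidal_category (Mod TYPE('b) scale)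
              dsum dsum_arr zero_mod dsum_assoc dsum_lunit dsum_runit dsum_sym
              (mtensor \<Delta>) (mtensor_arr \<Delta>) (unit_mod \<epsilon>)
              (mtensor_assoc \<Delta>) (mtensor_lunit \<Delta> \<epsilon>) (mtensor_runit \<Delta> \<epsilon>)
              (mtensor_lnull \<Delta>) (mtensor_rnull \<Delta>)
              (mtensor_ldistrib \<Delta>) (mtensor_rdistrib \<Delta>)
              (mtensor_braid \<Delta> R))"
  using bialgebra.tight_bimonoidal_Mod[OF assms] braided_bialgebra.tight_braided_bimonoidal_Mod
    symmetric_bialgebra.tight_symmetric_bimonoidal_Mod
  by blast

end
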